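(* Let $\Gamma$ be a compact (not necessarily connected) quantum graph. Let $v_0$ and $v_1$ be (distinct) vertices of $\Gamma$ endowed with $\delta$-type conditions, i.e. for $j=0,1$: $f$ is continuous at $v_j$ and $$\sum_{e\in\mathcal{E}_{v_j}}\frac{df}{dx_e}(v_j)=\alpha_jf(v_j).$$ Arbitrary self-adjoint conditions are allowed at all other vertices of $\Gamma$. Let $\Gamma'$ be the graph obtained from $\Gamma$ by gluing the vertices $v_0$ and $v_1$ together into a single vertex $v$, so that $\mathcal{E}_v=\mathcal{E}_{v_0}\cup\mathcal{E}_{v_1}$, and endowed with the $\delta$-type condition $$\sum_{e\in\mathcal{E}_v}\frac{df}{dx_e}(v)=(\alpha_0+\alpha_1)f(v)$$ at $v$ (with $f$ continuous at $v$), all other conditions being unchanged. Then the eigenvalues of the two graphs satisfy, for every $n\ge1$, $$\lambda_n(\Gamma)\le\lambda_n(\Gamma')\le\lambda_{n+1}(\Gamma).$$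
   Context: A compact quantum graph is a metric graph with finitely many vertices and edges, each edge $e$ being a segment of finite positive length, equipped with the operator $\mathcal{H}$ acting as $-d^2/dx^2+V(x)$ on each edge, where $V\in L_2(\Gamma)$ is real-valued, on functions that belong to $H^2(e)$ on each edge $e$ and satisfy local self-adjoint vertex conditions. Self-adjoint conditions at a vertex $w$ of degree $d_w$ are conditions $A_wF(w)+B_wF'(w)=0$, where $F(w)$ and $F'(w)$ are the column vectors of values and of derivatives of $f$ at $w$ along the incident edges, $A_w,B_w$ are $d_w\times d_w$ complex matrices, $(A_w\ B_w)$ has rank $d_w$ and $A_wB_w^*$ is self-adjoint. The eigenvalues $\lambda_n(\Gamma)$, $n\ge1$, of $\mathcal{H}$ are labeled in non-decreasing order, counting multiplicity. $\mathcal{E}_v$ is the set of edges (edge-ends) incident to $v$; derivatives $\frac{df}{dx_e}(v)$ are taken away from the vertex and into the edge; the coefficients $\alpha_0,\alpha_1$ are real numbers. *)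

theory Defs
  imports
    "HOL-Analysis.Analysis"
    "HOL-Library.Function_Algebras"
    "HOL-Library.Disjoint_Sets"
    "Jordan_Normal_Form.DL_Rank"
    "Jordan_Normal_Form.Schur_Decomposition"
begin

text \<open>
  The edge \<open>e\<close> is the segment \<open>[0, len e]\<close>. Its two ends are \<open>(e, False)\<close>, at \<open>x = 0\<close>,
  and \<open>(e, True)\<close>, at \<open>x = len e\<close>. A vertex is the set of the edge-ends incident to it, so
  that the vertices partition the set of all edge-ends, the degree of a vertex is its
  cardinality, and loops and multiple edges are allowed. Every vertex is incident to at
  least one edge. The vertex condition at \<open>w\<close> is a relation \<open>cond w F F'\<close> between the values
  \<open>F\<close> and the derivatives \<open>F'\<close> along the edge-ends at \<open>w\<close>.
\<close>

type_synonym 'e edge_end = "'e \<times> bool"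
type_synonym 'e vertex = "'e edge_end set"
type_synonym 'e vertex_condition =
  "('e edge_end \<Rightarrow> complex) \<Rightarrow> ('e edge_end \<Rightarrow> complex) \<Rightarrow> bool"

record 'e qgraph =
  edges :: "'e set"
  len :: "'e \<Rightarrow> real"
  pot :: "'e \<Rightarrow> real \<Rightarrow> real"
  vertices :: "'e vertex set"
  cond :: "'e vertex \<Rightarrow> 'e vertex_condition"

text \<open>
  The conditions \<open>A F(w) + B F'(w) = 0\<close> with \<open>(A B)\<close> of full rank and \<open>A B\<^sup>*\<close> self-adjoint; the
  list \<open>es\<close> is the order in which the edge-ends at \<open>w\<close> index the columns of \<open>A\<close> and \<open>B\<close>.
\<close>

definition self_adjoint_condition :: "'e vertex \<Rightarrow> 'e vertex_condition \<Rightarrow> bool" where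
  "self_adjoint_condition w C \<longleftrightarrow>
    (\<exists>es A B. distinct es \<and> set es = w \<and>
      A \<in> carrier_mat (card w) (card w) \<and> B \<in> carrier_mat (card w) (card w) \<and>
      vec_space.rank (card w) (mat_of_cols (card w) (cols A @ cols B)) = card w \<and>
      mat_adjoint (A * mat_adjoint B) = A * mat_adjoint B \<and>
      (\<forall>F F'. C F F' \<longleftrightarrow>
        A *\<^sub>v vec_of_list (map F es) + B *\<^sub>v vec_of_list (map F' es) = 0\<^sub>v (card w)))"

definition delta_condition :: "real \<Rightarrow> 'e vertex \<Rightarrow> 'e vertex_condition" where
  "delta_condition \<alpha> w F F' \<longleftrightarrow>
    (\<forall>a\<in>w. \<forall>b\<in>w. F a = F b) \<and>
    (\<forall>a\<in>w. (\<Sum>b\<in>w. F' b) = complex_of_real \<alpha> * F a)"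

definition L2_on :: "real set \<Rightarrow> (real \<Rightarrow> 'a::euclidean_space) \<Rightarrow> bool" where
  "L2_on S u \<longleftrightarrow> u \<in> borel_measurable (lebesgue_on S) \<and>
    integrable (lebesgue_on S) (\<lambda>x. (norm (u x))\<^sup>2)"

definition compact_quantum_graph :: "'e qgraph \<Rightarrow> bool" where
  "compact_quantum_graph \<Gamma> \<longleftrightarrow>
    finite (edges \<Gamma>) \<and>
    (\<forall>e\<in>edges \<Gamma>. 0 < len \<Gamma> e \<and> L2_on {0..len \<Gamma> e} (pot \<Gamma> e)) \<and>
    partition_on (edges \<Gamma> \<times> UNIV) (vertices \<Gamma>) \<and>
    (\<forall>w\<in>vertices \<Gamma>. self_adjoint_condition w (cond \<Gamma> w))"

definition deriv_on :: "real \<Rightarrow> (real \<Rightarrow> complex) \<Rightarrow> real \<Rightarrow> complex" where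
  "deriv_on l u x = vector_derivative u (at x within {0..l})"

text \<open>
  \<open>u\<close> (the continuously differentiable representative) belongs to \<open>H\<^sup>2(0,l)\<close> with second weak
  derivative \<open>g\<close>: \<open>u\<close> is differentiable on \<open>[0,l]\<close> with one-sided derivatives at the ends, and
  \<open>u'\<close> is absolutely continuous with \<open>u'' = g \<in> L\<^sup>2\<close>, i.e. \<open>u'\<close> is an indefinite integral of \<open>g\<close>.
\<close>

definition has_second_weak_deriv :: "real \<Rightarrow> (real \<Rightarrow> complex) \<Rightarrow> (real \<Rightarrow> complex) \<Rightarrow> bool" where
  "has_second_weak_deriv l u g \<longleftrightarrow>
    (\<forall>x\<in>{0..l}. u differentiable (at x within {0..l})) \<and>
    L2_on {0..l} g \<and>
    (\<forall>x\<in>{0..l}. (g has_integral (deriv_on l u x - deriv_on l u 0)) {0..x})"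

definition H2_edge :: "real \<Rightarrow> (real \<Rightarrow> complex) \<Rightarrow> bool" where
  "H2_edge l u \<longleftrightarrow> (\<exists>g. has_second_weak_deriv l u g)"

definition end_value :: "'e qgraph \<Rightarrow> ('e \<Rightarrow> real \<Rightarrow> complex) \<Rightarrow> 'e edge_end \<Rightarrow> complex" where
  "end_value \<Gamma> f = (\<lambda>(e, b). f e (if b then len \<Gamma> e else 0))"

text \<open>Derivatives at the edge-ends are taken away from the vertex and into the edge.\<close>

definition end_deriv :: "'e qgraph \<Rightarrow> ('e \<Rightarrow> real \<Rightarrow> complex) \<Rightarrow> 'e edge_end \<Rightarrow> complex" where
  "end_deriv \<Gamma> f = (\<lambda>(e, b).
    if b then - deriv_on (len \<Gamma> e) (f e) (len \<Gamma> e) else deriv_on (len \<Gamma> e) (f e) 0)"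

text \<open>
  A function on \<open>\<Gamma>\<close> is a total function that vanishes off \<open>\<Gamma>\<close>, so that dimensions of function
  spaces on \<open>\<Gamma>\<close> can be taken in the type of total functions.
\<close>

definition op_domain :: "'e qgraph \<Rightarrow> ('e \<Rightarrow> real \<Rightarrow> complex) set" where
  "op_domain \<Gamma> = {f.
    (\<forall>e x. \<not> (e \<in> edges \<Gamma> \<and> x \<in> {0..len \<Gamma> e}) \<longrightarrow> f e x = 0) \<and>
    (\<forall>e\<in>edges \<Gamma>. H2_edge (len \<Gamma> e) (f e)) \<and>
    (\<forall>w\<in>vertices \<Gamma>. cond \<Gamma> w (end_value \<Gamma> f) (end_deriv \<Gamma> f))}"

text \<open>
  \<open>op_maps_to \<Gamma> f h\<close>: \<open>f\<close> is in the domain of the operator \<open>-d\<^sup>2/dx\<^sup>2 + V\<close>, which maps \<open>f\<close> to (the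
  \<open>L\<^sup>2\<close>-class of) \<open>h\<close>.
\<close>

definition op_maps_to ::
  "'e qgraph \<Rightarrow> ('e \<Rightarrow> real \<Rightarrow> complex) \<Rightarrow> ('e \<Rightarrow> real \<Rightarrow> complex) \<Rightarrow> bool" where
  "op_maps_to \<Gamma> f h \<longleftrightarrow> f \<in> op_domain \<Gamma> \<and>
    (\<forall>e\<in>edges \<Gamma>. \<exists>g. has_second_weak_deriv (len \<Gamma> e) (f e) g \<and>
      (AE x in lebesgue_on {0..len \<Gamma> e}.
        h e x = - g x + complex_of_real (pot \<Gamma> e x) * f e x))"

definition scale_fun ::
  "complex \<Rightarrow> ('e \<Rightarrow> real \<Rightarrow> complex) \<Rightarrow> 'e \<Rightarrow> real \<Rightarrow> complex" where
  "scale_fun c f = (\<lambda>e x. c * f e x)"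

lemma vector_space_scale_fun: "vector_space scale_fun"
  by unfold_locales (auto simp: scale_fun_def fun_eq_iff algebra_simps)

definition qg_eigenspace :: "'e qgraph \<Rightarrow> complex \<Rightarrow> ('e \<Rightarrow> real \<Rightarrow> complex) set" where
  "qg_eigenspace \<Gamma> z = {f. op_maps_to \<Gamma> f (scale_fun z f)}"

definition multiplicity_of :: "'e qgraph \<Rightarrow> complex \<Rightarrow> nat" where
  "multiplicity_of \<Gamma> z = vector_space.dim scale_fun (qg_eigenspace \<Gamma> z)"

text \<open>
  \<open>lam 1, lam 2, \<dots>\<close> lists the eigenvalues in non-decreasing order, each as often as its
  multiplicity; \<open>lam 0\<close> is irrelevant. The finiteness clause is needed because \<open>card\<close> of an
  infinite set is \<open>0\<close>.
\<close>

definition lists_eigenvalues :: "'e qgraph \<Rightarrow> (nat \<Rightarrow> real) \<Rightarrow> bool" where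
  "lists_eigenvalues \<Gamma> lam \<longleftrightarrow> mono_on {1..} lam \<and>
    (\<forall>z. finite {n\<in>{1..}. complex_of_real (lam n) = z} \<and>
         card {n\<in>{1..}. complex_of_real (lam n) = z} = multiplicity_of \<Gamma> z)"

definition qg_eigenvalue :: "'e qgraph \<Rightarrow> nat \<Rightarrow> real" where
  "qg_eigenvalue \<Gamma> = (SOME lam. lists_eigenvalues \<Gamma> lam)"

definition glue :: "'e qgraph \<Rightarrow> 'e vertex \<Rightarrow> 'e vertex \<Rightarrow> real \<Rightarrow> 'e qgraph" where
  "glue \<Gamma> v\<^sub>0 v\<^sub>1 \<alpha> = \<Gamma>\<lparr>
    vertices := insert (v\<^sub>0 \<union> v\<^sub>1) (vertices \<Gamma> - {v\<^sub>0, v\<^sub>1}),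
    cond := (cond \<Gamma>)(v\<^sub>0 \<union> v\<^sub>1 := delta_condition \<alpha> (v\<^sub>0 \<union> v\<^sub>1))\<rparr>"

end

theory Submission
  imports Defs "HOL-Complex_Analysis.Great_Picard"
begin

text \<open>
  Fix \<open>\<mu>\<close> below both spectra. On the space of functions continuous on the edges, with the \<open>L\<^sup>2\<close> inner product,
  the resolvents \<open>G\<close> and \<open>G'\<close> at \<open>\<mu>\<close> of the two operators are positive and compact: on each edge one
  solves an initial value problem, and the boundary data are matched because the vertex conditions
  and the Cauchy data of solutions are transversal Lagrangian subspaces. So the eigenvalues are
  \<open>\<mu> + 1 / s n\<close>, where \<open>s\<close> is the decreasing sequence of eigenvalues of the resolvent.

  For given \<open>h\<close>, the functions \<open>G h\<close> and \<open>G' h\<close> solve the same equation on the edges, and by Green's formula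
  \<open>(G h, h) - (G' h, h)\<close> is the energy of \<open>G h - G' h\<close>, hence nonnegative; it vanishes if \<open>G h\<close> takes the same
  value at the two vertices, which is one linear condition on \<open>h\<close>. The Courant--Fischer principle
  turns this into \<open>s' n \<le> s n\<close> and \<open>s (n + 1) \<le> s' n\<close>.
\<close>

section \<open>Lagrangian boundary conditions\<close>

text \<open>Arbitrary vertex conditions are handled through boundary data alone: the two operators
  share edges, lengths and potential and differ only in the Lagrangian relations \<open>L\<close>
  and \<open>L'\<close> on the edge-ends. Every pair in \<open>L'\<close> takes equal values at two
  chosen edge-ends \<open>i\<close> and \<open>j\<close>, one at each of the two vertices, and
  enters \<open>L\<close> after an amount \<open>t\<close> of derivative is moved from
  \<open>i\<close> to \<open>j\<close>. The comparison of the resolvents rests on this rank-one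
  relation, which explains the index shift by one. A suitable \<mu> exists because a Lagrangian
  relation bounds its boundary form by a constant times the sum of |F|^2, and a trace inequality
  absorbs the boundary values and the integral of V |u|^2 into half of the Dirichlet integral and a
  large multiple of the mass. Continuous functions with the L2 product form an incomplete space, so
  the limit that yields an eigenvector has to come from compactness of the resolvent, by
  Arzela-Ascoli. Since \<open>qg_eigenvalue\<close> is a choice among listings, all listings must
  also be shown to agree.\<close>

lemma homogeneous_system_nontrivial:
  fixes a :: "'i \<Rightarrow> 'j \<Rightarrow> complex"
  assumes "finite I" "finite J" "card I < card J"
  shows "\<exists>c. (\<exists>j\<in>J. c j \<noteq> 0) \<and> (\<forall>i\<in>I. (\<Sum>j\<in>J. c j * a i j) = 0)"
  using assms
proof (induction I arbitrary: J a rule: finite_induct)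
  case empty
  then have "J \<noteq> {}" by auto
  then show ?case by (auto intro!: exI[of _ "\<lambda>_. 1"])
next
  case (insert k I)
  show ?case
  proof (cases "\<forall>j\<in>J. a k j = 0")
    case True
    have "card I < card J" using insert by simp
    from insert.IH[OF \<open>finite J\<close> this, of a] obtain c where
      "\<exists>j\<in>J. c j \<noteq> 0" "\<forall>i\<in>I. (\<Sum>j\<in>J. c j * a i j) = 0" by blast
    with True show ?thesis by (intro exI[of _ c]) auto
  next
    case False
    then obtain p where p: "p \<in> J" "a k p \<noteq> 0" by blast
    have "card I < card (J - {p})" using insert p by simp
    \<comment> \<open>Gaussian elimination: equation \<open>k\<close> is solved for the unknown
      \<open>p\<close> and substituted into the others; \<open>c'\<close> restores the value at
      \<open>p\<close> that equation \<open>k\<close> prescribes.\<close>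
    from insert.IH[OF _ this, of "\<lambda>i j. a i j - a k j / a k p * a i p"] \<open>finite J\<close>
    obtain c where c: "\<exists>j\<in>J - {p}. c j \<noteq> 0"
      "\<forall>i\<in>I. (\<Sum>j\<in>J - {p}. c j * (a i j - a k j / a k p * a i p)) = 0" by auto
    define s where "s = (\<Sum>j\<in>J - {p}. c j * a k j)"
    define c' where "c' = c(p := - s / a k p)"
    have sum: "(\<Sum>j\<in>J. c' j * a i j) = - s / a k p * a i p + (\<Sum>j\<in>J - {p}. c j * a i j)" for i
      using p \<open>finite J\<close> by (subst sum.remove[of J p]) (auto simp: c'_def intro!: sum.cong)
    have "(\<Sum>j\<in>J. c' j * a k j) = 0"
      unfolding sum using p by (simp add: s_def)
    moreover have "(\<Sum>j\<in>J. c' j * a i j) = 0" if "i \<in> I" for i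
    proof -
      have "0 = (\<Sum>j\<in>J - {p}. c j * a i j - (c j * a k j) * (a i p / a k p))"
        using c(2) that by (auto simp: algebra_simps)
      also have "\<dots> = (\<Sum>j\<in>J - {p}. c j * a i j) - s * (a i p / a k p)"
        by (simp add: sum_subtractf s_def sum_distrib_right sum_divide_distrib)
      finally show ?thesis unfolding sum by simp
    qed
    moreover have "\<exists>j\<in>J. c' j \<noteq> 0" using c(1) by (auto simp: c'_def)
    ultimately show ?thesis by blast
  qed
qed

lemma sum_fun_apply: "(\<Sum>i\<in>A. f i) x = (\<Sum>i\<in>A. f i x)"
  for f :: "'a \<Rightarrow> 'b \<Rightarrow> 'c::comm_monoid_add"
  by (induction A rule: infinite_finite_induct) auto

text \<open>The hypothesis \<open>off\<close> makes membership in \<open>S\<close> depend on the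
  coordinates in \<open>I\<close> only, although \<open>S\<close> consists of total functions. A
  linear functional that kills a basis of \<open>S\<close> and is 1 at \<open>x\<close> is therefore
  determined by its values \<open>d\<close> on the unit vectors of \<open>I\<close>.\<close>

lemma separating_functional:
  fixes S :: "('i \<Rightarrow> complex) set"
  assumes "finite I"
    and add: "\<And>f g. f \<in> S \<Longrightarrow> g \<in> S \<Longrightarrow> (\<lambda>i. f i + g i) \<in> S"
    and scale: "\<And>c f. f \<in> S \<Longrightarrow> (\<lambda>i. c * f i) \<in> S"
    and off: "\<And>f. \<forall>i\<in>I. f i = 0 \<Longrightarrow> f \<in> S"
    and "x \<notin> S"
  obtains d where "\<And>y. y \<in> S \<Longrightarrow> (\<Sum>i\<in>I. y i * d i) = 0" "(\<Sum>i\<in>I. x i * d i) \<noteq> 0"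
proof -
  define sc where "sc = (\<lambda>(c::complex) (f::'i \<Rightarrow> complex) i. c * f i)"
  interpret V: vector_space sc
    by unfold_locales (auto simp: sc_def fun_eq_iff algebra_simps)
  interpret W: vector_space "(*) :: complex \<Rightarrow> complex \<Rightarrow> complex"
    by unfold_locales (auto simp: algebra_simps)
  interpret VW: vector_space_pair sc "(*) :: complex \<Rightarrow> complex \<Rightarrow> complex" ..
  have S: "V.subspace S"
  proof (rule V.subspaceI)
    show "0 \<in> S" by (rule off) auto
    show "f + g \<in> S" if "f \<in> S" "g \<in> S" for f g
      using add[OF that] by (simp add: plus_fun_def)
    show "sc c f \<in> S" if "f \<in> S" for c f
      using scale[OF that] by (simp add: sc_def)
  qed
  obtain B where B: "B \<subseteq> S" "V.independent B" "S \<subseteq> V.span B"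
    using V.maximal_independent_subset[of S] by blast
  have span: "V.span B = S" using B S by (meson V.span_minimal subset_antisym)
  have "V.independent (insert x B)"
    using B span \<open>x \<notin> S\<close> by (simp add: V.independent_insertI)
  from VW.linear_independent_extend[OF this, of "\<lambda>b. if b = x then 1 else 0"]
  obtain g where g: "Vector_Spaces.linear sc (*) g"
    "\<forall>b\<in>insert x B. g b = (if b = x then 1 else 0)" by blast
  have "x \<notin> B" using B \<open>x \<notin> S\<close> by auto
  have gS: "g y = 0" if "y \<in> S" for y
  proof -
    have "y \<in> V.span B" using that span by simp
    moreover have "g b = 0" if "b \<in> B" for b using g(2) that \<open>x \<notin> B\<close> by auto
    ultimately show ?thesis
      by (rule VW.linear_eq_0_on_span[OF g(1), rotated])
  qed
  define d where "d i = g (\<lambda>j. if j = i then 1 else 0)" for i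
  have gI: "g f = (\<Sum>i\<in>I. f i * d i)" for f
  proof -
    define h where "h = (\<Sum>i\<in>I. sc (f i) (\<lambda>j. if j = i then 1 else 0))"
    have "h j = f j" if "j \<in> I" for j
      using that \<open>finite I\<close> by (simp add: h_def sc_def sum_fun_apply if_distrib cong: if_cong)
    then have "f - h \<in> S" by (intro off) auto
    then have "g (f - h) = 0" by (rule gS)
    then have "g f = g h" by (simp add: VW.linear_diff[OF g(1)])
    also have "\<dots> = (\<Sum>i\<in>I. f i * d i)"
      by (simp add: h_def d_def VW.linear_sum[OF g(1)] VW.linear_scale[OF g(1)])
    finally show ?thesis .
  qed
  show thesis
    using that[of d] gS g(2) unfolding gI by auto
qed

text \<open>
  The pairs in \<open>L\<close> are those annihilated by \<open>L\<close> under the symplectic form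
  \<open>\<Sum>i. F' i * cnj (G i) - F i * cnj (G' i)\<close>; in particular \<open>L\<close> is a linear subspace and only
  depends on restrictions to \<open>I\<close>.
\<close>

definition lagrangian ::
    "'i set \<Rightarrow> (('i \<Rightarrow> complex) \<Rightarrow> ('i \<Rightarrow> complex) \<Rightarrow> bool) \<Rightarrow> bool" where
  "lagrangian I L \<longleftrightarrow> (\<forall>F F'. L F F' \<longleftrightarrow>
    (\<forall>G G'. L G G' \<longrightarrow> (\<Sum>i\<in>I. F' i * cnj (G i)) = (\<Sum>i\<in>I. F i * cnj (G' i))))"

section \<open>Linear structure of Lagrangian relations\<close>

lemma lagrangian_isotropic:
  "lagrangian I L \<Longrightarrow> L F F' \<Longrightarrow> L G G' \<Longrightarrow>
    (\<Sum>i\<in>I. F' i * cnj (G i)) = (\<Sum>i\<in>I. F i * cnj (G' i))"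
  unfolding lagrangian_def by blast

lemma lagrangian_maximal:
  "lagrangian I L \<Longrightarrow>
    (\<And>G G'. L G G' \<Longrightarrow> (\<Sum>i\<in>I. F' i * cnj (G i)) = (\<Sum>i\<in>I. F i * cnj (G' i))) \<Longrightarrow> L F F'"
  unfolding lagrangian_def by blast

lemma lagrangian_vanishing:
  "lagrangian I L \<Longrightarrow> \<forall>i\<in>I. F i = 0 \<and> F' i = 0 \<Longrightarrow> L F F'"
  by (erule lagrangian_maximal) auto

lemma lagrangian_add:
  assumes "lagrangian I L" "L F F'" "L G G'"
  shows "L (\<lambda>i. F i + G i) (\<lambda>i. F' i + G' i)"
proof (rule lagrangian_maximal[OF assms(1)])
  fix H H' assume H: "L H H'"
  show "(\<Sum>i\<in>I. (F' i + G' i) * cnj (H i)) = (\<Sum>i\<in>I. (F i + G i) * cnj (H' i))"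
    using lagrangian_isotropic[OF assms(1), OF assms(2) H] lagrangian_isotropic[OF assms(1), OF assms(3) H]
    by (simp add: distrib_right sum.distrib)
qed

lemma lagrangian_scale:
  assumes "lagrangian I L" "L F F'"
  shows "L (\<lambda>i. c * F i) (\<lambda>i. c * F' i)"
proof (rule lagrangian_maximal[OF assms(1)])
  fix H H' assume H: "L H H'"
  show "(\<Sum>i\<in>I. c * F' i * cnj (H i)) = (\<Sum>i\<in>I. c * F i * cnj (H' i))"
    using lagrangian_isotropic[OF assms(1), OF assms(2) H]
    by (simp add: mult.assoc flip: sum_distrib_left)
qed

lemma lagrangian_diff:
  assumes "lagrangian I L" "L F F'" "L G G'"
  shows "L (\<lambda>i. F i - G i) (\<lambda>i. F' i - G' i)"
  using lagrangian_add[OF assms(1), OF assms(2) lagrangian_scale[OF assms(1), OF assms(3), of "-1"]] by simp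

lemma lagrangian_cong:
  assumes "lagrangian I L" "L F F'" "\<And>i. i \<in> I \<Longrightarrow> F i = G i" "\<And>i. i \<in> I \<Longrightarrow> F' i = G' i"
  shows "L G G'"
proof (rule lagrangian_maximal[OF assms(1)])
  fix H H' assume H: "L H H'"
  show "(\<Sum>i\<in>I. G' i * cnj (H i)) = (\<Sum>i\<in>I. G i * cnj (H' i))"
    using lagrangian_isotropic[OF assms(1), OF assms(2) H] assms(3,4) by simp
qed

text \<open>
  The fibre of \<open>L\<close> over \<open>F = 0\<close> is orthogonal to all \<open>F\<close> occurring in \<open>L\<close>, so \<open>F'\<close> may be
  replaced by \<open>S F\<close> for any linear section \<open>S\<close> of \<open>L \<rightarrow> F\<close>.
\<close>

lemma lagrangian_form_bounded:
  fixes L :: "('i \<Rightarrow> complex) \<Rightarrow> ('i \<Rightarrow> complex) \<Rightarrow> bool"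
  assumes "finite I" and L: "lagrangian I L"
  obtains C where "C \<ge> 0"
    "\<And>F F'. L F F' \<Longrightarrow> cmod (\<Sum>i\<in>I. F' i * cnj (F i)) \<le> C * (\<Sum>i\<in>I. (cmod (F i))\<^sup>2)"
proof -
  define sc where "sc = (\<lambda>(c::complex) (f::'i \<Rightarrow> complex) i. c * f i)"
  interpret V: vector_space sc
    by unfold_locales (auto simp: sc_def fun_eq_iff algebra_simps)
  interpret VV: vector_space_pair sc sc ..
  define D where "D = {F. \<exists>F'. L F F'}"
  obtain B where B: "B \<subseteq> D" "V.independent B" "D \<subseteq> V.span B"
    using V.maximal_independent_subset[of D] by blast
  define s where "s F = (SOME F'. L F F')" for F
  have s: "L F (s F)" if "F \<in> D" for F
    using that unfolding D_def s_def by (simp add: someI_ex)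
  \<comment> \<open>The section: arbitrary choices \<open>s\<close> on a basis of \<open>D\<close>,
    extended linearly; \<open>LS\<close> confirms that it stays in \<open>L\<close>.\<close>
  obtain S where S: "Vector_Spaces.linear sc sc S" "\<forall>b\<in>B. S b = s b"
    using VV.linear_independent_extend[OF B(2), of s] by blast
  have LS: "L F (S F)" if "F \<in> V.span B" for F
    using that
  proof (induction rule: V.span_induct_alt)
    case base
    have "S 0 = 0" using S(1) by (rule VV.linear_0)
    then show ?case by (simp only:) (intro lagrangian_vanishing[OF L], auto)
  next
    case (step c x y)
    have "L x (S x)" using step S(2) s B(1) by auto
    then have "L (\<lambda>i. c * x i + y i) (\<lambda>i. c * S x i + S y i)"
      using step by (intro lagrangian_add[OF L, OF lagrangian_scale[OF L]]) auto
    moreover have "S (sc c x + y) = sc c (S x) + S y"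
      by (simp only: VV.linear_add[OF S(1)] VV.linear_scale[OF S(1)])
    moreover have "sc c (S x) + S y = (\<lambda>i. c * S x i + S y i)"
      by (simp add: plus_fun_def sc_def)
    moreover have "sc c x + y = (\<lambda>i. c * x i + y i)" by (simp add: plus_fun_def sc_def)
    ultimately show ?case by simp
  qed
  define T where "T i j = cmod (S (\<lambda>k. if k = i then 1 else 0) j)" for i j
  define M where "M = (\<Sum>i\<in>I. \<Sum>j\<in>I. T i j)"
  have T0: "T i j \<ge> 0" for i j by (simp add: T_def)
  have TM: "T i j \<le> M" if "i \<in> I" "j \<in> I" for i j
  proof -
    have "T i j \<le> (\<Sum>j\<in>I. T i j)" using that \<open>finite I\<close> T0 by (intro member_le_sum) auto
    also have "\<dots> \<le> M" unfolding M_def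
      using that \<open>finite I\<close> T0 by (intro member_le_sum) (auto intro: sum_nonneg)
    finally show ?thesis .
  qed
  have M0: "M \<ge> 0" unfolding M_def by (intro sum_nonneg T0)
  show thesis
  proof
    show "M * card I \<ge> 0" using M0 by simp
    fix F F' assume LF: "L F F'"
    \<comment> \<open>Truncation to \<open>I\<close> makes \<open>F\<close> a finite combination of
      unit vectors, so that \<open>S F0\<close> is given by a matrix with entries bounded by
      \<open>M\<close>.\<close>
    define F0 where "F0 i = (if i \<in> I then F i else 0)" for i
    have LF0: "L F0 F'" using lagrangian_cong[OF L, OF LF] by (auto simp: F0_def)
    then have "F0 \<in> D" by (auto simp: D_def)
    then have LS0: "L F0 (S F0)" using LS B by auto
    have "L (\<lambda>i. 0) (\<lambda>i. F' i - S F0 i)"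
      using lagrangian_diff[OF L, OF LF0 LS0] by simp
    from lagrangian_isotropic[OF L, OF this LF0]
    have "(\<Sum>i\<in>I. F' i * cnj (F0 i)) = (\<Sum>i\<in>I. S F0 i * cnj (F0 i))"
      by (simp add: left_diff_distrib sum_subtractf)
    then have eq: "(\<Sum>i\<in>I. F' i * cnj (F i)) = (\<Sum>i\<in>I. S F0 i * cnj (F i))"
      by (simp add: F0_def)
    have F0eq: "F0 = (\<Sum>i\<in>I. sc (F i) (\<lambda>k. if k = i then 1 else 0))"
      using \<open>finite I\<close> by (auto simp: F0_def sc_def fun_eq_iff sum_fun_apply if_distrib cong: if_cong)
    have SF0: "S F0 j = (\<Sum>i\<in>I. F i * S (\<lambda>k. if k = i then 1 else 0) j)" for j
      unfolding F0eq
      by (simp add: VV.linear_sum[OF S(1)] VV.linear_scale[OF S(1)] sum_fun_apply)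
         (simp add: sc_def)
    have "cmod (\<Sum>j\<in>I. S F0 j * cnj (F j)) \<le> (\<Sum>j\<in>I. \<Sum>i\<in>I. cmod (F i) * T i j * cmod (F j))"
      unfolding SF0 sum_distrib_right
      by (intro order_trans[OF norm_sum] sum_mono order_trans[OF norm_sum])
         (auto simp: norm_mult T_def)
    also have "\<dots> \<le> (\<Sum>j\<in>I. \<Sum>i\<in>I. M / 2 * ((cmod (F i))\<^sup>2 + (cmod (F j))\<^sup>2))"
    proof (intro sum_mono)
      fix i j assume ij: "i \<in> I" "j \<in> I"
      have "cmod (F i) * T i j * cmod (F j) = T i j * (cmod (F i) * cmod (F j))" by simp
      also have "\<dots> \<le> M * (cmod (F i) * cmod (F j))"
        using TM[OF ij] by (intro mult_right_mono) auto
      also have "\<dots> \<le> M * (((cmod (F i))\<^sup>2 + (cmod (F j))\<^sup>2) / 2)"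
        using sum_squares_bound[of "cmod (F i)" "cmod (F j)"] M0 by (intro mult_left_mono) auto
      finally show "cmod (F i) * T i j * cmod (F j) \<le> M / 2 * ((cmod (F i))\<^sup>2 + (cmod (F j))\<^sup>2)"
        by simp
    qed
    also have "\<dots> = M / 2 * ((\<Sum>j\<in>I. \<Sum>i\<in>I. (cmod (F i))\<^sup>2) + (\<Sum>j\<in>I. \<Sum>i\<in>I. (cmod (F j))\<^sup>2))"
      by (simp only: sum.distrib distrib_left sum_distrib_left)
    also have "\<dots> = M * card I * (\<Sum>i\<in>I. (cmod (F i))\<^sup>2)"
      by (simp flip: sum_distrib_left)
    finally show "cmod (\<Sum>i\<in>I. F' i * cnj (F i)) \<le> M * card I * (\<Sum>i\<in>I. (cmod (F i))\<^sup>2)"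
      using eq by simp
  qed
qed

text \<open>If \<open>L + K\<close> were a proper subspace, some nonzero functional would vanish on
  it. The symplectic form is nondegenerate and represents this functional by a pair
  \<open>(Y, Y')\<close>, which is then annihilated by \<open>L\<close> and by \<open>K\<close>.
  Maximality puts it into both relations, so it vanishes on \<open>I\<close>, a
  contradiction.\<close>

lemma lagrangian_transversal:
  fixes L K :: "('i \<Rightarrow> complex) \<Rightarrow> ('i \<Rightarrow> complex) \<Rightarrow> bool"
  assumes "finite I" and L: "lagrangian I L" and K: "lagrangian I K"
    and disj: "\<And>F F'. L F F' \<Longrightarrow> K F F' \<Longrightarrow> \<forall>i\<in>I. F i = 0 \<and> F' i = 0"
  obtains G G' where "K G G'" "L (\<lambda>i. P i + G i) (\<lambda>i. P' i + G' i)"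
proof -
  define enc where "enc F F' = (\<lambda>(i, b). if b then F' i else F i)" for F F' :: "'i \<Rightarrow> complex"
  define S where "S = {x. \<exists>F F' G G'. L F F' \<and> K G G' \<and>
      x = enc (\<lambda>i. F i + G i) (\<lambda>i. F' i + G' i)}"
  have "enc P P' \<in> S"
  proof (rule ccontr)
    assume notin: "enc P P' \<notin> S"
    have "finite (I \<times> (UNIV :: bool set))" using \<open>finite I\<close> by simp
    then obtain d where d: "\<And>y. y \<in> S \<Longrightarrow> (\<Sum>i\<in>I \<times> UNIV. y i * d i) = 0"
      "(\<Sum>i\<in>I \<times> UNIV. enc P P' i * d i) \<noteq> 0"
    proof (rule separating_functional[where S = S])
      show "(\<lambda>i. f i + g i) \<in> S" if fS: "f \<in> S" and gS: "g \<in> S" for f g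
      proof -
        from fS obtain F F' G G' where f: "L F F'" "K G G'"
          "f = enc (\<lambda>i. F i + G i) (\<lambda>i. F' i + G' i)" unfolding S_def by blast
        from gS obtain F2 F2' G2 G2' where g: "L F2 F2'" "K G2 G2'"
          "g = enc (\<lambda>i. F2 i + G2 i) (\<lambda>i. F2' i + G2' i)" unfolding S_def by blast
        show ?thesis unfolding S_def mem_Collect_eq
          using lagrangian_add[OF L, OF f(1) g(1)] lagrangian_add[OF K, OF f(2) g(2)]
          by (intro exI conjI) (assumption, assumption, auto simp: f g enc_def fun_eq_iff)
      qed
      show "(\<lambda>i. c * f i) \<in> S" if fS: "f \<in> S" for c f
      proof -
        from fS obtain F F' G G' where f: "L F F'" "K G G'"
          "f = enc (\<lambda>i. F i + G i) (\<lambda>i. F' i + G' i)" unfolding S_def by blast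
        show ?thesis unfolding S_def mem_Collect_eq
          using lagrangian_scale[OF L, OF f(1)] lagrangian_scale[OF K, OF f(2)]
          by (intro exI conjI) (assumption, assumption, auto simp: f enc_def fun_eq_iff algebra_simps)
      qed
      show "f \<in> S" if "\<forall>i\<in>I \<times> UNIV. f i = 0" for f
      proof -
        have "L (\<lambda>i. f (i, False)) (\<lambda>i. f (i, True))"
          using that by (intro lagrangian_vanishing[OF L]) auto
        moreover have "K (\<lambda>i. 0) (\<lambda>i. 0)" by (intro lagrangian_vanishing[OF K]) auto
        ultimately show ?thesis unfolding S_def mem_Collect_eq
          by (intro exI conjI) (assumption, assumption, auto simp: enc_def fun_eq_iff)
      qed
    qed (use notin in auto)
    \<comment> \<open>The representative of \<open>d\<close> under the symplectic form; the
      conjugation and the sign are those of the form.\<close>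
    define Y where "Y i = cnj (d (i, True))" for i
    define Y' where "Y' i = - cnj (d (i, False))" for i
    have sum: "(\<Sum>i\<in>I \<times> UNIV. enc F F' i * d i)
        = (\<Sum>i\<in>I. F' i * cnj (Y i)) - (\<Sum>i\<in>I. F i * cnj (Y' i))" for F F'
    proof -
      have "(\<Sum>i\<in>I \<times> UNIV. enc F F' i * d i) = (\<Sum>i\<in>I. \<Sum>b\<in>UNIV. enc F F' (i, b) * d (i, b))"
        by (simp add: sum.cartesian_product case_prod_unfold)
      also have "\<dots> = (\<Sum>i\<in>I. F' i * cnj (Y i) - F i * cnj (Y' i))"
        by (simp add: UNIV_bool enc_def Y_def Y'_def add.commute)
      finally show ?thesis by (simp add: sum_subtractf)
    qed
    have ann: "M Y Y'" if M: "lagrangian I M" and MS: "\<And>F F'. M F F' \<Longrightarrow> enc F F' \<in> S" for M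
    proof (rule lagrangian_maximal[OF M])
      fix G G' assume "M G G'"
      then have "(\<Sum>i\<in>I. G' i * cnj (Y i)) = (\<Sum>i\<in>I. G i * cnj (Y' i))"
        using d(1)[OF MS] sum by auto
      then have "cnj (\<Sum>i\<in>I. G' i * cnj (Y i)) = cnj (\<Sum>i\<in>I. G i * cnj (Y' i))" by simp
      then show "(\<Sum>i\<in>I. Y' i * cnj (G i)) = (\<Sum>i\<in>I. Y i * cnj (G' i))"
        by (simp add: mult.commute)
    qed
    have "L Y Y'"
    proof (rule ann[OF L])
      show "enc F F' \<in> S" if "L F F'" for F F'
        unfolding S_def mem_Collect_eq using that lagrangian_vanishing[OF K, of "\<lambda>_. 0" "\<lambda>_. 0"]
        by (intro exI[of _ F] exI[of _ F'] exI[of _ "\<lambda>_. 0"]) (auto simp: enc_def fun_eq_iff)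
    qed
    moreover have "K Y Y'"
    proof (rule ann[OF K])
      show "enc F F' \<in> S" if "K F F'" for F F'
        unfolding S_def mem_Collect_eq using that lagrangian_vanishing[OF L, of "\<lambda>_. 0" "\<lambda>_. 0"]
        by (intro exI[of _ "\<lambda>_. 0"] exI[of _ F] exI[of _ F']) (auto simp: enc_def fun_eq_iff)
    qed
    ultimately have "\<forall>i\<in>I. Y i = 0 \<and> Y' i = 0" by (rule disj)
    then show False using d(2) unfolding sum by simp
  qed
  then obtain F F' G G' where *: "L F F'" "K G G'"
    "enc P P' = enc (\<lambda>i. F i + G i) (\<lambda>i. F' i + G' i)" unfolding S_def by blast
  have PP: "P i = F i + G i" "P' i = F' i + G' i" for i
    using fun_cong[OF *(3), of "(i, False)"] fun_cong[OF *(3), of "(i, True)"]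
    by (auto simp: enc_def)
  show thesis
  proof
    show "K (\<lambda>i. -1 * G i) (\<lambda>i. -1 * G' i)" using *(2) by (rule lagrangian_scale[OF K])
    show "L (\<lambda>i. P i + -1 * G i) (\<lambda>i. P' i + -1 * G' i)" using *(1) by (simp add: PP)
  qed
qed

text \<open>The right-hand side becomes an additional column, indexed by \<open>None\<close>, so
  there is one unknown more than equations. A nontrivial solution has nonzero coefficient at
  \<open>None\<close> by injectivity, and dividing by it solves the system.\<close>

lemma square_system_solvable:
  fixes m :: "'i \<Rightarrow> 'i \<Rightarrow> complex"
  assumes "finite I"
    and inj: "\<And>y. \<forall>i\<in>I. (\<Sum>j\<in>I. m i j * y j) = 0 \<Longrightarrow> \<forall>j\<in>I. y j = 0"
  obtains y where "\<forall>i\<in>I. (\<Sum>j\<in>I. m i j * y j) = p i"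
proof -
  define J where "J = insert None (Some ` I)"
  have "finite J" "card I < card J"
    using \<open>finite I\<close> by (auto simp: J_def card_image)
  from homogeneous_system_nontrivial[OF \<open>finite I\<close> this,
      of "\<lambda>i j. case j of None \<Rightarrow> - p i | Some j \<Rightarrow> m i j"]
  obtain c where c: "\<exists>j\<in>J. c j \<noteq> 0"
    "\<forall>i\<in>I. (\<Sum>j\<in>J. c j * (case j of None \<Rightarrow> - p i | Some j \<Rightarrow> m i j)) = 0" by blast
  have sum: "(\<Sum>j\<in>I. m i j * c (Some j)) = c None * p i" if "i \<in> I" for i
  proof -
    have "0 = (\<Sum>j\<in>J. c j * (case j of None \<Rightarrow> - p i | Some j \<Rightarrow> m i j))" using c(2) that by simp
    also have "\<dots> = - c None * p i + (\<Sum>j\<in>I. c (Some j) * m i j)"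
      using \<open>finite I\<close> unfolding J_def by (subst sum.insert) (auto simp: sum.reindex)
    finally show ?thesis by (simp add: mult.commute)
  qed
  have "c None \<noteq> 0"
  proof
    assume 0: "c None = 0"
    with sum have "\<forall>i\<in>I. (\<Sum>j\<in>I. m i j * c (Some j)) = 0" by simp
    then have "\<forall>j\<in>I. c (Some j) = 0" by (rule inj)
    with 0 c(1) show False by (auto simp: J_def)
  qed
  show thesis
  proof
    show "\<forall>i\<in>I. (\<Sum>j\<in>I. m i j * (c (Some j) / c None)) = p i"
      using sum \<open>c None \<noteq> 0\<close> by (auto simp flip: sum_divide_distrib)
  qed
qed

text \<open>
  Isotropy: with \<open>p = F - \<i> F'\<close> and \<open>q = F + \<i> F'\<close> the condition reads \<open>(A + \<i> B) p + (A - \<i> B) q = 0\<close>,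
  and \<open>(A + \<i> B)(A + \<i> B)\<^sup>* = A A\<^sup>* + B B\<^sup>* = (A - \<i> B)(A - \<i> B)\<^sup>*\<close> is invertible, so \<open>q \<mapsto> p\<close> is unitary.
\<close>

lemma lagrangian_matrix_condition:
  fixes a b :: "'i \<Rightarrow> 'i \<Rightarrow> complex"
  assumes "finite I"
    and sa: "\<And>i k. i \<in> I \<Longrightarrow> k \<in> I \<Longrightarrow>
      (\<Sum>j\<in>I. a i j * cnj (b k j)) = (\<Sum>j\<in>I. b i j * cnj (a k j))"
    and rank: "\<And>z. \<forall>j\<in>I. (\<Sum>i\<in>I. z i * a i j) = 0 \<and> (\<Sum>i\<in>I. z i * b i j) = 0 \<Longrightarrow> \<forall>i\<in>I. z i = 0"
  shows "lagrangian I (\<lambda>F F'. \<forall>i\<in>I. (\<Sum>j\<in>I. a i j * F j) + (\<Sum>j\<in>I. b i j * F' j) = 0)"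
    (is "lagrangian I ?L")
proof -
  define n where "n i k = (\<Sum>j\<in>I. a i j * cnj (a k j) + b i j * cnj (b k j))" for i k
  define m where "m s i j = a i j + s * b i j" for s i j
  have mm: "(\<Sum>j\<in>I. m s i j * cnj (m s k j)) = n i k"
    if "i \<in> I" "k \<in> I" "s = \<i> \<or> s = - \<i>" for s i k
  proof -
    have s: "cnj s = - s" "s * s = -1" using that(3) by auto
    have "m s i j * cnj (m s k j) = (a i j * cnj (a k j) + b i j * cnj (b k j))
        + s * (b i j * cnj (a k j)) - s * (a i j * cnj (b k j))" for j
    proof -
      have "m s i j * cnj (m s k j) = a i j * cnj (a k j) - (s * s) * (b i j * cnj (b k j))
        + s * (b i j * cnj (a k j)) - s * (a i j * cnj (b k j))"
        unfolding m_def complex_cnj_add complex_cnj_mult s(1) by (simp add: algebra_simps)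
      then show ?thesis by (simp add: s(2))
    qed
    then have "(\<Sum>j\<in>I. m s i j * cnj (m s k j)) = n i k
        + s * (\<Sum>j\<in>I. b i j * cnj (a k j)) - s * (\<Sum>j\<in>I. a i j * cnj (b k j))"
      by (simp add: n_def sum.distrib sum_subtractf sum_distrib_left)
    then show ?thesis using sa[OF that(1,2)] by simp
  qed
  \<comment> \<open>\<open>n\<close> is the sum of the Gram matrices of the rows of \<open>a\<close>
    and of \<open>b\<close>. If it kills \<open>y\<close>, so do both adjoints, and
    \<open>rank\<close> applies to the conjugate of \<open>y\<close>.\<close>
  have n_inj: "\<forall>k\<in>I. y k = 0" if "\<forall>i\<in>I. (\<Sum>k\<in>I. n i k * y k) = 0" for y
  proof -
    define u where "u j = (\<Sum>k\<in>I. cnj (a k j) * y k)" for j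
    define v where "v j = (\<Sum>k\<in>I. cnj (b k j) * y k)" for j
    have "0 = (\<Sum>i\<in>I. cnj (y i) * (\<Sum>k\<in>I. n i k * y k))" using that by simp
    also have "\<dots> = (\<Sum>i\<in>I. \<Sum>k\<in>I. \<Sum>j\<in>I. cnj (y i) * a i j * cnj (a k j) * y k
        + cnj (y i) * b i j * cnj (b k j) * y k)"
      by (simp add: n_def sum_distrib_left sum_distrib_right distrib_left distrib_right mult.assoc)
    also have "\<dots> = (\<Sum>i\<in>I. \<Sum>j\<in>I. \<Sum>k\<in>I. cnj (y i) * a i j * cnj (a k j) * y k
        + cnj (y i) * b i j * cnj (b k j) * y k)"
      by (rule sum.cong[OF refl], rule sum.swap)
    also have "\<dots> = (\<Sum>j\<in>I. \<Sum>i\<in>I. \<Sum>k\<in>I. cnj (y i) * a i j * cnj (a k j) * y k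
        + cnj (y i) * b i j * cnj (b k j) * y k)"
      by (rule sum.swap)
    also have "\<dots> = (\<Sum>j\<in>I. cnj (u j) * u j + cnj (v j) * v j)"
      by (simp add: u_def v_def sum_product sum.distrib mult.assoc mult.left_commute)
    also have "\<dots> = complex_of_real (\<Sum>j\<in>I. (cmod (u j))\<^sup>2 + (cmod (v j))\<^sup>2)"
      by (simp add: complex_norm_square mult.commute del: of_real_power)
    finally have "(\<Sum>j\<in>I. (cmod (u j))\<^sup>2 + (cmod (v j))\<^sup>2) = 0" by (metis of_real_eq_0_iff)
    then have *: "\<forall>j\<in>I. u j = 0 \<and> v j = 0"
      using \<open>finite I\<close> by (subst (asm) sum_nonneg_eq_0_iff) (auto simp: add_nonneg_eq_0_iff)
    have "\<forall>i\<in>I. cnj (y i) = 0"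
    proof (rule rank, intro ballI conjI)
      fix j assume "j \<in> I"
      have "cnj (u j) = (\<Sum>i\<in>I. cnj (y i) * a i j)" "cnj (v j) = (\<Sum>i\<in>I. cnj (y i) * b i j)"
        by (simp_all add: u_def v_def mult.commute)
      with * \<open>j \<in> I\<close>
      show "(\<Sum>i\<in>I. cnj (y i) * a i j) = 0" "(\<Sum>i\<in>I. cnj (y i) * b i j) = 0" by auto
    qed
    then show ?thesis by simp
  qed
  have m_adj: "(\<Sum>j\<in>I. m s i j * (\<Sum>k\<in>I. cnj (m s k j) * y k)) = (\<Sum>k\<in>I. n i k * y k)"
    if "i \<in> I" "s = \<i> \<or> s = - \<i>" for s i y
  proof -
    have "(\<Sum>j\<in>I. m s i j * (\<Sum>k\<in>I. cnj (m s k j) * y k))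
        = (\<Sum>j\<in>I. \<Sum>k\<in>I. m s i j * cnj (m s k j) * y k)"
      by (simp add: sum_distrib_left mult.assoc)
    also have "\<dots> = (\<Sum>k\<in>I. \<Sum>j\<in>I. m s i j * cnj (m s k j) * y k)" by (rule sum.swap)
    also have "\<dots> = (\<Sum>k\<in>I. n i k * y k)"
      using mm that by (intro sum.cong refl) (simp flip: sum_distrib_right)
    finally show ?thesis .
  qed
  have m_adj_surj: "\<exists>y. \<forall>j\<in>I. (\<Sum>k\<in>I. cnj (m s k j) * y k) = p j" if "s = \<i> \<or> s = - \<i>" for s p
  proof -
    have "\<forall>k\<in>I. y k = 0" if "\<forall>j\<in>I. (\<Sum>k\<in>I. cnj (m s k j) * y k) = 0" for y
    proof (rule n_inj, intro ballI)
      fix i assume "i \<in> I"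
      from m_adj[OF this \<open>s = \<i> \<or> s = - \<i>\<close>, of y] that
      show "(\<Sum>k\<in>I. n i k * y k) = 0" by simp
    qed
    then obtain y where "\<forall>j\<in>I. (\<Sum>k\<in>I. cnj (m s k j) * y k) = p j"
      by (rule square_system_solvable[OF \<open>finite I\<close>, of "\<lambda>j k. cnj (m s k j)" p])
    then show ?thesis by blast
  qed
  have m_inj: "\<forall>j\<in>I. r j = 0" if r: "\<forall>i\<in>I. (\<Sum>j\<in>I. m s i j * r j) = 0" and s: "s = \<i> \<or> s = - \<i>" for s r
  proof -
    obtain y where y: "\<forall>j\<in>I. (\<Sum>k\<in>I. cnj (m s k j) * y k) = r j" using m_adj_surj[OF s] by blast
    have "\<forall>k\<in>I. y k = 0"
    proof (rule n_inj, rule ballI)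
      fix i assume i: "i \<in> I"
      have "(\<Sum>k\<in>I. n i k * y k) = (\<Sum>j\<in>I. m s i j * r j)"
        using m_adj[OF i s, of y] y by simp
      then show "(\<Sum>k\<in>I. n i k * y k) = 0" using r i by simp
    qed
    with y show ?thesis by simp
  qed
  have iso: "(\<Sum>i\<in>I. F' i * cnj (G i)) = (\<Sum>i\<in>I. F i * cnj (G' i))"
    if F: "?L F F'" and G: "?L G G'" for F F' G G'
  proof -
    define pF where "pF j = F j - \<i> * F' j" for j
    define qF where "qF j = F j + \<i> * F' j" for j
    define pG where "pG j = G j - \<i> * G' j" for j
    define qG where "qG j = G j + \<i> * G' j" for j
    have mpq: "(\<Sum>j\<in>I. m \<i> i j * (H j - \<i> * H' j)) = - (\<Sum>j\<in>I. m (- \<i>) i j * (H j + \<i> * H' j))"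
      if "?L H H'" "i \<in> I" for H H' i
    proof -
      have "(\<Sum>j\<in>I. m \<i> i j * (H j - \<i> * H' j)) + (\<Sum>j\<in>I. m (- \<i>) i j * (H j + \<i> * H' j))
          = (\<Sum>j\<in>I. 2 * (a i j * H j + b i j * H' j))"
        unfolding sum.distrib[symmetric] by (intro sum.cong refl) (simp add: m_def algebra_simps)
      also have "\<dots> = 2 * ((\<Sum>j\<in>I. a i j * H j) + (\<Sum>j\<in>I. b i j * H' j))"
        by (simp add: sum.distrib sum_distrib_left)
      also have "\<dots> = 0" using that by simp
      finally show ?thesis by (simp add: eq_neg_iff_add_eq_0)
    qed
    \<comment> \<open>One vector \<open>y\<close> parametrizes both components: \<open>pG\<close> is
      the adjoint of \<open>m \<i>\<close> applied to \<open>y\<close>, and \<open>q\<close> shows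
      that \<open>qG\<close> is minus the adjoint of \<open>m (- \<i>)\<close> applied to the same
      \<open>y\<close>.\<close>
    obtain y where y: "\<forall>j\<in>I. (\<Sum>k\<in>I. cnj (m \<i> k j) * y k) = pG j" using m_adj_surj by blast
    have q: "\<forall>j\<in>I. qG j + (\<Sum>k\<in>I. cnj (m (- \<i>) k j) * y k) = 0"
    proof (rule m_inj[of "- \<i>"], intro ballI)
      fix i assume i: "i \<in> I"
      have "(\<Sum>j\<in>I. m (- \<i>) i j * (qG j + (\<Sum>k\<in>I. cnj (m (- \<i>) k j) * y k)))
          = (\<Sum>j\<in>I. m (- \<i>) i j * qG j) + (\<Sum>k\<in>I. n i k * y k)"
        using m_adj[OF i, of "- \<i>" y] by (simp add: distrib_left sum.distrib)
      also have "(\<Sum>k\<in>I. n i k * y k) = (\<Sum>j\<in>I. m \<i> i j * pG j)"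
        using m_adj[OF i, of "\<i>" y] y by simp
      also have "\<dots> = - (\<Sum>j\<in>I. m (- \<i>) i j * qG j)"
        unfolding pG_def qG_def using mpq[OF G i] .
      finally show "(\<Sum>j\<in>I. m (- \<i>) i j * (qG j + (\<Sum>k\<in>I. cnj (m (- \<i>) k j) * y k))) = 0" by simp
    qed simp
    have pair: "(\<Sum>j\<in>I. r j * cnj (\<Sum>k\<in>I. cnj (m s k j) * y k))
        = (\<Sum>k\<in>I. cnj (y k) * (\<Sum>j\<in>I. m s k j * r j))" for s r
    proof -
      have "(\<Sum>j\<in>I. r j * cnj (\<Sum>k\<in>I. cnj (m s k j) * y k))
          = (\<Sum>j\<in>I. \<Sum>k\<in>I. r j * (m s k j * cnj (y k)))"
        by (simp add: sum_distrib_left)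
      also have "\<dots> = (\<Sum>k\<in>I. \<Sum>j\<in>I. r j * (m s k j * cnj (y k)))" by (rule sum.swap)
      also have "\<dots> = (\<Sum>k\<in>I. cnj (y k) * (\<Sum>j\<in>I. m s k j * r j))"
        by (simp add: sum_distrib_left algebra_simps)
      finally show ?thesis .
    qed
    have "(\<Sum>j\<in>I. pF j * cnj (pG j)) = (\<Sum>j\<in>I. pF j * cnj (\<Sum>k\<in>I. cnj (m \<i> k j) * y k))"
      using y by simp
    also have "\<dots> = - (\<Sum>k\<in>I. cnj (y k) * (\<Sum>j\<in>I. m (- \<i>) k j * qF j))"
      unfolding pair pF_def qF_def using mpq[OF F] by (simp add: sum_negf)
    also have "\<dots> = - (\<Sum>j\<in>I. qF j * cnj (\<Sum>k\<in>I. cnj (m (- \<i>) k j) * y k))"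
      unfolding pair ..
    also have "\<dots> = (\<Sum>j\<in>I. qF j * cnj (qG j))"
    proof -
      have "(\<Sum>k\<in>I. cnj (m (- \<i>) k j) * y k) = - qG j" if "j \<in> I" for j
        using q that by (metis add.commute eq_neg_iff_add_eq_0)
      then show ?thesis by (simp add: sum_negf)
    qed
    finally have eq: "(\<Sum>j\<in>I. qF j * cnj (qG j) - pF j * cnj (pG j)) = 0" by (simp add: sum_subtractf)
    have "qF j * cnj (qG j) - pF j * cnj (pG j) = 2 * \<i> * (F' j * cnj (G j) - F j * cnj (G' j))" for j
      by (simp add: pF_def qF_def pG_def qG_def algebra_simps)
    with eq have "2 * \<i> * (\<Sum>j\<in>I. F' j * cnj (G j) - F j * cnj (G' j)) = 0"
      by (simp add: sum_distrib_left)
    then show ?thesis by (simp add: sum_subtractf)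
  qed
  show ?thesis
    unfolding lagrangian_def
  proof (intro allI iffI impI)
    fix F F' G G' assume "?L F F'" "?L G G'"
    then show "(\<Sum>i\<in>I. F' i * cnj (G i)) = (\<Sum>i\<in>I. F i * cnj (G' i))" by (rule iso)
  next
    fix F F' assume *: "\<forall>G G'. ?L G G' \<longrightarrow> (\<Sum>i\<in>I. F' i * cnj (G i)) = (\<Sum>i\<in>I. F i * cnj (G' i))"
    show "?L F F'"
    proof
      fix i assume i: "i \<in> I"
      \<comment> \<open>Self-adjointness places this pair, built from row \<open>i\<close> of both
        matrices, into the relation; testing against it returns row \<open>i\<close> of the
        condition.\<close>
      have "?L (\<lambda>j. cnj (b i j)) (\<lambda>j. - cnj (a i j))"
        using sa[OF _ i] by (auto simp: sum_negf)
      from *[rule_format, OF this[rule_format]]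
      have "(\<Sum>j\<in>I. F' j * cnj (cnj (b i j))) = (\<Sum>j\<in>I. F j * cnj (- cnj (a i j)))" by simp
      then show "(\<Sum>j\<in>I. a i j * F j) + (\<Sum>j\<in>I. b i j * F' j) = 0"
        by (simp add: sum_negf mult.commute)
    qed
  qed
qed

section \<open>Transport and assembly of Lagrangian vertex conditions\<close>

lemma lagrangian_reindex:
  assumes h: "bij_betw h J I" and L0: "lagrangian J L0"
    and L: "\<And>F F'. L F F' \<longleftrightarrow> L0 (F \<circ> h) (F' \<circ> h)"
  shows "lagrangian I L"
proof -
  have sum: "(\<Sum>i\<in>I. f i) = (\<Sum>j\<in>J. f (h j))" for f :: "_ \<Rightarrow> complex"
    using sum.reindex_bij_betw[OF h, of f] by simp
  show ?thesis
    unfolding lagrangian_def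
  proof (intro allI iffI impI)
    fix F F' G G' assume "L F F'" "L G G'"
    then have "L0 (F \<circ> h) (F' \<circ> h)" "L0 (G \<circ> h) (G' \<circ> h)" by (simp_all add: L)
    from lagrangian_isotropic[OF L0, OF this]
    show "(\<Sum>i\<in>I. F' i * cnj (G i)) = (\<Sum>i\<in>I. F i * cnj (G' i))" by (simp add: sum)
  next
    fix F F' assume *: "\<forall>G G'. L G G' \<longrightarrow> (\<Sum>i\<in>I. F' i * cnj (G i)) = (\<Sum>i\<in>I. F i * cnj (G' i))"
    have "L0 (F \<circ> h) (F' \<circ> h)"
    proof (rule lagrangian_maximal[OF L0])
      fix G G' assume G: "L0 G G'"
      let ?h = "the_inv_into J h"
      have h': "?h (h j) = j" if "j \<in> J" for j
        using h that by (simp add: bij_betw_def the_inv_into_f_f)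
      have "L0 (G \<circ> ?h \<circ> h) (G' \<circ> ?h \<circ> h)"
        by (rule lagrangian_cong[OF L0, OF G]) (auto simp: h')
      then have "L (G \<circ> ?h) (G' \<circ> ?h)" by (simp add: L)
      with * have "(\<Sum>i\<in>I. F' i * cnj ((G \<circ> ?h) i)) = (\<Sum>i\<in>I. F i * cnj ((G' \<circ> ?h) i))" by blast
      then show "(\<Sum>i\<in>J. (F' \<circ> h) i * cnj (G i)) = (\<Sum>i\<in>J. (F \<circ> h) i * cnj (G' i))"
        by (simp add: sum h')
    qed
    then show "L F F'" by (simp add: L)
  qed
qed

text \<open>The condition at the glued vertex is given in this form, so its being Lagrangian is
  derived here from the formula itself and not from a matrix pair.\<close>

lemma lagrangian_delta_condition:
  assumes "finite w" "w \<noteq> {}"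
  shows "lagrangian w (delta_condition \<alpha> w)"
proof -
  obtain a where a: "a \<in> w" using assms by blast
  have delta: "delta_condition \<alpha> w F F' \<longleftrightarrow> (\<forall>b\<in>w. F b = F a) \<and> (\<Sum>b\<in>w. F' b) = of_real \<alpha> * F a"
    for F F' using a unfolding delta_condition_def by metis
  show ?thesis
    unfolding lagrangian_def
  proof (intro allI iffI impI)
    fix F F' G G' assume F: "delta_condition \<alpha> w F F'" and G: "delta_condition \<alpha> w G G'"
    have "(\<Sum>b\<in>w. F' b * cnj (G b)) = (\<Sum>b\<in>w. F' b) * cnj (G a)"
      using G unfolding delta sum_distrib_right by (intro sum.cong) auto
    also have "\<dots> = F a * cnj (\<Sum>b\<in>w. G' b)"
      using F G unfolding delta by simp
    also have "\<dots> = (\<Sum>b\<in>w. F b * cnj (G' b))"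
      using F unfolding delta cnj_sum sum_distrib_left by (intro sum.cong) auto
    finally show "(\<Sum>b\<in>w. F' b * cnj (G b)) = (\<Sum>b\<in>w. F b * cnj (G' b))" .
  next
    fix F F' assume *: "\<forall>G G'. delta_condition \<alpha> w G G' \<longrightarrow>
      (\<Sum>i\<in>w. F' i * cnj (G i)) = (\<Sum>i\<in>w. F i * cnj (G' i))"
    have "F b = F a" if b: "b \<in> w" for b
    proof -
      \<comment> \<open>Zero values with derivative 1 at \<open>b\<close> and -1 at
        \<open>a\<close>: annihilation by this pair is continuity.\<close>
      have "delta_condition \<alpha> w (\<lambda>_. 0) (\<lambda>i. (if i = b then 1 else 0) - (if i = a then 1 else 0))"
        unfolding delta using a b assms by (simp add: sum_subtractf)
      with * have "(\<Sum>i\<in>w. F' i * cnj 0)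
          = (\<Sum>i\<in>w. F i * cnj ((if i = b then 1 else 0) - (if i = a then 1 else 0)))" by blast
      also have "\<dots> = (\<Sum>i\<in>w. (if i = b then F i else 0) - (if i = a then F i else 0))"
        by (intro sum.cong) auto
      also have "\<dots> = F b - F a" using a b assms by (simp add: sum_subtractf)
      finally show ?thesis by simp
    qed
    \<comment> \<open>Constant value 1 with the whole derivative \<alpha> placed at
      \<open>a\<close>: annihilation by this pair is the condition on the sum of the
      derivatives.\<close>
    moreover have "delta_condition \<alpha> w (\<lambda>_. 1) (\<lambda>i. if i = a then of_real \<alpha> else 0)"
      unfolding delta using a assms by simp
    with * have "(\<Sum>i\<in>w. F' i * cnj 1) = (\<Sum>i\<in>w. F i * cnj (if i = a then of_real \<alpha> else 0))" by blast
    then have "(\<Sum>i\<in>w. F' i) = of_real \<alpha> * F a"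
      using a assms by (simp add: if_distrib mult.commute cong: if_cong)
    ultimately show "delta_condition \<alpha> w F F'" unfolding delta by blast
  qed
qed

lemma sum_partition:
  fixes f :: "'i \<Rightarrow> complex"
  assumes "finite E" "partition_on E P"
  shows "(\<Sum>i\<in>E. f i) = (\<Sum>w\<in>P. \<Sum>i\<in>w. f i)"
proof -
  have "\<forall>w\<in>P. finite w"
    using partition_onD1[OF assms(2)] by (auto intro: finite_subset[OF _ assms(1)])
  moreover have "\<forall>v\<in>P. \<forall>w\<in>P. v \<noteq> w \<longrightarrow> v \<inter> w = {}"
    using partition_onD2[OF assms(2)] by (auto simp: disjoint_def)
  ultimately show ?thesis
    using sum.Union_disjoint[of P f] partition_onD1[OF assms(2)] by simp
qed

lemma lagrangian_partition:
  assumes "finite E" and P: "partition_on E P" and c: "\<And>w. w \<in> P \<Longrightarrow> lagrangian w (c w)"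
  shows "lagrangian E (\<lambda>F F'. \<forall>w\<in>P. c w F F')"
  unfolding lagrangian_def
proof (intro allI iffI impI)
  fix F F' G G' assume F: "\<forall>w\<in>P. c w F F'" and G: "\<forall>w\<in>P. c w G G'"
  have "(\<Sum>i\<in>w. F' i * cnj (G i)) = (\<Sum>i\<in>w. F i * cnj (G' i))" if "w \<in> P" for w
    using lagrangian_isotropic[OF c[OF that]] F G that by blast
  then show "(\<Sum>i\<in>E. F' i * cnj (G i)) = (\<Sum>i\<in>E. F i * cnj (G' i))"
    by (simp add: sum_partition[OF assms(1,2)])
next
  fix F F' assume *: "\<forall>G G'. (\<forall>w\<in>P. c w G G') \<longrightarrow>
      (\<Sum>i\<in>E. F' i * cnj (G i)) = (\<Sum>i\<in>E. F i * cnj (G' i))"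
  show "\<forall>w\<in>P. c w F F'"
  proof
    fix w assume w: "w \<in> P"
    show "c w F F'"
    proof (rule lagrangian_maximal[OF c[OF w]])
      fix G G' assume G: "c w G G'"
      \<comment> \<open>Extension by zero turns a test pair for \<open>w\<close> into one for all
        vertices, since pairs vanishing on a vertex satisfy any Lagrangian condition there.\<close>
      define H where "H i = (if i \<in> w then G i else 0)" for i
      define H' where "H' i = (if i \<in> w then G' i else 0)" for i
      have "c v H H'" if v: "v \<in> P" for v
      proof (cases "v = w")
        case True
        then show ?thesis
          by (simp only:) (rule lagrangian_cong[OF c[OF w], OF G]; simp add: H_def H'_def)
      next
        case False
        then have "v \<inter> w = {}"
          using partition_onD2[OF P] v w by (auto simp: disjoint_def)
        then show ?thesis
          by (intro lagrangian_vanishing[OF c[OF v]]) (auto simp: H_def H'_def)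
      qed
      with * have eq: "(\<Sum>i\<in>E. F' i * cnj (H i)) = (\<Sum>i\<in>E. F i * cnj (H' i))" by blast
      have "w \<subseteq> E" using partition_onD1[OF P] w by auto
      have "(\<Sum>i\<in>w. F' i * cnj (G i)) = (\<Sum>i\<in>E. F' i * cnj (H i))"
        using \<open>finite E\<close> \<open>w \<subseteq> E\<close> by (intro sum.mono_neutral_cong_left) (auto simp: H_def)
      moreover have "(\<Sum>i\<in>w. F i * cnj (G' i)) = (\<Sum>i\<in>E. F i * cnj (H' i))"
        using \<open>finite E\<close> \<open>w \<subseteq> E\<close> by (intro sum.mono_neutral_cong_left) (auto simp: H'_def)
      ultimately show "(\<Sum>i\<in>w. F' i * cnj (G i)) = (\<Sum>i\<in>w. F i * cnj (G' i))" using eq by simp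
    qed
  qed
qed

section \<open>Self-adjoint vertex conditions in matrix form\<close>

lemma mat_adjoint_index:
  fixes A :: "complex mat"
  assumes "A \<in> carrier_mat m n" "i < n" "j < m"
  shows "mat_adjoint A $$ (i, j) = cnj (A $$ (j, i))"
  using assms by (simp add: mat_adjoint_def mat_of_rows_index)

text \<open>Rank \<open>d\<close> provides \<open>d\<close> independent columns, which form an
  invertible square matrix \<open>Q\<close>. The product in \<open>orth\<close> is bilinear, without
  conjugation, so orthogonality to the columns says that the transpose of \<open>Q\<close> kills
  \<open>v\<close>.\<close>

lemma full_row_rank_kernel:
  fixes M :: "complex mat"
  assumes M: "M \<in> carrier_mat d n" and rank: "vec_space.rank d M = d"
    and v: "v \<in> carrier_vec d" and orth: "\<And>c. c \<in> set (cols M) \<Longrightarrow> c \<bullet> v = 0"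
  shows "v = 0\<^sub>v d"
proof (rule ccontr)
  interpret V: vec_space "TYPE(complex)" d .
  assume "v \<noteq> 0\<^sub>v d"
  have "V.lin_indpt {}" by (auto simp: V.lin_dep_def)
  then obtain S where S: "maximal S (\<lambda>T. T \<subseteq> set (cols M) \<and> V.lin_indpt T)"
    using maximal_exists_superset[of "set (cols M)" "\<lambda>T. T \<subseteq> set (cols M) \<and> V.lin_indpt T" "{}"] by auto
  have card: "card S = d" using V.rank_card_indpt[OF M S] rank by simp
  have Ssub: "S \<subseteq> set (cols M)" and indep: "V.lin_indpt S" using S unfolding maximal_def by blast+
  have "finite S" using Ssub finite_subset by blast
  then obtain ss where ss: "set ss = S" "distinct ss" using finite_distinct_list by blast
  have len: "length ss = d" using ss card distinct_card by metis
  have carr: "set ss \<subseteq> carrier_vec d" using ss Ssub cols_dim[of M] M by auto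
  define Q where "Q = mat_of_cols d ss"
  have Q: "Q \<in> carrier_mat d d" unfolding Q_def using len by auto
  have cQ: "cols Q = ss" unfolding Q_def using carr by (rule cols_mat_of_cols)
  have "V.rank Q = d"
    using V.lin_indpt_full_rank[OF Q] cQ ss indep by simp
  then have "det Q \<noteq> 0" using V.det_rank_iff[OF Q] by simp
  then have det: "det (transpose_mat Q) \<noteq> 0" using det_transpose[OF Q] by simp
  have "transpose_mat Q *\<^sub>v v = 0\<^sub>v d"
  proof (rule eq_vecI)
    fix i assume i: "i < dim_vec (0\<^sub>v d :: complex vec)"
    have "col Q i \<in> set (cols Q)" using Q i by (auto simp: cols_def)
    then have "col Q i \<in> set (cols M)" using cQ ss Ssub by auto
    then show "(transpose_mat Q *\<^sub>v v) $ i = 0\<^sub>v d $ i" using orth i Q by simp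
  qed (use Q in auto)
  then show False
    using det_0_iff_vec_prod_zero_field[of "transpose_mat Q" d] Q det v \<open>v \<noteq> 0\<^sub>v d\<close> by auto
qed

text \<open>The matrix criterion is applied with indices below \<open>d\<close>, where full rank
  means trivial left kernel of the block matrix, and the result is carried to the edge-ends along
  the enumeration \<open>es\<close>.\<close>

lemma lagrangian_self_adjoint_condition:
  assumes "self_adjoint_condition w C"
  shows "lagrangian w C"
proof -
  define d where "d = card w"
  from assms[unfolded self_adjoint_condition_def, folded d_def]
  obtain es A B where es: "distinct es" "set es = w"
    and A: "A \<in> carrier_mat d d" and B: "B \<in> carrier_mat d d"
    and rank: "vec_space.rank d (mat_of_cols d (cols A @ cols B)) = d"
    and adj: "mat_adjoint (A * mat_adjoint B) = A * mat_adjoint B"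
    and C: "\<forall>F F'. C F F' \<longleftrightarrow>
        A *\<^sub>v vec_of_list (map F es) + B *\<^sub>v vec_of_list (map F' es) = 0\<^sub>v d"
    by (elim exE conjE) (rule that)
  have len: "length es = d" using distinct_card[OF es(1)] es(2) by (simp add: d_def)
  define a where "a i j = A $$ (i, j)" for i j
  define b where "b i j = B $$ (i, j)" for i j
  have B': "mat_adjoint B \<in> carrier_mat d d" using B by (auto simp: mat_adjoint_def)
  have prod: "(A * mat_adjoint B) $$ (i, k) = (\<Sum>j<d. a i j * cnj (b k j))" if "i < d" "k < d" for i k
    using that A B B' by (simp add: scalar_prod_def a_def b_def mat_adjoint_index[OF B] lessThan_atLeast0)
  have AB: "A * mat_adjoint B \<in> carrier_mat d d" using A B' by simp
  have "lagrangian {..<d} (\<lambda>F F'. \<forall>i\<in>{..<d}. (\<Sum>j<d. a i j * F j) + (\<Sum>j<d. b i j * F' j) = 0)"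
  proof (rule lagrangian_matrix_condition)
    fix i k assume "i \<in> {..<d}" "k \<in> {..<d}"
    then have ik: "i < d" "k < d" by auto
    have "(\<Sum>j<d. a i j * cnj (b k j)) = (A * mat_adjoint B) $$ (i, k)" using prod ik by simp
    also have "\<dots> = mat_adjoint (A * mat_adjoint B) $$ (i, k)" by (simp add: adj)
    also have "\<dots> = cnj (\<Sum>j<d. a k j * cnj (b i j))"
      using ik by (simp add: mat_adjoint_index[OF AB] prod)
    finally show "(\<Sum>j<d. a i j * cnj (b k j)) = (\<Sum>j<d. b i j * cnj (a k j))"
      by (simp add: mult.commute)
  next
    fix z assume z: "\<forall>j\<in>{..<d}. (\<Sum>i<d. z i * a i j) = 0 \<and> (\<Sum>i<d. z i * b i j) = 0"
    let ?M = "mat_of_cols d (cols A @ cols B)"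
    have carr: "set (cols A @ cols B) \<subseteq> carrier_vec d"
      using cols_dim[of A] cols_dim[of B] A B by auto
    have "vec d z = 0\<^sub>v d"
    proof (rule full_row_rank_kernel[OF _ rank])
      show "?M \<in> carrier_mat d (length (cols A @ cols B))" by (rule mat_of_cols_carrier)
      fix c assume "c \<in> set (cols ?M)"
      then have "c \<in> set (cols A) \<or> c \<in> set (cols B)" using cols_mat_of_cols[OF carr] by simp
      then obtain j where j: "j < d" "c = col A j \<or> c = col B j"
        using A B by (auto simp: cols_def)
      then show "c \<bullet> vec d z = 0"
        using z A B by (auto simp: scalar_prod_def a_def b_def mult.commute lessThan_atLeast0)
    qed simp
    then have *: "vec d z $ i = 0\<^sub>v d $ i" for i by (rule arg_cong)
    show "\<forall>i\<in>{..<d}. z i = 0"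
    proof
      fix i assume "i \<in> {..<d}"
      with *[of i] show "z i = 0" by (simp only: lessThan_iff index_vec index_zero_vec)
    qed
  qed simp
  then show ?thesis
  proof (rule lagrangian_reindex[rotated])
    show "bij_betw (\<lambda>i. es ! i) {..<d} w"
      using bij_betw_nth[OF es(1), of "{..<d}" w] len es(2) by simp
    fix F F' :: "_ \<Rightarrow> complex"
    have "C F F' \<longleftrightarrow> (\<forall>i<d. (A *\<^sub>v vec_of_list (map F es) + B *\<^sub>v vec_of_list (map F' es)) $ i = 0)"
      unfolding C[rule_format] using A B by (auto simp: vec_eq_iff)
    also have "\<dots> \<longleftrightarrow> (\<forall>i<d. (\<Sum>j<d. a i j * F (es ! j)) + (\<Sum>j<d. b i j * F' (es ! j)) = 0)"
      using A B len by (auto simp: scalar_prod_def a_def b_def vec_of_list_index lessThan_atLeast0)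
    finally show "C F F' \<longleftrightarrow> (\<forall>i\<in>{..<d}. (\<Sum>j<d. a i j * (F \<circ> (!) es) j) + (\<Sum>j<d. b i j * (F' \<circ> (!) es) j) = 0)"
      by auto
  qed
qed

section \<open>Eigenvectors of compact positive operators\<close>

text \<open>The product is required to be definite on the carrier \<open>E\<close> only, while
  \<open>span\<close> and \<open>dim\<close> refer to the ambient type, as they do in
  \<open>multiplicity_of\<close>. In the application \<open>E\<close> is incomplete, so limits have
  to be supplied by the operator.\<close>

locale complex_inner_space = vector_space sc
  for sc :: "complex \<Rightarrow> 'a::ab_group_add \<Rightarrow> 'a" +
  fixes E :: "'a set" and ip :: "'a \<Rightarrow> 'a \<Rightarrow> complex"
  assumes subspace_E: "subspace E"
    and ip_add_left: "\<And>x y z. x \<in> E \<Longrightarrow> y \<in> E \<Longrightarrow> z \<in> E \<Longrightarrow> ip (x + y) z = ip x z + ip y z"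
    and ip_scale_left: "\<And>c x y. x \<in> E \<Longrightarrow> y \<in> E \<Longrightarrow> ip (sc c x) y = c * ip x y"
    and ip_commute: "\<And>x y. x \<in> E \<Longrightarrow> y \<in> E \<Longrightarrow> ip y x = cnj (ip x y)"
    and ip_ge_0: "\<And>x. x \<in> E \<Longrightarrow> 0 \<le> Re (ip x x)"
    and ip_definite: "\<And>x. x \<in> E \<Longrightarrow> Re (ip x x) = 0 \<Longrightarrow> x = 0"
begin

section \<open>Inner product calculus on the carrier\<close>

lemma E_simps [simp, intro]:
  "0 \<in> E" "x \<in> E \<Longrightarrow> y \<in> E \<Longrightarrow> x + y \<in> E" "x \<in> E \<Longrightarrow> y \<in> E \<Longrightarrow> x - y \<in> E"
  "x \<in> E \<Longrightarrow> sc c x \<in> E" "(\<And>i. i \<in> A \<Longrightarrow> F i \<in> E) \<Longrightarrow> sum F A \<in> E"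
  using subspace_E
  by (auto intro: subspace_0 subspace_add subspace_diff subspace_scale subspace_sum)

lemma ip_0_left [simp]: "x \<in> E \<Longrightarrow> ip 0 x = 0"
  using ip_scale_left[of 0 x 0] by simp

lemma ip_0_right [simp]: "x \<in> E \<Longrightarrow> ip x 0 = 0"
  using ip_commute[of 0 x] by simp

lemma ip_add_right: "x \<in> E \<Longrightarrow> y \<in> E \<Longrightarrow> z \<in> E \<Longrightarrow> ip x (y + z) = ip x y + ip x z"
  using ip_commute[of x "y + z"] ip_commute[of x y] ip_commute[of x z]
    ip_commute[of "y + z" x] by (simp add: ip_add_left)

lemma ip_scale_right: "x \<in> E \<Longrightarrow> y \<in> E \<Longrightarrow> ip x (sc c y) = cnj c * ip x y"
  using ip_commute[of "sc c y" x] ip_commute[of y x] by (simp add: ip_scale_left)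

lemma ip_diff_left: "x \<in> E \<Longrightarrow> y \<in> E \<Longrightarrow> z \<in> E \<Longrightarrow> ip (x - y) z = ip x z - ip y z"
  using ip_add_left[of "x - y" y z] by simp

lemma ip_diff_right: "x \<in> E \<Longrightarrow> y \<in> E \<Longrightarrow> z \<in> E \<Longrightarrow> ip x (y - z) = ip x y - ip x z"
  using ip_add_right[of x "y - z" z] by simp

lemma ip_sum_left:
  "finite A \<Longrightarrow> (\<And>i. i \<in> A \<Longrightarrow> F i \<in> E) \<Longrightarrow> x \<in> E \<Longrightarrow> ip (sum F A) x = (\<Sum>i\<in>A. ip (F i) x)"
  by (induction A rule: finite_induct) (auto simp: ip_add_left)

lemma ip_sum_right:
  "finite A \<Longrightarrow> (\<And>i. i \<in> A \<Longrightarrow> F i \<in> E) \<Longrightarrow> x \<in> E \<Longrightarrow> ip x (sum F A) = (\<Sum>i\<in>A. ip x (F i))"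
  by (induction A rule: finite_induct) (auto simp: ip_add_right)

definition nrm :: "'a \<Rightarrow> real" where "nrm x = sqrt (Re (ip x x))"

lemma ip_self: "x \<in> E \<Longrightarrow> ip x x = of_real ((nrm x)\<^sup>2)"
  using ip_commute[of x x] ip_ge_0[of x]
  by (auto simp: nrm_def complex_eq_iff)

lemma nrm_ge_0 [simp]: "x \<in> E \<Longrightarrow> 0 \<le> nrm x"
  by (simp add: nrm_def ip_ge_0)

lemma nrm_eq_0: "x \<in> E \<Longrightarrow> nrm x = 0 \<longleftrightarrow> x = 0"
  using ip_definite[of x] by (auto simp: nrm_def)

lemma nrm_0 [simp]: "nrm 0 = 0"
  by (simp add: nrm_def)

lemma nrm_scale: "x \<in> E \<Longrightarrow> nrm (sc c x) = cmod c * nrm x"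
proof -
  assume x: "x \<in> E"
  have "ip (sc c x) (sc c x) = of_real ((cmod c)\<^sup>2) * ip x x"
    using x by (simp add: ip_scale_left ip_scale_right complex_norm_square del: of_real_power)
  then show ?thesis
    by (simp add: nrm_def real_sqrt_mult del: of_real_power)
qed

lemma nrm_diff_commute: "x \<in> E \<Longrightarrow> y \<in> E \<Longrightarrow> nrm (x - y) = nrm (y - x)"
  using nrm_scale[of "y - x" "-1"] by (simp add: scale_minus_left)

lemma Cauchy_Schwarz:
  assumes x: "x \<in> E" and y: "y \<in> E"
  shows "cmod (ip x y) \<le> nrm x * nrm y"
proof (cases "y = 0")
  case True
  then show ?thesis using x by simp
next
  case False
  then have ny: "nrm y > 0" using nrm_eq_0[OF y] nrm_ge_0[OF y] by linarith
  define c where "c = ip x y / of_real ((nrm y)\<^sup>2)"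
  have cy: "c * of_real ((nrm y)\<^sup>2) = ip x y" using ny by (simp add: c_def)
  have "ip (x - sc c y) (x - sc c y) = ip x x - cnj c * ip x y - c * (ip y x - cnj c * ip y y)"
    using x y by (simp add: ip_diff_left ip_diff_right ip_scale_left ip_scale_right algebra_simps)
  also have "ip y x - cnj c * ip y y = 0"
  proof -
    have "cnj c * of_real ((nrm y)\<^sup>2) = cnj (ip x y)"
      unfolding cy[symmetric] by simp
    then show ?thesis unfolding ip_self[OF y] ip_commute[OF x y] by simp
  qed
  finally have "Re (ip (x - sc c y) (x - sc c y)) = (nrm x)\<^sup>2 - Re (cnj c * ip x y)"
    by (simp add: ip_self x)
  moreover have "cnj c * ip x y = of_real ((cmod (ip x y))\<^sup>2 / (nrm y)\<^sup>2)"
    by (simp add: c_def complex_norm_square mult.commute del: of_real_power)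
  ultimately have "(cmod (ip x y))\<^sup>2 / (nrm y)\<^sup>2 \<le> (nrm x)\<^sup>2"
    using ip_ge_0[of "x - sc c y"] x y by simp
  then have "(cmod (ip x y))\<^sup>2 \<le> (nrm x * nrm y)\<^sup>2"
    using ny by (simp add: field_simps)
  then show ?thesis by (rule power2_le_imp_le) (use x y in simp)
qed

lemma nrm_triangle:
  assumes x: "x \<in> E" and y: "y \<in> E"
  shows "nrm (x + y) \<le> nrm x + nrm y"
proof -
  have "Re (ip x y) \<le> nrm x * nrm y"
    using Cauchy_Schwarz[OF x y] complex_Re_le_cmod[of "ip x y"] by linarith
  moreover have "ip (x + y) (x + y) = of_real ((nrm x)\<^sup>2) + of_real ((nrm y)\<^sup>2) + (ip x y + cnj (ip x y))"
    using x y unfolding ip_self[OF x, symmetric] ip_self[OF y, symmetric] ip_commute[OF x y, symmetric]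
    by (simp add: ip_add_left ip_add_right)
  then have "(nrm (x + y))\<^sup>2 = (nrm x)\<^sup>2 + (nrm y)\<^sup>2 + 2 * Re (ip x y)"
    using ip_ge_0[of "x + y"] x y by (simp add: nrm_def)
  ultimately have "(nrm (x + y))\<^sup>2 \<le> (nrm x + nrm y)\<^sup>2"
    by (simp add: power2_sum)
  then show ?thesis by (rule power2_le_imp_le) (use x y in simp)
qed

lemma nrm_triangle_diff:
  assumes "x \<in> E" "y \<in> E" "z \<in> E"
  shows "nrm (x - z) \<le> nrm (x - y) + nrm (y - z)"
  using nrm_triangle[of "x - y" "y - z"] assms by simp

lemma nrm_triangle_sub:
  assumes "x \<in> E" "y \<in> E"
  shows "\<bar>nrm x - nrm y\<bar> \<le> nrm (x - y)"
  using nrm_triangle[of "x - y" y] nrm_triangle[of "y - x" x] nrm_diff_commute[of x y] assms by simp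

text \<open>The greedy sequence of the variational principle: \<open>s n\<close> is the maximum of
  the Rayleigh quotient on the orthogonal complement of the earlier eigenvectors, attained at
  \<open>f n\<close>. Counting starts at 0, one below the eigenvalues of the graph.\<close>

definition eigen_system :: "('a \<Rightarrow> 'a) \<Rightarrow> (nat \<Rightarrow> 'a) \<Rightarrow> (nat \<Rightarrow> real) \<Rightarrow> bool" where
  "eigen_system G f s \<longleftrightarrow> (\<forall>n. f n \<in> E \<and> ip (f n) (f n) = 1 \<and> (\<forall>k<n. ip (f n) (f k) = 0) \<and>
    G (f n) = sc (of_real (s n)) (f n) \<and> 0 < s n \<and>
    (\<forall>h\<in>E. (\<forall>k<n. ip h (f k) = 0) \<longrightarrow> Re (ip (G h) h) \<le> s n * (nrm h)\<^sup>2))"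

lemma eigen_systemD:
  assumes "eigen_system G f s"
  shows "f n \<in> E" "G (f n) = sc (of_real (s n)) (f n)" "0 < s n"
    "\<And>h. h \<in> E \<Longrightarrow> (\<And>k. k < n \<Longrightarrow> ip h (f k) = 0) \<Longrightarrow> Re (ip (G h) h) \<le> s n * (nrm h)\<^sup>2"
  using assms unfolding eigen_system_def by blast+

lemma eigen_system_orthonormal:
  assumes "eigen_system G f s"
  shows "ip (f m) (f n) = (if m = n then 1 else 0)"
proof -
  have *: "ip (f n) (f k) = 0" if "k < n" for k n using assms that unfolding eigen_system_def by blast
  have "ip (f m) (f m) = 1" using assms unfolding eigen_system_def by blast
  moreover have "ip (f m) (f n) = 0" if "m < n"
    using *[OF that] ip_commute[of "f n" "f m"] eigen_systemD(1)[OF assms] by simp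
  ultimately show ?thesis using *[of n m] by (cases m n rule: linorder_cases) auto
qed

lemma eigen_system_antimono:
  assumes es: "eigen_system G f s" and "m \<le> n"
  shows "s n \<le> s m"
proof -
  note f = eigen_systemD[OF es] and o = eigen_system_orthonormal[OF es]
  have "Re (ip (G (f n)) (f n)) \<le> s m * (nrm (f n))\<^sup>2"
    using \<open>m \<le> n\<close> by (intro f(4)) (auto simp: o f(1))
  moreover have "nrm (f n) = 1" by (simp add: nrm_def o)
  ultimately show ?thesis by (simp add: f o ip_scale_left)
qed

end

text \<open>For \<open>G\<close> the inverse of H - \<mu>, the inequality \<open>G_coercive\<close>
  says that H - \<mu> is at least 1; it contains both positivity and the norm bound 1.
  \<open>G_compact\<close> places its limits in \<open>E\<close> and so does the work of
  completeness, and \<open>infinite_dim\<close> lets the sequence of eigenvectors continue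
  forever.\<close>

locale compact_positive = complex_inner_space sc E ip
  for sc :: "complex \<Rightarrow> 'a::ab_group_add \<Rightarrow> 'a" and E ip +
  fixes G :: "'a \<Rightarrow> 'a"
  assumes G_E: "\<And>x. x \<in> E \<Longrightarrow> G x \<in> E"
    and G_add: "\<And>x y. x \<in> E \<Longrightarrow> y \<in> E \<Longrightarrow> G (x + y) = G x + G y"
    and G_scale: "\<And>c x. x \<in> E \<Longrightarrow> G (sc c x) = sc c (G x)"
    and G_sym: "\<And>x y. x \<in> E \<Longrightarrow> y \<in> E \<Longrightarrow> ip (G x) y = ip x (G y)"
    and G_coercive: "\<And>x. x \<in> E \<Longrightarrow> (nrm (G x))\<^sup>2 \<le> Re (ip (G x) x)"
    and G_inj: "\<And>x. x \<in> E \<Longrightarrow> G x = 0 \<Longrightarrow> x = 0"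
    and G_compact: "\<And>f. (\<And>n. f n \<in> E) \<Longrightarrow> (\<And>n. nrm (f n) = 1) \<Longrightarrow>
      \<exists>g\<in>E. \<exists>r::nat \<Rightarrow> nat. strict_mono r \<and> (\<lambda>n. nrm (G (f (r n)) - g)) \<longlonglongrightarrow> 0"
    and infinite_dim: "\<And>(f::nat \<Rightarrow> 'a) n. (\<And>k. k < n \<Longrightarrow> f k \<in> E) \<Longrightarrow>
      \<exists>h\<in>E. h \<noteq> 0 \<and> (\<forall>k<n. ip h (f k) = 0)"
begin

section \<open>Variational construction of the eigenvectors\<close>

lemma G_0 [simp]: "G 0 = 0"
  using G_scale[of 0 0] by simp

lemma G_diff: "x \<in> E \<Longrightarrow> y \<in> E \<Longrightarrow> G (x - y) = G x - G y"
  using G_add[of "x - y" y] by simp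

lemma G_sum: "finite A \<Longrightarrow> (\<And>i. i \<in> A \<Longrightarrow> F i \<in> E) \<Longrightarrow> G (sum F A) = (\<Sum>i\<in>A. G (F i))"
  by (induction A rule: finite_induct) (auto simp: G_add)

lemma G_ip_real: "x \<in> E \<Longrightarrow> ip (G x) x = of_real (Re (ip (G x) x))"
  using ip_commute[of x "G x"] G_sym[of x x] by (auto simp: G_E complex_eq_iff)

lemma nrm_G_le: "x \<in> E \<Longrightarrow> nrm (G x) \<le> nrm x"
proof -
  assume x: "x \<in> E"
  have "nrm (G x) * nrm (G x) \<le> Re (ip (G x) x)"
    using G_coercive[OF x] by (simp add: power2_eq_square)
  also have "\<dots> \<le> nrm (G x) * nrm x"
    using Cauchy_Schwarz[of "G x" x] complex_Re_le_cmod[of "ip (G x) x"] x G_E by force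
  finally show ?thesis
    using nrm_ge_0[of "G x"] nrm_ge_0[OF x] G_E[OF x]
    by (cases "nrm (G x) = 0") (auto simp: mult_le_cancel_left)
qed

lemma Re_ip_G_le: "x \<in> E \<Longrightarrow> Re (ip (G x) x) \<le> (nrm x)\<^sup>2"
proof -
  assume x: "x \<in> E"
  have "Re (ip (G x) x) \<le> nrm (G x) * nrm x"
    using Cauchy_Schwarz[of "G x" x] complex_Re_le_cmod[of "ip (G x) x"] x G_E by force
  also have "\<dots> \<le> nrm x * nrm x" using nrm_G_le[OF x] x by (intro mult_right_mono) auto
  finally show ?thesis by (simp add: power2_eq_square)
qed

lemma Re_ip_G_pos:
  assumes "x \<in> E" "x \<noteq> 0" shows "0 < Re (ip (G x) x)"
proof -
  have "nrm (G x) \<noteq> 0" using G_inj[OF assms(1)] assms nrm_eq_0[OF G_E[OF assms(1)]] by auto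
  then have "0 < (nrm (G x))\<^sup>2" by simp
  then show ?thesis using G_coercive[OF assms(1)] by linarith
qed

text \<open>
  For the nonnegative form \<open>s |x|\<^sup>2 - (G x, x)\<close>, moving from \<open>h\<close> in the direction of the residue
  \<open>s h - G h\<close> shows that almost-maximizers are almost-eigenvectors.
\<close>

lemma residue_bound:
  assumes M: "subspace M" "M \<subseteq> E" "\<And>x. x \<in> M \<Longrightarrow> G x \<in> M" and "0 < s"
    and le: "\<And>x. x \<in> M \<Longrightarrow> Re (ip (G x) x) \<le> s * (nrm x)\<^sup>2" and h: "h \<in> M"
  shows "(nrm (sc (of_real s) h - G h))\<^sup>2 \<le> s * (s * (nrm h)\<^sup>2 - Re (ip (G h) h))"
proof -
  define r where "r = sc (of_real s) h - G h"
  \<comment> \<open>Step length 1/s: the operator s - G is at most s, so this gradient step lowers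
    the form by at least |r|^2 / s, while the form stays nonnegative.\<close>
  define a where "a = complex_of_real (1 / s)"
  have a: "cnj a = a" by (simp add: a_def)
  define x where "x = h - sc a r"
  define K where "K = sc (of_real s) r - G r"
  have rM: "r \<in> M" unfolding r_def using M h by (intro subspace_diff subspace_scale) auto
  have xM: "x \<in> M" unfolding x_def using M h rM by (intro subspace_diff subspace_scale) auto
  have E: "h \<in> E" "r \<in> E" "G h \<in> E" "G r \<in> E" using M h rM by auto
  have q: "s * (nrm y)\<^sup>2 - Re (ip (G y) y) = Re (ip (sc (of_real s) y - G y) y)" if "y \<in> E" for y
    using that G_E ip_self[OF that] by (simp add: ip_diff_left ip_scale_left)
  have KE: "K \<in> E" unfolding K_def using E by auto
  have "sc (of_real s) x - G x = (sc (of_real s) h - G h) - sc a K"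
    using E by (simp add: x_def K_def G_diff G_scale scale_right_diff_distrib mult.commute)
  then have Gx: "sc (of_real s) x - G x = r - sc a K" by (simp add: r_def)
  have hr: "ip K h = of_real ((nrm r)\<^sup>2)"
  proof -
    have "ip K h = ip r (sc (of_real s) h - G h)"
      using E by (simp add: K_def ip_diff_left ip_diff_right ip_scale_left ip_scale_right G_sym)
    then show ?thesis using ip_self[OF E(2)] by (simp add: r_def)
  qed
  have "0 \<le> Re (ip (sc (of_real s) x - G x) x)"
    using le[OF xM] q[of x] xM M(2) by auto
  also have "ip (sc (of_real s) x - G x) x = ip r h - a * ip r r - a * ip K h + a * a * ip K r"
    unfolding Gx using E KE
    by (simp add: x_def ip_diff_left ip_diff_right ip_scale_left ip_scale_right a algebra_simps)
  also have "Re \<dots> = Re (ip r h) - 2 * ((nrm r)\<^sup>2 / s) + Re (ip K r) / s\<^sup>2"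
    unfolding hr ip_self[OF E(2)] a_def by (simp add: power2_eq_square)
  also have "Re (ip K r) = s * (nrm r)\<^sup>2 - Re (ip (G r) r)"
    using q[OF E(2)] by (simp add: K_def)
  also have "(s * (nrm r)\<^sup>2 - Re (ip (G r) r)) / s\<^sup>2 \<le> s * (nrm r)\<^sup>2 / s\<^sup>2"
    using order_trans[OF zero_le_power2 G_coercive[OF E(2)]] by (intro divide_right_mono) auto
  finally have "(nrm r)\<^sup>2 / s \<le> Re (ip r h)"
    using \<open>0 < s\<close> by (simp add: power2_eq_square)
  also have "Re (ip r h) = s * (nrm h)\<^sup>2 - Re (ip (G h) h)"
    using q[OF E(1)] by (simp add: r_def)
  finally show ?thesis using \<open>0 < s\<close> by (simp add: r_def field_simps)
qed

text \<open>Along a maximizing sequence \<open>h\<close> in the orthogonal complement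
  \<open>M\<close>, the residues s h - G h tend to 0 by \<open>residue_bound\<close>, and a
  subsequence of G h converges to some \<open>g\<close> in \<open>E\<close>. Hence s h converges to
  the same \<open>g\<close>, which has norm s > 0, lies in \<open>M\<close>, and is an
  eigenvector.\<close>

lemma eigenvector_exists:
  fixes n :: nat
  assumes f: "\<And>k. k < n \<Longrightarrow> f k \<in> E" "\<And>k. k < n \<Longrightarrow> G (f k) = sc (of_real (t k)) (f k)"
  shows "\<exists>g\<in>E. ip g g = 1 \<and> (\<forall>k<n. ip g (f k) = 0) \<and> (\<exists>s>0. G g = sc (of_real s) g \<and>
    (\<forall>h\<in>E. (\<forall>k<n. ip h (f k) = 0) \<longrightarrow> Re (ip (G h) h) \<le> s * (nrm h)\<^sup>2))"
proof -
  define M where "M = {h\<in>E. \<forall>k<n. ip h (f k) = 0}"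
  have ME: "M \<subseteq> E" by (auto simp: M_def)
  have subM: "subspace M"
    unfolding M_def using f(1) by (intro subspaceI) (auto simp: ip_add_left ip_scale_left)
  have GM: "G x \<in> M" if "x \<in> M" for x
    using that f unfolding M_def by (auto simp: G_E G_sym ip_scale_right)
  obtain h0 where h0: "h0 \<in> M" "h0 \<noteq> 0" using infinite_dim[of n f] f(1) unfolding M_def by blast
  define A where "A = (\<lambda>h. Re (ip (G h) h)) ` {h\<in>M. nrm h = 1}"
  define s where "s = Sup A"
  have normalize: "sc (of_real (1 / nrm h)) h \<in> M" "nrm (sc (of_real (1 / nrm h)) h) = 1"
      "Re (ip (G (sc (of_real (1 / nrm h)) h)) (sc (of_real (1 / nrm h)) h)) = Re (ip (G h) h) / (nrm h)\<^sup>2"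
    if "h \<in> M" "h \<noteq> 0" for h
  proof -
    have hE: "h \<in> E" using that ME by auto
    then have pos: "nrm h > 0" using nrm_eq_0[OF hE] nrm_ge_0[OF hE] that by linarith
    show "sc (of_real (1 / nrm h)) h \<in> M" using subM that by (intro subspace_scale)
    show "nrm (sc (of_real (1 / nrm h)) h) = 1" using pos hE by (simp add: nrm_scale norm_divide)
    show "Re (ip (G (sc (of_real (1 / nrm h)) h)) (sc (of_real (1 / nrm h)) h)) = Re (ip (G h) h) / (nrm h)\<^sup>2"
      using hE G_E by (simp add: G_scale ip_scale_left ip_scale_right power2_eq_square del: of_real_divide)
  qed
  have AI: "Re (ip (G h) h) / (nrm h)\<^sup>2 \<in> A" if "h \<in> M" "h \<noteq> 0" for h
    unfolding A_def
    by (rule image_eqI[where x = "sc (of_real (1 / nrm h)) h"]) (use normalize[OF that] in simp_all)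
  have bdd: "bdd_above A"
  proof (rule bdd_aboveI[of _ 1])
    fix a assume "a \<in> A"
    then obtain h where "h \<in> M" "nrm h = 1" "a = Re (ip (G h) h)" by (auto simp: A_def)
    then show "a \<le> 1" using Re_ip_G_le[of h] ME by auto
  qed
  have le: "Re (ip (G h) h) \<le> s * (nrm h)\<^sup>2" if h: "h \<in> M" for h
  proof (cases "h = 0")
    case False
    have hE: "h \<in> E" using h ME by auto
    have "Re (ip (G h) h) / (nrm h)\<^sup>2 \<le> s"
      unfolding s_def using AI[OF h False] bdd by (rule cSup_upper)
    then show ?thesis using nrm_eq_0[OF hE] False by (simp add: field_simps)
  qed simp
  have "A \<noteq> {}" using AI[OF h0] by auto
  have "0 < s"
  proof -
    have "0 < Re (ip (G h0) h0)" using h0 ME by (intro Re_ip_G_pos) auto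
    also have "\<dots> \<le> s * (nrm h0)\<^sup>2" using h0 by (intro le)
    finally show ?thesis using zero_le_power2[of "nrm h0"] by (simp add: zero_less_mult_iff)
  qed
  have "\<exists>h\<in>M. nrm h = 1 \<and> s - 1 / Suc k < Re (ip (G h) h)" for k
  proof -
    have "s - 1 / Suc k < Sup A" by (simp add: s_def)
    then obtain a where "a \<in> A" "s - 1 / Suc k < a" using less_cSupD[OF \<open>A \<noteq> {}\<close>] by blast
    then show ?thesis by (auto simp: A_def)
  qed
  then obtain h where h: "\<And>k. h k \<in> M" "\<And>k. nrm (h k) = 1"
    "\<And>k. s - 1 / Suc k < Re (ip (G (h k)) (h k))" by metis
  have hE: "h k \<in> E" for k using h(1) ME by blast
  obtain g r where g: "g \<in> E" and r: "strict_mono (r :: nat \<Rightarrow> nat)"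
    and lim: "(\<lambda>k. nrm (G (h (r k)) - g)) \<longlonglongrightarrow> 0"
    using G_compact[of h] hE h(2) by blast
  have "(\<lambda>k. nrm (sc (of_real s) (h k) - G (h k))) \<longlonglongrightarrow> 0"
  proof (rule tendsto_0_le)
    have "(\<lambda>k. s * (1 / Suc k)) \<longlonglongrightarrow> s * 0"
      by (intro tendsto_mult tendsto_const LIMSEQ_Suc[OF lim_1_over_n])
    then show "(\<lambda>k. sqrt (s * (1 / Suc k))) \<longlonglongrightarrow> 0"
      using tendsto_real_sqrt by fastforce
    show "\<forall>\<^sub>F k in sequentially. norm (nrm (sc (of_real s) (h k) - G (h k))) \<le> norm (sqrt (s * (1 / Suc k))) * 1"
    proof (intro always_eventually allI)
      fix k
      have "(nrm (sc (of_real s) (h k) - G (h k)))\<^sup>2 \<le> s * (s * (nrm (h k))\<^sup>2 - Re (ip (G (h k)) (h k)))"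
        using subM ME GM \<open>0 < s\<close> le h(1) by (rule residue_bound)
      also have "\<dots> \<le> s * (1 / Suc k)"
        using h(3)[of k] \<open>0 < s\<close> by (intro mult_left_mono) (auto simp: h(2))
      finally have "nrm (sc (of_real s) (h k) - G (h k)) \<le> sqrt (s * (1 / Suc k))"
        by (rule real_le_rsqrt)
      then show "norm (nrm (sc (of_real s) (h k) - G (h k))) \<le> norm (sqrt (s * (1 / Suc k))) * 1"
        using nrm_ge_0[of "sc (of_real s) (h k) - G (h k)"] hE G_E \<open>0 < s\<close> by simp
    qed
  qed
  from LIMSEQ_subseq_LIMSEQ[OF this r]
  have lim': "(\<lambda>k. nrm (sc (of_real s) (h (r k)) - G (h (r k)))) \<longlonglongrightarrow> 0" by (simp add: o_def)
  \<comment> \<open>A null sequence that dominates the distance of both s h and G h from the limit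
    \<open>g\<close>.\<close>
  define e where "e k = nrm (sc (of_real s) (h (r k)) - G (h (r k))) + nrm (G (h (r k)) - g)" for k
  have e0: "e \<longlonglongrightarrow> 0" unfolding e_def using tendsto_add[OF lim' lim] by simp
  have eg: "nrm (sc (of_real s) (h (r k)) - g) \<le> e k" for k
    unfolding e_def using hE G_E g by (intro nrm_triangle_diff) auto
  \<comment> \<open>Passage to the limit in one form: the norm of \<open>g\<close>, its
    orthogonality to the earlier vectors and the eigenvalue equation are all obtained by bounding a
    fixed number by a multiple of \<open>e\<close>.\<close>
  have small: "x \<le> 0" if "\<And>k. x \<le> c * e k" for x c :: real
    using tendsto_mult[OF tendsto_const[of c] e0] that by (intro LIMSEQ_le_const) auto
  have "nrm g = s"
  proof -
    have "\<bar>nrm (sc (of_real s) (h (r k))) - nrm g\<bar> \<le> 1 * e k" for k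
      using nrm_triangle_sub[of "sc (of_real s) (h (r k))" g] eg[of k] hE g by simp
    then have "\<bar>s - nrm g\<bar> \<le> 1 * e k" for k
      using \<open>0 < s\<close> hE by (simp add: nrm_scale h(2))
    then have "\<bar>s - nrm g\<bar> \<le> 0" by (rule small)
    then show ?thesis by simp
  qed
  have gM: "g \<in> M"
    unfolding M_def
  proof (intro CollectI conjI allI impI g)
    fix k assume k: "k < n"
    have "cmod (ip g (f k)) \<le> nrm (f k) * e j" for j
    proof -
      have "ip (sc (of_real s) (h (r j)) - g) (f k) = - ip g (f k)"
        using h(1)[of "r j"] k f(1)[OF k] g hE by (simp add: M_def ip_diff_left ip_scale_left)
      then have "cmod (ip g (f k)) \<le> nrm (sc (of_real s) (h (r j)) - g) * nrm (f k)"
        using Cauchy_Schwarz[of "sc (of_real s) (h (r j)) - g" "f k"] g hE f(1)[OF k] by simp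
      also have "\<dots> \<le> e j * nrm (f k)" using eg f(1)[OF k] by (intro mult_right_mono) auto
      finally show ?thesis by (simp add: mult.commute)
    qed
    then have "cmod (ip g (f k)) \<le> 0" by (rule small)
    then show "ip g (f k) = 0" by simp
  qed
  have Gg: "G g = sc (of_real s) g"
  proof -
    have "nrm (G g - sc (of_real s) g) \<le> (1 + s) * e k" for k
    proof -
      let ?h = "h (r k)"
      have "nrm (G g - sc (of_real s) g) \<le> nrm (G g - G (sc (of_real s) ?h)) + nrm (G (sc (of_real s) ?h) - sc (of_real s) g)"
        using hE g G_E by (intro nrm_triangle_diff) auto
      also have "G g - G (sc (of_real s) ?h) = G (g - sc (of_real s) ?h)"
        using hE g by (simp add: G_diff)
      also have "nrm \<dots> \<le> nrm (g - sc (of_real s) ?h)" using hE g by (intro nrm_G_le) auto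
      also have "\<dots> = nrm (sc (of_real s) ?h - g)" using hE g by (intro nrm_diff_commute) auto
      also have "\<dots> \<le> e k" by (rule eg)
      also have "G (sc (of_real s) ?h) - sc (of_real s) g = sc (of_real s) (G ?h - g)"
        using hE g G_E by (simp add: G_scale scale_right_diff_distrib)
      also have "nrm \<dots> = s * nrm (G ?h - g)" using hE g G_E \<open>0 < s\<close> by (simp add: nrm_scale)
      also have "\<dots> \<le> s * e k" unfolding e_def using \<open>0 < s\<close> hE G_E g by (intro mult_left_mono) auto
      finally show ?thesis by (simp add: algebra_simps)
    qed
    then have "nrm (G g - sc (of_real s) g) \<le> 0" by (rule small)
    then have "nrm (G g - sc (of_real s) g) = 0" using g G_E by (intro antisym) auto
    then show ?thesis using nrm_eq_0[of "G g - sc (of_real s) g"] g G_E by simp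
  qed
  have "g \<noteq> 0" using \<open>nrm g = s\<close> \<open>0 < s\<close> by auto
  define g1 where "g1 = sc (of_real (1 / nrm g)) g"
  have g1: "g1 \<in> M" "nrm g1 = 1" unfolding g1_def using normalize[OF gM \<open>g \<noteq> 0\<close>] by auto
  have "g1 \<in> E" using g1 ME by auto
  have "G g1 = sc (of_real s) g1"
    unfolding g1_def using g by (simp add: G_scale Gg mult.commute)
  then show ?thesis
    using g1 \<open>g1 \<in> E\<close> \<open>0 < s\<close> le ip_self[OF \<open>g1 \<in> E\<close>] unfolding M_def
    by (intro bexI[of _ g1] conjI exI[of _ s]) auto
qed

lemma eigen_system_exists: "\<exists>f s. eigen_system G f s"
proof -
  define P where "P f n p \<longleftrightarrow> fst p \<in> E \<and> ip (fst p) (fst p) = 1 \<and> (\<forall>k<n. ip (fst p) (fst (f k)) = 0) \<and>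
      G (fst p) = sc (of_real (snd p)) (fst p) \<and> 0 < snd p \<and>
      (\<forall>h\<in>E. (\<forall>k<n. ip h (fst (f k)) = 0) \<longrightarrow> Re (ip (G h) h) \<le> snd p * (nrm h)\<^sup>2)"
    for f :: "nat \<Rightarrow> 'a \<times> real" and n :: nat and p
  have "\<exists>f. \<forall>n. P f n (f n)"
  proof (rule dependent_wellorder_choice)
    show "P f n p = P g n p" if "\<And>k. k < n \<Longrightarrow> f k = g k" for f g n p
      unfolding P_def using that by simp
    show "\<exists>p. P f n p" if "\<And>k. k < n \<Longrightarrow> P f k (f k)" for f n
    proof -
      have "\<And>k. k < n \<Longrightarrow> fst (f k) \<in> E"
        "\<And>k. k < n \<Longrightarrow> G (fst (f k)) = sc (of_real (snd (f k))) (fst (f k))"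
        using that unfolding P_def by blast+
      from eigenvector_exists[of n "\<lambda>k. fst (f k)", OF this] obtain g s where
        "g \<in> E" "ip g g = 1" "\<forall>k<n. ip g (fst (f k)) = 0" "s > 0" "G g = sc (of_real s) g"
        "\<forall>h\<in>E. (\<forall>k<n. ip h (fst (f k)) = 0) \<longrightarrow> Re (ip (G h) h) \<le> s * (nrm h)\<^sup>2" by blast
      then show ?thesis unfolding P_def by (intro exI[of _ "(g, s)"]) simp
    qed
  qed
  then obtain f where "\<forall>n. P f n (f n)" by blast
  then have "eigen_system G (\<lambda>n. fst (f n)) (\<lambda>n. snd (f n))"
    unfolding eigen_system_def P_def by blast
  then show ?thesis by blast
qed

text \<open>Otherwise the vectors G (f n) would be pairwise orthogonal with norms at least
  \<open>c\<close>, hence at mutual distance more than \<open>c\<close>, which excludes a convergent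
  subsequence.\<close>

lemma eigen_system_tendsto_0:
  assumes es: "eigen_system G f s" and "0 < c"
  shows "\<exists>n. s n < c"
proof (rule ccontr)
  note f = eigen_systemD[OF es] and o = eigen_system_orthonormal[OF es]
  assume "\<not> (\<exists>n. s n < c)"
  then have ge: "c \<le> s n" for n by (simp add: not_less)
  have "nrm (f n) = 1" for n by (simp add: nrm_def o)
  then obtain g r where g: "g \<in> E" and r: "strict_mono (r :: nat \<Rightarrow> nat)"
    and lim: "(\<lambda>k. nrm (G (f (r k)) - g)) \<longlonglongrightarrow> 0"
    using G_compact[of f] f(1) by blast
  from lim obtain N where N: "\<And>k. k \<ge> N \<Longrightarrow> \<bar>nrm (G (f (r k)) - g)\<bar> < c / 2"
    using LIMSEQ_D[OF lim, of "c / 2"] \<open>0 < c\<close> by auto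
  define m n where "m = r N" and "n = r (Suc N)"
  have "m \<noteq> n" using r by (simp add: m_def n_def strict_mono_eq)
  have "nrm (G (f m) - G (f n)) \<le> nrm (G (f m) - g) + nrm (g - G (f n))"
    using f(1) g G_E by (intro nrm_triangle_diff) auto
  also have "nrm (g - G (f n)) = nrm (G (f n) - g)" using f(1) g G_E by (intro nrm_diff_commute) auto
  finally have "nrm (G (f m) - G (f n)) < c"
    using N[of N] N[of "Suc N"] by (simp add: m_def n_def)
  have "ip (G (f m) - G (f n)) (G (f m) - G (f n)) = of_real ((s m)\<^sup>2 + (s n)\<^sup>2)"
    using f(1) \<open>m \<noteq> n\<close>
    by (simp add: f(2) ip_diff_left ip_diff_right ip_scale_left ip_scale_right o power2_eq_square)
  then have "(nrm (G (f m) - G (f n)))\<^sup>2 = (s m)\<^sup>2 + (s n)\<^sup>2"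
    by (simp add: nrm_def)
  moreover have "c\<^sup>2 \<le> (s m)\<^sup>2" using ge[of m] \<open>0 < c\<close> by (intro power_mono) auto
  moreover have "(nrm (G (f m) - G (f n)))\<^sup>2 < c\<^sup>2"
    using \<open>nrm (G (f m) - G (f n)) < c\<close> f(1) G_E by (intro power_strict_mono) auto
  ultimately show False using zero_le_power2[of "s n"] by linarith
qed

text \<open>Positivity makes \<kappa> a real number c > 0. With s N < c, the part \<open>y\<close>
  of \<open>x\<close> orthogonal to the first N eigenvectors is still an eigenvector for c, but its
  Rayleigh quotient is at most s N unless it vanishes; so \<open>y = 0\<close>.\<close>

lemma eigenvector_in_span:
  assumes es: "eigen_system G f s" and x: "x \<in> E" "G x = sc \<kappa> x" and "\<kappa> \<noteq> 0"
  shows "x \<in> span (f ` {n. of_real (s n) = \<kappa>})"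
proof (cases "x = 0")
  case True
  then show ?thesis by (simp add: span_zero)
next
  case False
  note f = eigen_systemD[OF es] and o = eigen_system_orthonormal[OF es]
  have nx: "nrm x > 0" using nrm_eq_0[OF x(1)] nrm_ge_0[OF x(1)] False by linarith
  have kx: "\<kappa> * of_real ((nrm x)\<^sup>2) = of_real (Re (ip (G x) x))"
    using G_ip_real[OF x(1)] ip_self[OF x(1)] x by (simp add: ip_scale_left)
  define c where "c = Re (ip (G x) x) / (nrm x)\<^sup>2"
  have "c > 0" unfolding c_def using Re_ip_G_pos[OF x(1) False] nx by simp
  have kc: "\<kappa> = of_real c" using kx nx by (simp add: c_def field_simps)
  obtain N where N: "s N < c" using eigen_system_tendsto_0[OF es \<open>c > 0\<close>] by blast
  \<comment> \<open>By symmetry of \<open>G\<close>, eigenvectors for different eigenvalues are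
    orthogonal; only the vectors belonging to \<kappa> contribute to the expansion.\<close>
  have coef: "ip x (f k) = 0 \<or> of_real (s k) = \<kappa>" for k
  proof -
    have "\<kappa> * ip x (f k) = ip (G x) (f k)" using x f(1) by (simp add: ip_scale_left)
    also have "\<dots> = of_real (s k) * ip x (f k)"
      using x(1) f(1) by (simp add: G_sym f(2) ip_scale_right)
    finally show ?thesis by auto
  qed
  define y where "y = x - (\<Sum>k<N. sc (ip x (f k)) (f k))"
  have yE: "y \<in> E" unfolding y_def using x(1) f(1) by auto
  have "ip y (f j) = 0" if "j < N" for j
  proof -
    have "ip (\<Sum>k<N. sc (ip x (f k)) (f k)) (f j) = (\<Sum>k<N. if k = j then ip x (f j) else 0)"
      using f(1) by (simp add: ip_sum_left ip_scale_left o if_distrib cong: if_cong)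
    then show ?thesis unfolding y_def using x f(1) that by (subst ip_diff_left) auto
  qed
  then have le: "Re (ip (G y) y) \<le> s N * (nrm y)\<^sup>2" using yE by (intro f(4)) auto
  have "G y = sc \<kappa> y"
  proof -
    have "G (\<Sum>k<N. sc (ip x (f k)) (f k)) = (\<Sum>k<N. sc (ip x (f k) * of_real (s k)) (f k))"
      using f(1) by (subst G_sum) (auto simp: G_scale f(2))
    also have "\<dots> = (\<Sum>k<N. sc (\<kappa> * ip x (f k)) (f k))"
    proof (rule sum.cong[OF refl])
      fix k
      show "sc (ip x (f k) * of_real (s k)) (f k) = sc (\<kappa> * ip x (f k)) (f k)"
        using coef[of k] by (auto simp: mult.commute)
    qed
    also have "\<dots> = sc \<kappa> (\<Sum>k<N. sc (ip x (f k)) (f k))"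
      by (simp add: scale_sum_right)
    finally show ?thesis unfolding y_def using x f(1) by (subst G_diff) (auto simp: scale_right_diff_distrib)
  qed
  then have "c * (nrm y)\<^sup>2 \<le> s N * (nrm y)\<^sup>2"
    using le ip_self[OF yE] yE by (simp add: kc ip_scale_left)
  then have "\<not> 0 < (nrm y)\<^sup>2" using N by (auto simp: mult_le_cancel_right)
  then have "y = 0" using nrm_eq_0[OF yE] by simp
  then have "x = (\<Sum>k<N. sc (ip x (f k)) (f k))" by (simp add: y_def)
  also have "\<dots> \<in> span (f ` {n. of_real (s n) = \<kappa>})"
  proof (rule span_sum)
    fix k
    show "sc (ip x (f k)) (f k) \<in> span (f ` {n. of_real (s n) = \<kappa>})"
      using coef[of k]
    proof
      assume "of_real (s k) = \<kappa>"
      then show ?thesis by (intro span_scale span_base imageI CollectI)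
    qed (simp add: span_zero)
  qed
  finally show ?thesis .
qed

lemma eigen_system_multiplicity:
  assumes es: "eigen_system G f s" and "\<kappa> \<noteq> 0"
  shows "finite {n. of_real (s n) = \<kappa>}"
    and "dim {x\<in>E. G x = sc \<kappa> x} = card {n. of_real (s n) = \<kappa>}"
proof -
  note f = eigen_systemD[OF es] and o = eigen_system_orthonormal[OF es]
  let ?K = "{n. complex_of_real (s n) = \<kappa>}"
  show fin: "finite ?K"
  proof (cases "?K = {}")
    case False
    then obtain n where n: "of_real (s n) = \<kappa>" by blast
    obtain N where N: "s N < s n" using eigen_system_tendsto_0[OF es f(3)] by blast
    have "?K \<subseteq> {..<N}"
    proof
      fix k assume "k \<in> ?K"
      then have "s k = s n" using n by (metis mem_Collect_eq of_real_eq_iff)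
      then show "k \<in> {..<N}" using N eigen_system_antimono[OF es, of N k] by (cases "N \<le> k") auto
    qed
    then show ?thesis by (rule finite_subset) simp
  qed simp
  have inj: "inj_on f ?K" using o by (intro inj_onI) (metis zero_neq_one)
  show "dim {x\<in>E. G x = sc \<kappa> x} = card ?K"
  proof (rule dim_unique)
    show "f ` ?K \<subseteq> {x\<in>E. G x = sc \<kappa> x}" using f by auto
    show "{x\<in>E. G x = sc \<kappa> x} \<subseteq> span (f ` ?K)"
      using eigenvector_in_span[OF es] \<open>\<kappa> \<noteq> 0\<close> by blast
    show "independent (f ` ?K)"
    proof (rule independent_if_scalars_zero)
      show "finite (f ` ?K)" using fin by simp
      fix u b assume sum: "(\<Sum>x\<in>f ` ?K. sc (u x) x) = 0" and "b \<in> f ` ?K"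
      then obtain j where j: "j \<in> ?K" "b = f j" by blast
      have "(\<Sum>k\<in>?K. sc (u (f k)) (f k)) = 0" using sum inj by (simp add: sum.reindex)
      then have "0 = ip (\<Sum>k\<in>?K. sc (u (f k)) (f k)) (f j)" using f(1) by simp
      also have "\<dots> = (\<Sum>k\<in>?K. ip (sc (u (f k)) (f k)) (f j))"
        using f(1) by (intro ip_sum_left fin) auto
      also have "\<dots> = (\<Sum>k\<in>?K. if k = j then u (f j) else 0)"
        by (rule sum.cong) (auto simp: ip_scale_left o f(1))
      also have "\<dots> = u b" using j sum.delta[OF fin, of j "\<lambda>_. u (f j)"] by simp
      finally show "u b = 0" by simp
    qed
    show "card (f ` ?K) = card ?K" using inj by (rule card_image)
  qed
qed

text \<open>Counterpart of the upper bound in \<open>eigen_system\<close>: on the span of the first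
  n + 1 eigenvectors the form is diagonal with entries at least \<open>s n\<close>.\<close>

lemma eigen_system_form_ge:
  assumes es: "eigen_system G f s" and h: "h = (\<Sum>k\<le>n. sc (c k) (f k))"
  shows "s n * (nrm h)\<^sup>2 \<le> Re (ip (G h) h)"
proof -
  note f = eigen_systemD[OF es] and o = eigen_system_orthonormal[OF es]
  have E: "(\<Sum>k\<le>n. sc (d k) (f k)) \<in> E" for d using f(1) by auto
  have ip: "ip (\<Sum>k\<le>n. sc (d k) (f k)) h = (\<Sum>k\<le>n. d k * cnj (c k))" for d
  proof -
    have "ip (f k) h = cnj (c k)" if "k \<le> n" for k
    proof -
      have "ip (f k) h = (\<Sum>j\<le>n. if j = k then cnj (c k) else 0)"
        unfolding h using f(1) that
        by (simp add: ip_sum_right ip_scale_right o if_distrib cong: if_cong)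
      then show ?thesis using that by simp
    qed
    then show ?thesis using f(1) E[of c] unfolding h[symmetric]
      by (subst ip_sum_left) (auto simp: ip_scale_left)
  qed
  have Gh: "G h = (\<Sum>k\<le>n. sc (of_real (s k) * c k) (f k))"
    unfolding h using f(1) by (subst G_sum) (auto simp: G_scale f(2) mult.commute)
  have re: "Re (of_real a * x * cnj x) = a * (cmod x)\<^sup>2" for a x
    unfolding cmod_power2 by (simp add: power2_eq_square algebra_simps)
  have "h \<in> E" using E[of c] h by simp
  have "(nrm h)\<^sup>2 = Re (ip h h)" using ip_self[OF \<open>h \<in> E\<close>] by simp
  also have "ip h h = (\<Sum>k\<le>n. c k * cnj (c k))" using ip[of c] unfolding h[symmetric] .
  also have "Re \<dots> = (\<Sum>k\<le>n. (cmod (c k))\<^sup>2)" using re[of 1] unfolding Re_sum by simp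
  finally have "s n * (nrm h)\<^sup>2 = (\<Sum>k\<le>n. s n * (cmod (c k))\<^sup>2)" by (simp add: sum_distrib_left)
  also have "\<dots> \<le> (\<Sum>k\<le>n. s k * (cmod (c k))\<^sup>2)"
    using eigen_system_antimono[OF es] by (intro sum_mono mult_right_mono) auto
  also have "\<dots> = Re (ip (G h) h)"
    unfolding Gh ip Re_sum re ..
  finally show ?thesis .
qed

end

text \<open>
  Courant--Fischer: some nonzero combination \<open>h\<close> of the first eigenvectors of one operator meets
  finitely many linear conditions, which put the other form below its eigenvalue on \<open>h\<close>.
\<close>

context complex_inner_space
begin

lemma eigen_system_compare:
  assumes G: "compact_positive sc E ip G" and es: "eigen_system G f s"
    and es': "eigen_system G' f' s'"
    and \<phi>: "\<And>x y. x \<in> E \<Longrightarrow> y \<in> E \<Longrightarrow> \<phi> (x + y) = \<phi> x + \<phi> y"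
      "\<And>c x. x \<in> E \<Longrightarrow> \<phi> (sc c x) = c * (\<phi> x :: complex)"
    and le: "\<And>h. h \<in> E \<Longrightarrow> \<phi> h = 0 \<Longrightarrow> Re (ip (G h) h) \<le> Re (ip (G' h) h)"
  shows "s (Suc n) \<le> s' n"
    and "(\<And>h. \<phi> h = 0) \<Longrightarrow> s n \<le> s' n"
proof -
  interpret G: compact_positive sc E ip G by (rule G)
  note f = eigen_systemD[OF es] and o = eigen_system_orthonormal[OF es]
    and f' = eigen_systemD[OF es']
  have \<phi>0: "\<phi> 0 = 0" using \<phi>(2)[of 0 0] by simp
  have \<phi>sum: "\<phi> (\<Sum>k\<in>A. sc (c k) (f k)) = (\<Sum>k\<in>A. c k * \<phi> (f k))" if "finite A" for A c
    using that f(1) by (induction A rule: finite_induct) (auto simp: \<phi>0 \<phi>)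
  have main: "s m \<le> s' n"
    if c: "\<exists>k\<le>m. c k \<noteq> 0" "\<forall>j<n. (\<Sum>k\<le>m. c k * ip (f k) (f' j)) = 0"
      "(\<Sum>k\<le>m. c k * \<phi> (f k)) = 0" for c m
  proof -
    define h where "h = (\<Sum>k\<le>m. sc (c k) (f k))"
    have hE: "h \<in> E" unfolding h_def using f(1) by auto
    have "ip h (f' j) = 0" if "j < n" for j
      using c(2) that f(1) f'(1) by (simp add: h_def ip_sum_left ip_scale_left)
    then have "Re (ip (G' h) h) \<le> s' n * (nrm h)\<^sup>2" using hE by (intro f'(4)) auto
    moreover have "\<phi> h = 0" using c(3) by (simp add: h_def \<phi>sum)
    then have "Re (ip (G h) h) \<le> Re (ip (G' h) h)" using hE by (intro le)
    moreover have "s m * (nrm h)\<^sup>2 \<le> Re (ip (G h) h)"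
      by (rule G.eigen_system_form_ge[OF es h_def])
    ultimately have *: "s m * (nrm h)\<^sup>2 \<le> s' n * (nrm h)\<^sup>2" by linarith
    have "h \<noteq> 0"
    proof
      assume "h = 0"
      from c(1) obtain k where k: "k \<le> m" "c k \<noteq> 0" by blast
      have "ip h (f k) = (\<Sum>j\<le>m. if j = k then c k else 0)"
        unfolding h_def using f(1) k
        by (simp add: ip_sum_left ip_scale_left o if_distrib cong: if_cong)
      with k \<open>h = 0\<close> f(1) show False by simp
    qed
    then have "0 < (nrm h)\<^sup>2" using nrm_eq_0[OF hE] by simp
    with * show ?thesis by simp
  qed
  show "s (Suc n) \<le> s' n"
  proof -
    \<comment> \<open>n orthogonality conditions and, indexed by \<open>None\<close>, the condition
      on \<phi>, against n + 2 coefficients: the extra condition costs one index.\<close>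
    have "card (insert None (Some ` {..<n})) < card {..Suc n}" by (simp add: card_image)
    then obtain c where c: "\<exists>k\<in>{..Suc n}. c k \<noteq> 0"
      "\<forall>i\<in>insert None (Some ` {..<n}). (\<Sum>k\<le>Suc n. c k *
        (case i of None \<Rightarrow> \<phi> (f k) | Some j \<Rightarrow> ip (f k) (f' j))) = 0"
      using homogeneous_system_nontrivial[of "insert None (Some ` {..<n})" "{..Suc n}"
        "\<lambda>i k. case i of None \<Rightarrow> \<phi> (f k) | Some j \<Rightarrow> ip (f k) (f' j)"] by auto
    show ?thesis by (rule main[of "Suc n" c]) (use c in auto)
  qed
  show "s n \<le> s' n" if "\<And>h. \<phi> h = 0"
  proof -
    obtain c where c: "\<exists>k\<in>{..n}. c k \<noteq> 0" "\<forall>j\<in>{..<n}. (\<Sum>k\<le>n. c k * ip (f k) (f' j)) = 0"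
      using homogeneous_system_nontrivial[of "{..<n}" "{..n}" "\<lambda>j k. ip (f k) (f' j)"] by auto
    show ?thesis by (rule main[of n c]) (use c that in auto)
  qed
qed

end

section \<open>Functions on an edge\<close>

lemma L2_on_imp_absolutely_integrable:
  fixes g :: "real \<Rightarrow> 'a::euclidean_space"
  assumes "L2_on {a..b} g"
  shows "g absolutely_integrable_on {a..b}"
proof -
  have "integrable (lebesgue_on {a..b}) g"
  proof (rule Bochner_Integration.integrable_bound)
    show "integrable (lebesgue_on {a..b}) (\<lambda>x. 1 + (norm (g x))\<^sup>2)"
      using assms continuous_imp_integrable_real[of a b "\<lambda>_. 1"]
      by (intro Bochner_Integration.integrable_add) (auto simp: L2_on_def)
    show "g \<in> borel_measurable (lebesgue_on {a..b})" using assms by (simp add: L2_on_def)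
    show "AE x in lebesgue_on {a..b}. norm (g x) \<le> norm (1 + (norm (g x))\<^sup>2)"
    proof (rule AE_I2)
      fix x
      have "2 * norm (g x) \<le> 1 + (norm (g x))\<^sup>2"
        using sum_squares_bound[of 1 "norm (g x)"] by simp
      then have "norm (g x) \<le> 1 + (norm (g x))\<^sup>2"
        using norm_ge_zero[of "g x"] by linarith
      then show "norm (g x) \<le> norm (1 + (norm (g x))\<^sup>2)" by simp
    qed
  qed
  then show ?thesis by (simp add: set_integrable_def integrable_restrict_space)
qed

lemma continuous_on_bounded_norm:
  fixes u :: "real \<Rightarrow> 'a::real_normed_vector"
  assumes "continuous_on {a..b} u"
  obtains B where "B \<ge> 0" "\<And>x. x \<in> {a..b} \<Longrightarrow> norm (u x) \<le> B"
proof -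
  have "bounded (u ` {a..b})" using assms by (intro compact_imp_bounded compact_continuous_image) auto
  then obtain B where "B > 0" "\<And>x. x \<in> {a..b} \<Longrightarrow> norm (u x) \<le> B"
    unfolding bounded_pos by auto
  then show thesis using that[of B] by auto
qed

text \<open>Makes the expression prescribed by the differential equation admissible as a second weak
  derivative.\<close>

lemma L2_on_affine:
  fixes u h :: "real \<Rightarrow> complex"
  assumes Q: "L2_on {a..b} Q" and u: "continuous_on {a..b} u" and h: "continuous_on {a..b} h"
  shows "L2_on {a..b} (\<lambda>x. of_real (Q x) * u x - h x)"
  unfolding L2_on_def
proof
  have Qm: "Q \<in> borel_measurable (lebesgue_on {a..b})" using Q by (simp add: L2_on_def)
  have um: "u \<in> borel_measurable (lebesgue_on {a..b})" "h \<in> borel_measurable (lebesgue_on {a..b})"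
    using u h by (auto intro: continuous_imp_measurable_on_sets_lebesgue)
  show m: "(\<lambda>x. of_real (Q x) * u x - h x) \<in> borel_measurable (lebesgue_on {a..b})"
    using Qm um by measurable
  obtain B where B: "B \<ge> 0" "\<And>x. x \<in> {a..b} \<Longrightarrow> norm (u x) \<le> B"
    using continuous_on_bounded_norm[OF u] by blast
  obtain C where C: "C \<ge> 0" "\<And>x. x \<in> {a..b} \<Longrightarrow> norm (h x) \<le> C"
    using continuous_on_bounded_norm[OF h] by blast
  show "integrable (lebesgue_on {a..b}) (\<lambda>x. (norm (of_real (Q x) * u x - h x))\<^sup>2)"
  proof (rule Bochner_Integration.integrable_bound)
    show "integrable (lebesgue_on {a..b}) (\<lambda>x. 2 * B\<^sup>2 * (norm (Q x))\<^sup>2 + 2 * C\<^sup>2)"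
      using Q continuous_imp_integrable_real[of a b "\<lambda>_. 2 * C\<^sup>2"]
      by (intro Bochner_Integration.integrable_add integrable_mult_right) (auto simp: L2_on_def)
    show "(\<lambda>x. (norm (of_real (Q x) * u x - h x))\<^sup>2) \<in> borel_measurable (lebesgue_on {a..b})"
      using m by measurable
    show "AE x in lebesgue_on {a..b}. norm ((norm (of_real (Q x) * u x - h x))\<^sup>2)
        \<le> norm (2 * B\<^sup>2 * (norm (Q x))\<^sup>2 + 2 * C\<^sup>2)"
    proof (rule AE_I2)
      fix x assume "x \<in> space (lebesgue_on {a..b})"
      then have x: "x \<in> {a..b}" by simp
      have "norm (of_real (Q x) * u x - h x) \<le> \<bar>Q x\<bar> * B + C"
        using B(2)[OF x] C(2)[OF x]
        by (intro order_trans[OF norm_triangle_ineq4] add_mono) (auto simp: norm_mult mult_left_mono)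
      then have "(norm (of_real (Q x) * u x - h x))\<^sup>2 \<le> (\<bar>Q x\<bar> * B + C)\<^sup>2"
        by (intro power_mono) auto
      also have "\<dots> \<le> 2 * (\<bar>Q x\<bar> * B)\<^sup>2 + 2 * C\<^sup>2"
        using sum_squares_bound[of "\<bar>Q x\<bar> * B" C] by (simp add: power2_sum)
      also have "\<dots> = 2 * B\<^sup>2 * (norm (Q x))\<^sup>2 + 2 * C\<^sup>2" by (simp add: power_mult_distrib)
      finally show "norm ((norm (of_real (Q x) * u x - h x))\<^sup>2)
        \<le> norm (2 * B\<^sup>2 * (norm (Q x))\<^sup>2 + 2 * C\<^sup>2)" by simp
    qed
  qed
qed

lemma absolutely_integrable_mult_continuous:
  fixes g v :: "real \<Rightarrow> complex"
  assumes "g absolutely_integrable_on {a..b}" "continuous_on {a..b} v"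
  shows "(\<lambda>x. g x * v x) absolutely_integrable_on {a..b}"
proof -
  have "(\<lambda>x. v x * g x) absolutely_integrable_on {a..b}"
  proof (rule absolutely_integrable_bounded_measurable_product[where h = "(*)"])
    show "bilinear ((*) :: complex \<Rightarrow> complex \<Rightarrow> complex)"
      by (simp add: bilinear_conv_bounded_bilinear bounded_bilinear_mult)
    show "v \<in> borel_measurable (lebesgue_on {a..b})"
      using assms(2) by (intro continuous_imp_measurable_on_sets_lebesgue) auto
    show "bounded (v ` {a..b})"
      using assms(2) by (intro compact_imp_bounded compact_continuous_image) auto
  qed (use assms in auto)
  then show ?thesis by (simp add: mult.commute)
qed

lemma absolutely_integrable_of_real_mult:
  fixes v :: "real \<Rightarrow> complex"
  assumes "Q absolutely_integrable_on {a..b}" "continuous_on {a..b} v"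
  shows "(\<lambda>x. of_real (Q x) * v x) absolutely_integrable_on {a..b}"
proof -
  have "(\<lambda>x. complex_of_real (Q x)) absolutely_integrable_on {a..b}"
    using absolutely_integrable_linear[OF assms(1) bounded_linear_of_real] by (simp add: o_def)
  then show ?thesis using assms(2) by (rule absolutely_integrable_mult_continuous)
qed

text \<open>Subdividing \<open>[0, l]\<close> into n equal parts gives each increment of
  \<open>F\<close> a factor l / n, while the increments of \<open>H\<close> telescope; the total is
  of order 1 / n. This does the work of a vanishing derivative for an \<open>F\<close> that need not
  be differentiable.\<close>

lemma superadditive_increments_imp_const:
  fixes F :: "real \<Rightarrow> 'a::real_normed_vector"
  assumes "0 \<le> l" "0 \<le> C"
    and *: "\<And>a b. 0 \<le> a \<Longrightarrow> a \<le> b \<Longrightarrow> b \<le> l \<Longrightarrow> norm (F b - F a) \<le> C * (b - a) * (H b - H a)"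
  shows "F l = F 0"
proof -
  have bound: "norm (F l - F 0) \<le> C * l * (H l - H 0) / real n" if "n > 0" for n :: nat
  proof -
    define x where "x i = l * real i / real n" for i
    have x: "0 \<le> x i" "x i \<le> x (Suc i)" for i
      using \<open>0 \<le> l\<close> by (auto simp: x_def intro!: divide_right_mono mult_left_mono)
    have xn: "x (Suc i) \<le> l" if "i < n" for i
      using \<open>0 \<le> l\<close> that \<open>n > 0\<close> by (simp add: x_def divide_le_eq mult_left_mono)
    have "F l - F 0 = F (x n) - F (x 0)" using that by (simp add: x_def)
    also have "\<dots> = (\<Sum>i<n. F (x (Suc i)) - F (x i))" by (rule sum_lessThan_telescope[symmetric])
    also have "norm \<dots> \<le> (\<Sum>i<n. C * l / n * (H (x (Suc i)) - H (x i)))"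
    proof (rule sum_norm_le)
      fix i assume i: "i \<in> {..<n}"
      have "x (Suc i) - x i = l / n" using that by (simp add: x_def field_simps)
      then show "norm (F (x (Suc i)) - F (x i)) \<le> C * l / n * (H (x (Suc i)) - H (x i))"
        using *[of "x i" "x (Suc i)"] x[of i] xn[of i] i by simp
    qed
    also have "\<dots> = C * l / n * (H (x n) - H (x 0))"
      unfolding sum_distrib_left[symmetric] by (simp add: sum_lessThan_telescope[of "\<lambda>i. H (x i)"])
    also have "\<dots> = C * l * (H l - H 0) / n" using that by (simp add: x_def)
    finally show ?thesis .
  qed
  have "(\<lambda>n. C * l * (H l - H 0) / real (Suc n)) \<longlonglongrightarrow> 0"
    using LIMSEQ_Suc[OF lim_const_over_n[of "C * l * (H l - H 0)"]] by simp
  then have "norm (F l - F 0) \<le> 0"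
    using bound[of "Suc n" for n]
    by (intro LIMSEQ_le_const[where X = "\<lambda>n. C * l * (H l - H 0) / real (Suc n)"]) blast+
  then show ?thesis by simp
qed

text \<open>
  On \<open>[a, b]\<close> the defect \<open>F\<close> of the formula changes by at most a multiple of \<open>(b - a) * integral {a..b} |g|\<close>, so
  subdividing shows that it does not change at all.
\<close>

lemma absolutely_continuous_by_parts:
  fixes g v v' :: "real \<Rightarrow> complex"
  assumes "0 \<le> l" and g: "g absolutely_integrable_on {0..l}"
    and U: "\<And>x. x \<in> {0..l} \<Longrightarrow> (g has_integral (U x - U 0)) {0..x}"
    and v: "\<And>x. x \<in> {0..l} \<Longrightarrow> (v has_vector_derivative v' x) (at x within {0..l})"
    and v': "continuous_on {0..l} v'"
  shows "integral {0..l} (\<lambda>x. g x * v x) = U l * v l - U 0 * v 0 - integral {0..l} (\<lambda>x. U x * v' x)"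
proof -
  have vc: "continuous_on {0..l} v"
    using v has_vector_derivative_continuous unfolding continuous_on_eq_continuous_within by blast
  have gi: "g integrable_on {0..l}" using g by (simp add: absolutely_integrable_on_def)
  have gn: "(\<lambda>x. norm (g x)) integrable_on {0..l}"
    using g by (simp add: absolutely_integrable_on_def)
  have Ueq: "U x = U 0 + integral {0..x} g" if "x \<in> {0..l}" for x
    using U[OF that] by (simp add: integral_unique)
  have "continuous_on {0..l} (\<lambda>x. U 0 + integral {0..x} g)"
    using gi by (intro continuous_intros indefinite_integral_continuous_1)
  then have Uc: "continuous_on {0..l} U" by (subst continuous_on_cong[OF refl Ueq]) auto
  obtain K where K: "K \<ge> 0" "\<And>x. x \<in> {0..l} \<Longrightarrow> norm (v' x) \<le> K"
    using continuous_on_bounded_norm[OF v'] by blast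
  have gv: "(\<lambda>x. g x * v x) integrable_on {0..l}"
    using absolutely_integrable_mult_continuous[OF g vc] by (simp add: absolutely_integrable_on_def)
  have Uv: "(\<lambda>x. U x * v' x) integrable_on {0..l}"
    using Uc v' by (intro integrable_continuous_interval continuous_intros)
  define F where "F x = integral {0..x} (\<lambda>x. g x * v x) + integral {0..x} (\<lambda>x. U x * v' x) - U x * v x" for x
  define H where "H x = integral {0..x} (\<lambda>x. norm (g x))" for x
  have diff: "integral {0..b} f - integral {0..a} f = integral {a..b} f"
    if "f integrable_on {0..l}" "0 \<le> a" "a \<le> b" "b \<le> l" for f :: "real \<Rightarrow> 'b::euclidean_space" and a b
    using Henstock_Kurzweil_Integration.integral_combine[OF that(2,3), of f] that
      integrable_on_subinterval[OF that(1), of 0 b] by (simp add: algebra_simps)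
  have "F l = F 0"
  proof (rule superadditive_increments_imp_const[where C = "2 * K" and H = H])
    fix a b assume ab: "0 \<le> a" "a \<le> b" "b \<le> l"
    have sub: "{a..b} \<subseteq> {0..l}" using ab by auto
    have vab: "(v' has_integral (v b - v a)) {a..b}"
      using ab v by (intro fundamental_theorem_of_calculus)
        (auto intro: has_vector_derivative_within_subset[OF _ sub])
    have gab: "g integrable_on {a..b}" using gi sub by (rule integrable_on_subinterval)
    have Uba: "U b - U a = integral {a..b} g"
      using diff[OF gi ab] Ueq[of a] Ueq[of b] ab by simp
    have i1: "(\<lambda>x. g x * v x) integrable_on {a..b}" "(\<lambda>x. U x * v' x) integrable_on {a..b}"
      using gv Uv sub by (auto intro: integrable_on_subinterval)
    have i2: "(\<lambda>x. g x * v a) integrable_on {a..b}" using gab by (intro integrable_on_mult_left)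
    have i3: "(\<lambda>x. U b * v' x) integrable_on {a..b}"
      using vab by (intro integrable_on_mult_right) auto
    \<comment> \<open>The boundary increment is split with \<open>v\<close> frozen at
      \<open>a\<close> and \<open>U\<close> frozen at \<open>b\<close>. Both pieces are integrals
      over \<open>[a, b]\<close>, so only the deviations of \<open>v\<close> from \<open>v a\<close>
      and of \<open>U\<close> from \<open>U b\<close> remain, and each of them is small.\<close>
    have "F b - F a = integral {a..b} (\<lambda>x. g x * v x) + integral {a..b} (\<lambda>x. U x * v' x)
        - ((U b - U a) * v a + U b * (v b - v a))"
      using diff[OF gv ab] diff[OF Uv ab] by (simp add: F_def algebra_simps)
    also have "(U b - U a) * v a = integral {a..b} (\<lambda>x. g x * v a)"
      unfolding Uba by simp
    also have "U b * (v b - v a) = integral {a..b} (\<lambda>x. U b * v' x)"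
      using vab by (simp add: integral_unique)
    also have "integral {a..b} (\<lambda>x. g x * v x) + integral {a..b} (\<lambda>x. U x * v' x)
        - (integral {a..b} (\<lambda>x. g x * v a) + integral {a..b} (\<lambda>x. U b * v' x))
        = integral {a..b} (\<lambda>x. (g x * v x - g x * v a) + (U x * v' x - U b * v' x))"
      using i1 i2 i3 by (subst integral_add integral_diff; (intro integrable_diff)?)+ (auto simp: integral_diff)
    also have "norm \<dots> \<le> integral {a..b} (\<lambda>x. K * (b - a) * norm (g x) + K * (H b - H a))"
    proof (rule integral_norm_bound_integral)
      show "(\<lambda>x. (g x * v x - g x * v a) + (U x * v' x - U b * v' x)) integrable_on {a..b}"
        using i1 i2 i3 by (intro integrable_add integrable_diff)
      show "(\<lambda>x. K * (b - a) * norm (g x) + K * (H b - H a)) integrable_on {a..b}"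
        using integrable_on_subinterval[OF gn sub]
        by (intro integrable_add integrable_on_mult_right) auto
      fix x assume x: "x \<in> {a..b}"
      have xl: "x \<in> {0..l}" using x sub by auto
      have vx: "(v' has_integral (v x - v a)) {a..x}"
        using ab x by (intro fundamental_theorem_of_calculus)
          (auto intro: has_vector_derivative_within_subset[OF v])
      have "norm (v x - v a) \<le> K * (x - a)"
        using has_integral_bound_real[OF K(1) finite.emptyI vx] K(2) ab x by auto
      also have "\<dots> \<le> K * (b - a)" using x K(1) by (intro mult_left_mono) auto
      finally have "norm (g x * v x - g x * v a) \<le> norm (g x) * (K * (b - a))"
        unfolding right_diff_distrib[symmetric] norm_mult by (intro mult_left_mono) auto
      moreover have "norm (U x * v' x - U b * v' x) \<le> (H b - H a) * K"
      proof -
        have "norm (U x - U b) = norm (integral {x..b} g)"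
          using diff[OF gi, of x b] Ueq[OF xl] Ueq[of b] x ab by (simp add: norm_minus_commute)
        also have "\<dots> \<le> integral {x..b} (\<lambda>x. norm (g x))"
          using gi gn x ab
          by (intro integral_norm_bound_integral) (auto intro: integrable_on_subinterval)
        also have "\<dots> \<le> integral {a..b} (\<lambda>x. norm (g x))"
          using gn x ab by (intro integral_subset_le) (auto intro: integrable_on_subinterval)
        also have "\<dots> = H b - H a" using diff[OF gn ab] by (simp add: H_def)
        finally have "norm (U x - U b) \<le> H b - H a" .
        then show ?thesis
          unfolding left_diff_distrib[symmetric] norm_mult
          using K(2)[OF xl] order_trans[OF norm_ge_zero \<open>norm (U x - U b) \<le> H b - H a\<close>]
          by (intro mult_mono) auto
      qed
      ultimately show "norm ((g x * v x - g x * v a) + (U x * v' x - U b * v' x))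
          \<le> K * (b - a) * norm (g x) + K * (H b - H a)"
        using norm_triangle_ineq[of "g x * v x - g x * v a" "U x * v' x - U b * v' x"]
        by (simp add: mult.commute)
    qed
    also have "\<dots> = integral {a..b} (\<lambda>x. K * (b - a) * norm (g x)) + integral {a..b} (\<lambda>x. K * (H b - H a))"
      using integrable_on_subinterval[OF gn sub]
      by (intro integral_add integrable_on_mult_right) auto
    also have "\<dots> = K * (b - a) * (H b - H a) + (b - a) * (K * (H b - H a))"
      using diff[OF gn ab] ab by (simp add: H_def)
    also have "\<dots> = 2 * K * (b - a) * (H b - H a)" by (simp add: algebra_simps)
    finally show "norm (F b - F a) \<le> 2 * K * (b - a) * (H b - H a)" .
  qed (use \<open>0 \<le> l\<close> K(1) in auto)
  then have *: "integral {0..l} (\<lambda>x. g x * v x) + integral {0..l} (\<lambda>x. U x * v' x) - U l * v l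
      = - (U 0 * v 0)" by (simp add: F_def)
  have "integral {0..l} (\<lambda>x. g x * v x) = (integral {0..l} (\<lambda>x. g x * v x)
      + integral {0..l} (\<lambda>x. U x * v' x) - U l * v l) + U l * v l - integral {0..l} (\<lambda>x. U x * v' x)"
    by simp
  then show ?thesis unfolding * by simp
qed

section \<open>Differentiable functions on an edge and the weak equation\<close>

definition C1_edge :: "real \<Rightarrow> (real \<Rightarrow> complex) \<Rightarrow> bool" where
  "C1_edge l u \<longleftrightarrow> (\<forall>x\<in>{0..l}. u differentiable (at x within {0..l})) \<and> continuous_on {0..l} (deriv_on l u)"

lemma C1_edge_has_vector_derivative:
  "C1_edge l u \<Longrightarrow> x \<in> {0..l} \<Longrightarrow> (u has_vector_derivative deriv_on l u x) (at x within {0..l})"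
  unfolding C1_edge_def deriv_on_def by (simp add: vector_derivative_works)

lemma C1_edge_continuous: "C1_edge l u \<Longrightarrow> continuous_on {0..l} u"
  using C1_edge_has_vector_derivative has_vector_derivative_continuous
  unfolding continuous_on_eq_continuous_within by blast

lemma C1_edge_continuous_deriv: "C1_edge l u \<Longrightarrow> continuous_on {0..l} (deriv_on l u)"
  by (simp add: C1_edge_def)

lemma deriv_on_eqI:
  assumes "0 < l" "x \<in> {0..l}" "(u has_vector_derivative d) (at x within {0..l})"
  shows "deriv_on l u x = d"
  using vector_derivative_within_cbox[of 0 l x u d] assms unfolding deriv_on_def by simp

lemma C1_edgeI:
  assumes "0 < l" "\<And>x. x \<in> {0..l} \<Longrightarrow> (u has_vector_derivative d x) (at x within {0..l})"
    "continuous_on {0..l} d"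
  shows "C1_edge l u" "\<And>x. x \<in> {0..l} \<Longrightarrow> deriv_on l u x = d x"
proof -
  show eq: "\<And>x. x \<in> {0..l} \<Longrightarrow> deriv_on l u x = d x" using assms by (intro deriv_on_eqI)
  have "continuous_on {0..l} (deriv_on l u)"
    using assms(3) by (subst continuous_on_cong[OF refl eq])
  then show "C1_edge l u" unfolding C1_edge_def
    using assms(2) has_vector_derivative_def differentiable_def by blast
qed

lemma C1_edge_lincomb:
  assumes "0 < l" "C1_edge l u" "C1_edge l v"
  shows "C1_edge l (\<lambda>x. a * u x + b * v x)"
    and "\<And>x. x \<in> {0..l} \<Longrightarrow> deriv_on l (\<lambda>x. a * u x + b * v x) x = a * deriv_on l u x + b * deriv_on l v x"
proof -
  have 1: "((\<lambda>x. a * u x + b * v x) has_vector_derivative (a * deriv_on l u x + b * deriv_on l v x)) (at x within {0..l})"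
    if "x \<in> {0..l}" for x
    using that assms
    by (intro has_vector_derivative_add has_vector_derivative_mult_right C1_edge_has_vector_derivative)
  have 2: "continuous_on {0..l} (\<lambda>x. a * deriv_on l u x + b * deriv_on l v x)"
    using assms by (intro continuous_intros C1_edge_continuous_deriv)
  show "C1_edge l (\<lambda>x. a * u x + b * v x)"
    and "\<And>x. x \<in> {0..l} \<Longrightarrow> deriv_on l (\<lambda>x. a * u x + b * v x) x = a * deriv_on l u x + b * deriv_on l v x"
    using C1_edgeI[OF \<open>0 < l\<close> 1 2] by auto
qed

text \<open>The equation - u'' + Q u = h, integrated once. Square integrability of u'' is absent
  because it follows when \<open>Q\<close> is square-integrable and \<open>h\<close> is continuous,
  see \<open>edge_sol_iff_has_second_weak_deriv\<close>. In the application \<open>Q\<close> is the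
  potential minus \<mu>.\<close>

definition edge_sol :: "real \<Rightarrow> (real \<Rightarrow> real) \<Rightarrow> (real \<Rightarrow> complex) \<Rightarrow> (real \<Rightarrow> complex) \<Rightarrow> bool" where
  "edge_sol l Q u h \<longleftrightarrow> C1_edge l u \<and> (\<forall>x\<in>{0..l}.
    ((\<lambda>x. of_real (Q x) * u x - h x) has_integral (deriv_on l u x - deriv_on l u 0)) {0..x})"

lemma edge_sol_C1: "edge_sol l Q u h \<Longrightarrow> C1_edge l u"
  by (simp add: edge_sol_def)

lemma has_second_weak_deriv_C1:
  assumes "0 < l" "has_second_weak_deriv l u g"
  shows "C1_edge l u"
proof -
  have g: "g absolutely_integrable_on {0..l}"
    using assms by (intro L2_on_imp_absolutely_integrable) (simp add: has_second_weak_deriv_def)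
  have eq: "deriv_on l u x = deriv_on l u 0 + integral {0..x} g" if "x \<in> {0..l}" for x
  proof -
    have "(g has_integral (deriv_on l u x - deriv_on l u 0)) {0..x}"
      using assms(2) that unfolding has_second_weak_deriv_def by blast
    then show ?thesis by (simp add: integral_unique)
  qed
  have "continuous_on {0..l} (\<lambda>x. deriv_on l u 0 + integral {0..x} g)"
    using g by (intro continuous_intros indefinite_integral_continuous_1)
      (simp add: absolutely_integrable_on_def)
  then have "continuous_on {0..l} (deriv_on l u)" by (subst continuous_on_cong[OF refl eq])
  then show ?thesis using assms unfolding C1_edge_def has_second_weak_deriv_def by blast
qed

lemma edge_sol_iff_has_second_weak_deriv:
  assumes "0 < l" "L2_on {0..l} Q" "continuous_on {0..l} h"
  shows "edge_sol l Q u h \<longleftrightarrow> has_second_weak_deriv l u (\<lambda>x. of_real (Q x) * u x - h x)"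
proof
  assume *: "edge_sol l Q u h"
  then have "L2_on {0..l} (\<lambda>x. of_real (Q x) * u x - h x)"
    using assms C1_edge_continuous edge_sol_C1 by (intro L2_on_affine) auto
  with * show "has_second_weak_deriv l u (\<lambda>x. of_real (Q x) * u x - h x)"
    unfolding edge_sol_def C1_edge_def has_second_weak_deriv_def by blast
next
  assume "has_second_weak_deriv l u (\<lambda>x. of_real (Q x) * u x - h x)"
  then show "edge_sol l Q u h"
    using has_second_weak_deriv_C1[OF assms(1)] unfolding edge_sol_def has_second_weak_deriv_def by blast
qed

lemma edge_sol_lincomb:
  assumes "0 < l" "edge_sol l Q u h" "edge_sol l Q v k"
  shows "edge_sol l Q (\<lambda>x. a * u x + b * v x) (\<lambda>x. a * h x + b * k x)"
  unfolding edge_sol_def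
proof (intro conjI ballI)
  show "C1_edge l (\<lambda>x. a * u x + b * v x)"
    using assms by (intro C1_edge_lincomb edge_sol_C1)
  fix x assume x: "x \<in> {0..l}"
  have "((\<lambda>x. a * (of_real (Q x) * u x - h x) + b * (of_real (Q x) * v x - k x)) has_integral
      (a * (deriv_on l u x - deriv_on l u 0) + b * (deriv_on l v x - deriv_on l v 0))) {0..x}"
    using assms x unfolding edge_sol_def by (intro has_integral_add has_integral_mult_right) auto
  then show "((\<lambda>x. of_real (Q x) * (a * u x + b * v x) - (a * h x + b * k x)) has_integral
      (deriv_on l (\<lambda>x. a * u x + b * v x) x - deriv_on l (\<lambda>x. a * u x + b * v x) 0)) {0..x}"
    using assms x by (simp add: C1_edge_lincomb edge_sol_C1 algebra_simps)
qed

definition edge_ip :: "real \<Rightarrow> (real \<Rightarrow> complex) \<Rightarrow> (real \<Rightarrow> complex) \<Rightarrow> complex" where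
  "edge_ip l u v = integral {0..l} (\<lambda>x. u x * cnj (v x))"

definition edge_form :: "real \<Rightarrow> (real \<Rightarrow> real) \<Rightarrow> (real \<Rightarrow> complex) \<Rightarrow> (real \<Rightarrow> complex) \<Rightarrow> complex" where
  "edge_form l Q u v = integral {0..l} (\<lambda>x. deriv_on l u x * cnj (deriv_on l v x)) +
    integral {0..l} (\<lambda>x. of_real (Q x) * u x * cnj (v x))"

lemma edge_form_commute: "edge_form l Q v u = cnj (edge_form l Q u v)"
  unfolding edge_form_def complex_cnj_add integral_cnj
  by (simp add: mult.commute mult.left_commute)

text \<open>Integration by parts against the conjugate of \<open>v\<close>. Since \<open>v\<close>
  is merely C1, a solution with other boundary conditions or another right-hand side can serve as
  test function. The signs at the two ends are those of derivatives taken into the edge.\<close>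

lemma edge_green:
  assumes "0 < l" and Q: "Q absolutely_integrable_on {0..l}" and h: "continuous_on {0..l} h"
    and u: "edge_sol l Q u h" and v: "C1_edge l v"
  shows "edge_ip l h v = deriv_on l u 0 * cnj (v 0) - deriv_on l u l * cnj (v l) + edge_form l Q u v"
proof -
  define g where "g x = of_real (Q x) * u x - h x" for x
  have uc: "continuous_on {0..l} u" and vc: "continuous_on {0..l} v"
    using u v edge_sol_C1 C1_edge_continuous by auto
  have cv: "continuous_on {0..l} (\<lambda>x. cnj (v x))" "continuous_on {0..l} (\<lambda>x. cnj (deriv_on l v x))"
    using v by (auto intro!: continuous_intros vc C1_edge_continuous_deriv)
  have g: "g absolutely_integrable_on {0..l}"
    unfolding g_def using absolutely_integrable_of_real_mult[OF Q uc] absolutely_integrable_continuous_real[OF h]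
    by (rule set_integral_diff)
  have "integral {0..l} (\<lambda>x. g x * cnj (v x)) = deriv_on l u l * cnj (v l) - deriv_on l u 0 * cnj (v 0)
      - integral {0..l} (\<lambda>x. deriv_on l u x * cnj (deriv_on l v x))"
  proof (rule absolutely_continuous_by_parts[OF _ g])
    show "(g has_integral (deriv_on l u x - deriv_on l u 0)) {0..x}" if "x \<in> {0..l}" for x
      using u that unfolding edge_sol_def g_def by blast
    show "((\<lambda>x. cnj (v x)) has_vector_derivative cnj (deriv_on l v x)) (at x within {0..l})"
      if "x \<in> {0..l}" for x
      using C1_edge_has_vector_derivative[OF v that] by (rule has_vector_derivative_cnj)
  qed (use \<open>0 < l\<close> cv in auto)
  moreover have "integral {0..l} (\<lambda>x. g x * cnj (v x))
      = integral {0..l} (\<lambda>x. of_real (Q x) * u x * cnj (v x)) - edge_ip l h v"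
    unfolding edge_ip_def g_def left_diff_distrib
  proof (rule integral_diff)
    show "(\<lambda>x. of_real (Q x) * u x * cnj (v x)) integrable_on {0..l}"
      using absolutely_integrable_mult_continuous[OF absolutely_integrable_of_real_mult[OF Q uc] cv(1)]
      by (simp add: absolutely_integrable_on_def)
    show "(\<lambda>x. h x * cnj (v x)) integrable_on {0..l}"
      by (intro integrable_continuous_interval continuous_on_mult h cv(1))
  qed
  ultimately show ?thesis by (simp add: edge_form_def algebra_simps)
qed

section \<open>One-dimensional Sobolev estimates\<close>

definition edge_dirichlet :: "real \<Rightarrow> (real \<Rightarrow> complex) \<Rightarrow> real" where
  "edge_dirichlet l u = integral {0..l} (\<lambda>x. (cmod (deriv_on l u x))\<^sup>2)"

definition edge_mass :: "real \<Rightarrow> (real \<Rightarrow> complex) \<Rightarrow> real" where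
  "edge_mass l u = integral {0..l} (\<lambda>x. (cmod (u x))\<^sup>2)"

lemma square_integrable_continuous:
  "continuous_on {a..b} u \<Longrightarrow> (\<lambda>x. (cmod (u x))\<^sup>2) integrable_on {a..b}" for u :: "real \<Rightarrow> complex"
  by (intro integrable_continuous_interval continuous_intros)

lemma edge_mass_nonneg: "0 \<le> edge_mass l u"
  unfolding edge_mass_def by (cases "(\<lambda>x. (cmod (u x))\<^sup>2) integrable_on {0..l}")
    (auto intro: integral_nonneg simp: not_integrable_integral)

lemma edge_dirichlet_nonneg: "0 \<le> edge_dirichlet l u"
  using edge_mass_nonneg[of l "deriv_on l u"] by (simp add: edge_mass_def edge_dirichlet_def)

lemma Re_edge_form:
  assumes "Q absolutely_integrable_on {0..l}" "C1_edge l u"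
  shows "Re (edge_form l Q u u) = edge_dirichlet l u + integral {0..l} (\<lambda>x. Q x * (cmod (u x))\<^sup>2)"
proof -
  have re: "Re (integral {0..l} f) = integral {0..l} (\<lambda>x. Re (f x))" if "f integrable_on {0..l}" for f
    using integral_linear[OF that bounded_linear_Re] by (simp add: o_def)
  note c = C1_edge_continuous[OF assms(2)] C1_edge_continuous_deriv[OF assms(2)]
  have "(\<lambda>x. deriv_on l u x * cnj (deriv_on l u x)) integrable_on {0..l}"
    using c by (intro integrable_continuous_interval continuous_intros)
  moreover have "(\<lambda>x. of_real (Q x) * u x * cnj (u x)) integrable_on {0..l}"
  proof -
    have "(\<lambda>x. of_real (Q x) * (u x * cnj (u x))) absolutely_integrable_on {0..l}"
      using assms c by (intro absolutely_integrable_of_real_mult continuous_intros)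
    then show ?thesis by (simp add: absolutely_integrable_on_def mult.assoc)
  qed
  moreover have "Re (of_real q * z * cnj z) = q * (cmod z)\<^sup>2" for q z
    unfolding cmod_power2 by (simp add: power2_eq_square algebra_simps)
  from this this[of 1] have "Re (of_real q * z * cnj z) = q * (cmod z)\<^sup>2" "Re (z * cnj z) = (cmod z)\<^sup>2" for q z
    by simp_all
  ultimately show ?thesis unfolding edge_form_def edge_dirichlet_def plus_complex.sel
    by (simp only: re)
qed

text \<open>The derivative of |u|^2 is twice the real inner product of u and u', which Young's
  inequality with weight \<epsilon> bounds by the integrand \<open>w\<close>.\<close>

lemma edge_square_difference_le:
  assumes u: "C1_edge l u" and x: "x \<in> {0..l}" and y: "y \<in> {0..l}" and "0 < \<epsilon>"
  shows "(cmod (u x))\<^sup>2 - (cmod (u y))\<^sup>2 \<le> \<epsilon> * edge_dirichlet l u + edge_mass l u / \<epsilon>"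
proof -
  note c = C1_edge_continuous[OF u] C1_edge_continuous_deriv[OF u]
  define w where "w t = \<epsilon> * (cmod (deriv_on l u t))\<^sup>2 + (cmod (u t))\<^sup>2 / \<epsilon>" for t
  have wc: "continuous_on {0..l} w" unfolding w_def using \<open>0 < \<epsilon>\<close> by (intro continuous_intros c) auto
  have w0: "0 \<le> w t" for t using \<open>0 < \<epsilon>\<close> by (simp add: w_def)
  have wl: "integral {0..l} w = \<epsilon> * edge_dirichlet l u + edge_mass l u / \<epsilon>"
    unfolding w_def edge_dirichlet_def edge_mass_def
    using square_integrable_continuous[OF c(1)] square_integrable_continuous[OF c(2)]
    by (subst integral_add) (auto intro!: integrable_on_mult_right integrable_on_divide)
  have *: "\<bar>(cmod (u b))\<^sup>2 - (cmod (u a))\<^sup>2\<bar> \<le> integral {0..l} w" if ab: "0 \<le> a" "a \<le> b" "b \<le> l" for a b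
  proof -
    have sub: "{a..b} \<subseteq> {0..l}" using ab by auto
    have "((\<lambda>t. u t \<bullet> deriv_on l u t + deriv_on l u t \<bullet> u t) has_integral (u b \<bullet> u b - u a \<bullet> u a)) {a..b}"
      using ab(2)
    proof (rule fundamental_theorem_of_calculus)
      fix t assume "t \<in> {a..b}"
      then have "(u has_vector_derivative deriv_on l u t) (at t within {a..b})"
        using sub C1_edge_has_vector_derivative[OF u] by (blast intro: has_vector_derivative_within_subset)
      then show "((\<lambda>t. u t \<bullet> u t) has_vector_derivative
          (u t \<bullet> deriv_on l u t + deriv_on l u t \<bullet> u t)) (at t within {a..b})"
        using bounded_bilinear.has_vector_derivative[OF bounded_bilinear_inner, of u _ t "{a..b}" u] by blast
    qed
    then have I: "((\<lambda>t. 2 * (u t \<bullet> deriv_on l u t)) has_integral ((cmod (u b))\<^sup>2 - (cmod (u a))\<^sup>2)) {a..b}"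
      by (simp add: inner_commute power2_norm_eq_inner)
    have "norm ((cmod (u b))\<^sup>2 - (cmod (u a))\<^sup>2) = norm (integral {a..b} (\<lambda>t. 2 * (u t \<bullet> deriv_on l u t)))"
      by (simp only: integral_unique[OF I])
    also have "\<dots> \<le> integral {a..b} w"
    proof (rule integral_norm_bound_integral)
      show "w integrable_on {a..b}"
        using wc continuous_on_subset sub by (intro integrable_continuous_interval) blast
      fix t
      have "norm (2 * (u t \<bullet> deriv_on l u t)) \<le> 2 * (cmod (u t) * cmod (deriv_on l u t))"
        using Cauchy_Schwarz_ineq2[of "u t" "deriv_on l u t"] by simp
      also have "\<dots> = 2 * (cmod (u t) / sqrt \<epsilon>) * (sqrt \<epsilon> * cmod (deriv_on l u t))"
        using \<open>0 < \<epsilon>\<close> by simp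
      also have "\<dots> \<le> (cmod (u t) / sqrt \<epsilon>)\<^sup>2 + (sqrt \<epsilon> * cmod (deriv_on l u t))\<^sup>2"
        by (rule sum_squares_bound)
      also have "\<dots> = w t" using \<open>0 < \<epsilon>\<close> by (simp add: w_def power_mult_distrib power_divide)
      finally show "norm (2 * (u t \<bullet> deriv_on l u t)) \<le> w t" .
    qed (use I in auto)
    also have "\<dots> \<le> integral {0..l} w"
      using sub wc w0 by (intro integral_subset_le integrable_continuous_interval)
        (auto intro: continuous_on_subset)
    finally show ?thesis by simp
  qed
  show ?thesis
    using *[of x y] *[of y x] x y unfolding wl by (cases "x \<le> y") auto
qed

text \<open>The minimum of |u|^2 is at most its mean, and \<open>edge_square_difference_le\<close>
  controls the rise from there. The free \<epsilon> allows boundary values and potential to be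
  absorbed by a small part of the Dirichlet integral.\<close>

lemma edge_sup_le:
  assumes "0 < l" and u: "C1_edge l u" and x: "x \<in> {0..l}" and "0 < \<epsilon>"
  shows "(cmod (u x))\<^sup>2 \<le> \<epsilon> * edge_dirichlet l u + (1 / \<epsilon> + 1 / l) * edge_mass l u"
proof -
  note c = C1_edge_continuous[OF u]
  have "continuous_on {0..l} (\<lambda>t. (cmod (u t))\<^sup>2)" by (intro continuous_intros c)
  then obtain y where y: "y \<in> {0..l}" "\<And>t. t \<in> {0..l} \<Longrightarrow> (cmod (u y))\<^sup>2 \<le> (cmod (u t))\<^sup>2"
    using continuous_attains_inf[of "{0..l}" "\<lambda>t. (cmod (u t))\<^sup>2"] \<open>0 < l\<close> by fastforce
  have "integral {0..l} (\<lambda>_. (cmod (u y))\<^sup>2) \<le> edge_mass l u"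
    unfolding edge_mass_def using y(2)
    by (intro integral_le square_integrable_continuous[OF c]) auto
  then have "(cmod (u y))\<^sup>2 \<le> edge_mass l u / l" using \<open>0 < l\<close> by (simp add: field_simps)
  then show ?thesis
    using edge_square_difference_le[OF u x y(1) \<open>0 < \<epsilon>\<close>] by (simp add: algebra_simps)
qed

text \<open>Hoelder continuity with exponent 1/2, with the product of square roots split by a free
  parameter \<theta>; it serves as equicontinuity in Arzela-Ascoli.\<close>

lemma edge_hoelder:
  assumes u: "C1_edge l u" and x: "x \<in> {0..l}" and y: "y \<in> {0..l}" and "0 < \<theta>"
  shows "cmod (u x - u y) \<le> (\<theta> * edge_dirichlet l u + \<bar>x - y\<bar> / \<theta>) / 2"
proof -
  note c = C1_edge_continuous_deriv[OF u]
  have *: "cmod (u b - u a) \<le> (\<theta> * edge_dirichlet l u + (b - a) / \<theta>) / 2"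
    if ab: "0 \<le> a" "a \<le> b" "b \<le> l" for a b
  proof -
    have sub: "{a..b} \<subseteq> {0..l}" using ab by auto
    have I: "(deriv_on l u has_integral (u b - u a)) {a..b}"
      using ab(2) sub C1_edge_has_vector_derivative[OF u]
      by (intro fundamental_theorem_of_calculus) (blast intro: has_vector_derivative_within_subset)+
    have sq: "(\<lambda>t. (cmod (deriv_on l u t))\<^sup>2) integrable_on {a..b}"
      using c sub continuous_on_subset by (intro square_integrable_continuous) blast
    have "cmod (u b - u a) = norm (integral {a..b} (deriv_on l u))" using I by (simp add: integral_unique)
    also have "\<dots> \<le> integral {a..b} (\<lambda>t. \<theta> / 2 * (cmod (deriv_on l u t))\<^sup>2 + 1 / (2 * \<theta>))"
    proof (rule integral_norm_bound_integral)
      show "deriv_on l u integrable_on {a..b}" using I by auto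
      show "(\<lambda>t. \<theta> / 2 * (cmod (deriv_on l u t))\<^sup>2 + 1 / (2 * \<theta>)) integrable_on {a..b}"
        using sq by (intro integrable_add integrable_on_mult_right) auto
      fix t
      have "2 * (sqrt \<theta> * cmod (deriv_on l u t)) * (1 / sqrt \<theta>) \<le> (sqrt \<theta> * cmod (deriv_on l u t))\<^sup>2 + (1 / sqrt \<theta>)\<^sup>2"
        by (rule sum_squares_bound)
      then show "cmod (deriv_on l u t) \<le> \<theta> / 2 * (cmod (deriv_on l u t))\<^sup>2 + 1 / (2 * \<theta>)"
        using \<open>0 < \<theta>\<close> by (simp add: power_mult_distrib power_divide field_simps)
    qed
    also have "\<dots> = \<theta> / 2 * integral {a..b} (\<lambda>t. (cmod (deriv_on l u t))\<^sup>2) + (b - a) / (2 * \<theta>)"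
      using sq ab by (subst integral_add) (auto intro!: integrable_on_mult_right)
    also have "integral {a..b} (\<lambda>t. (cmod (deriv_on l u t))\<^sup>2) \<le> edge_dirichlet l u"
      unfolding edge_dirichlet_def
      using sub sq square_integrable_continuous[OF c] by (intro integral_subset_le) auto
    finally show ?thesis using \<open>0 < \<theta>\<close> by (simp add: field_simps)
  qed
  show ?thesis
    using *[of x y] *[of y x] x y by (cases "x \<le> y") (auto simp: norm_minus_commute)
qed

text \<open>The boundary values and the potential term are at most 2 c + P times the supremum of
  |u|^2, where P is the L1 norm of V; half of the Dirichlet integral and a large shift pay for this.
  The threshold serves every larger shift, so that thresholds for several edges and two operators
  can be combined.\<close>

lemma edge_form_coercive:
  assumes "0 < l" and V: "V absolutely_integrable_on {0..l}" and "0 \<le> c"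
  obtains M where "\<And>m u. M \<le> m \<Longrightarrow> C1_edge l u \<Longrightarrow>
    c * ((cmod (u 0))\<^sup>2 + (cmod (u l))\<^sup>2) + edge_dirichlet l u / 2 + edge_mass l u
      \<le> Re (edge_form l (\<lambda>x. V x + m) u u)"
proof -
  define P where "P = integral {0..l} (\<lambda>x. \<bar>V x\<bar>)"
  have absV: "(\<lambda>x. \<bar>V x\<bar>) integrable_on {0..l}"
    using V by (simp add: absolutely_integrable_on_def)
  have P0: "0 \<le> P" unfolding P_def using absV by (rule integral_nonneg) auto
  \<comment> \<open>Small enough that the supremum bound, multiplied by P + 2 c, uses at most half
    of the Dirichlet integral.\<close>
  define \<epsilon> where "\<epsilon> = 1 / (2 * (P + 2 * c + 1))"
  have "0 < \<epsilon>" using P0 \<open>0 \<le> c\<close> by (simp add: \<epsilon>_def)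
  have eps: "(P + 2 * c) * \<epsilon> \<le> 1 / 2" using P0 \<open>0 \<le> c\<close> by (simp add: \<epsilon>_def field_simps)
  define C where "C = (P + 2 * c) * (1 / \<epsilon> + 1 / l)"
  show thesis
  proof (rule that[of "C + 1"])
    fix m u assume m: "C + 1 \<le> m" and u: "C1_edge l u"
    note cu = C1_edge_continuous[OF u]
    define S where "S = \<epsilon> * edge_dirichlet l u + (1 / \<epsilon> + 1 / l) * edge_mass l u"
    have S: "(cmod (u x))\<^sup>2 \<le> S" if "x \<in> {0..l}" for x
      unfolding S_def by (rule edge_sup_le[OF \<open>0 < l\<close> u that \<open>0 < \<epsilon>\<close>])
    have Vu: "(\<lambda>x. V x * (cmod (u x))\<^sup>2) integrable_on {0..l}"
    proof -
      have "(\<lambda>x. (cmod (u x))\<^sup>2 * V x) absolutely_integrable_on {0..l}"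
        using V cu by (intro absolutely_integrable_bounded_measurable_product_real
            continuous_imp_measurable_on_sets_lebesgue compact_imp_bounded compact_continuous_image
            continuous_intros) auto
      then show ?thesis by (simp add: absolutely_integrable_on_def mult.commute)
    qed
    have "(\<lambda>x. V x + m) absolutely_integrable_on {0..l}"
      using V by (intro set_integral_add) (auto intro: absolutely_integrable_continuous_real)
    then have "Re (edge_form l (\<lambda>x. V x + m) u u)
        = edge_dirichlet l u + integral {0..l} (\<lambda>x. (V x + m) * (cmod (u x))\<^sup>2)"
      using u by (rule Re_edge_form)
    also have "integral {0..l} (\<lambda>x. (V x + m) * (cmod (u x))\<^sup>2)
        = integral {0..l} (\<lambda>x. V x * (cmod (u x))\<^sup>2) + m * edge_mass l u"
      unfolding edge_mass_def distrib_right using Vu square_integrable_continuous[OF cu]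
      by (subst integral_add) (auto intro!: integrable_on_mult_right)
    finally have eq: "Re (edge_form l (\<lambda>x. V x + m) u u) = edge_dirichlet l u
        + integral {0..l} (\<lambda>x. V x * (cmod (u x))\<^sup>2) + m * edge_mass l u" by simp
    have "norm (integral {0..l} (\<lambda>x. V x * (cmod (u x))\<^sup>2)) \<le> integral {0..l} (\<lambda>x. \<bar>V x\<bar> * S)"
    proof (rule integral_norm_bound_integral[OF Vu])
      show "(\<lambda>x. \<bar>V x\<bar> * S) integrable_on {0..l}" using absV by (rule integrable_on_mult_left)
      fix x assume "x \<in> {0..l}"
      then show "norm (V x * (cmod (u x))\<^sup>2) \<le> \<bar>V x\<bar> * S"
        using S by (simp add: abs_mult mult_left_mono)
    qed
    then have V1: "- integral {0..l} (\<lambda>x. V x * (cmod (u x))\<^sup>2) \<le> P * S" by (simp add: P_def)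
    have "c * ((cmod (u 0))\<^sup>2 + (cmod (u l))\<^sup>2) \<le> c * (S + S)"
      using S[of 0] S[of l] \<open>0 < l\<close> \<open>0 \<le> c\<close> by (intro mult_left_mono add_mono) auto
    then have "c * ((cmod (u 0))\<^sup>2 + (cmod (u l))\<^sup>2) - integral {0..l} (\<lambda>x. V x * (cmod (u x))\<^sup>2) \<le> (P + 2 * c) * S"
      using V1 by (simp add: algebra_simps)
    also have "\<dots> = ((P + 2 * c) * \<epsilon>) * edge_dirichlet l u + C * edge_mass l u"
      by (simp add: S_def C_def algebra_simps)
    also have "\<dots> \<le> 1 / 2 * edge_dirichlet l u + (m - 1) * edge_mass l u"
      using eps m edge_dirichlet_nonneg edge_mass_nonneg by (intro add_mono mult_right_mono) auto
    finally show "c * ((cmod (u 0))\<^sup>2 + (cmod (u l))\<^sup>2) + edge_dirichlet l u / 2 + edge_mass l u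
      \<le> Re (edge_form l (\<lambda>x. V x + m) u u)"
      unfolding eq by (simp add: algebra_simps)
  qed
qed

text \<open>
  Picard iteration contracts in the weighted norm \<open>sup |exp (- k x) u x|\<close>: one integration of
  \<open>exp (k x)\<close> gains a factor \<open>1 / k\<close>. The unknown of the fixed point problem is \<open>exp (- k x) u x\<close>.
\<close>

lemma edge_ivp:
  fixes Q :: "real \<Rightarrow> real" and h :: "real \<Rightarrow> complex"
  assumes "0 < l" and Q: "Q absolutely_integrable_on {0..l}" and h: "continuous_on {0..l} h"
  obtains u where "edge_sol l Q u h" "u 0 = a" "deriv_on l u 0 = b"
proof -
  define N where "N = integral {0..l} (\<lambda>x. \<bar>Q x\<bar>)"
  have absQ: "(\<lambda>x. \<bar>Q x\<bar>) integrable_on {0..l}" using Q by (simp add: absolutely_integrable_on_def)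
  have N0: "0 \<le> N" unfolding N_def using absQ by (rule integral_nonneg) auto
  \<comment> \<open>With this weight N / k is at most 1/2, the contraction factor; the summand 1
    keeps \<open>k\<close> positive when \<open>Q\<close> vanishes almost everywhere.\<close>
  define k where "k = 2 * N + 1"
  have k: "0 < k" using N0 by (simp add: k_def)
  define E where "E x = complex_of_real (exp (k * x))" for x
  have cE: "continuous_on A E" for A unfolding E_def by (intro continuous_intros)
  have E0: "E x \<noteq> 0" for x by (simp add: E_def)
  define J where "J w s = integral {0..s} (\<lambda>t. of_real (Q t) * (E t * w t) - h t)" for w s
  define I where "I w x = a + integral {0..x} (\<lambda>s. b + J w s)" for w x
  have gi: "(\<lambda>t. of_real (Q t) * (E t * w t) - h t) integrable_on {0..l}"
    if "continuous_on {0..l} w" for w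
  proof (rule integrable_diff[OF _ integrable_continuous_interval[OF h]])
    have "(\<lambda>t. of_real (Q t) * (E t * w t)) absolutely_integrable_on {0..l}"
      using Q by (rule absolutely_integrable_of_real_mult) (intro continuous_intros cE that)
    then show "(\<lambda>t. of_real (Q t) * (E t * w t)) integrable_on {0..l}"
      by (simp add: absolutely_integrable_on_def)
  qed
  have cJ: "continuous_on {0..l} (J w)" if "continuous_on {0..l} w" for w
    unfolding J_def using gi[OF that] by (rule indefinite_integral_continuous_1)
  have cbJ: "continuous_on {0..l} (\<lambda>s. b + J w s)" if "continuous_on {0..l} w" for w
    using cJ[OF that] by (intro continuous_intros)
  have cI: "continuous_on {0..l} (I w)" if "continuous_on {0..l} w" for w
    unfolding I_def
    by (intro continuous_on_add continuous_on_const indefinite_integral_continuous_1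
        integrable_continuous_interval cbJ[OF that])
  define S where "S w x = I w x / E x" for w x
  have cS: "continuous_on {0..l} (S w)" if "continuous_on {0..l} w" for w
    unfolding S_def using cI[OF that] cE E0 by (intro continuous_intros) auto
  have cb: "continuous_on A (apply_bcontfun w)" for A and w :: "real \<Rightarrow>\<^sub>C complex"
    using apply_bcontfun[of w] continuous_on_subset unfolding bcontfun_def by blast
  \<comment> \<open>Banach's theorem is applied in the complete space of bounded continuous
    functions on the line; the iterate is computed on \<open>[0, l]\<close> and continued constantly
    beyond the ends by \<open>clamp\<close>.\<close>
  have "\<exists>g :: real \<Rightarrow>\<^sub>C complex. \<forall>x. g x = S (apply_bcontfun w) (clamp 0 l x)" for w :: "real \<Rightarrow>\<^sub>C complex"
    using continuous_on_cbox_bcontfunE[of 0 l "S (apply_bcontfun w)"] cS[OF cb] by (metis box_real(2))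
  then obtain T :: "(real \<Rightarrow>\<^sub>C complex) \<Rightarrow> (real \<Rightarrow>\<^sub>C complex)" where
    T: "\<And>w x. T w x = S (apply_bcontfun w) (clamp 0 l x)" by metis
  have contr: "dist (S (apply_bcontfun w) x) (S (apply_bcontfun v) x) \<le> 1 / 2 * dist w v"
    if x: "x \<in> {0..l}" for w v x
  proof -
    define d where "d = dist w v"
    have wv: "norm (w t - v t) \<le> d" for t using dist_bounded[of w t v] by (simp add: d_def dist_norm)
    have d0: "0 \<le> d" by (simp add: d_def)
    have Jd: "norm (J w s - J v s) \<le> N * d * exp (k * s)" if s: "s \<in> {0..l}" for s
    proof -
      have sub: "{0..s} \<subseteq> {0..l}" using s by auto
      note g = integrable_on_subinterval[OF gi[OF cb] sub]
      have "J w s - J v s = integral {0..s} (\<lambda>t. (of_real (Q t) * (E t * w t) - h t) - (of_real (Q t) * (E t * v t) - h t))"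
        unfolding J_def by (rule integral_diff[symmetric]) (rule g)+
      also have "norm \<dots> \<le> integral {0..s} (\<lambda>t. \<bar>Q t\<bar> * (exp (k * s) * d))"
      proof (rule integral_norm_bound_integral)
        show "(\<lambda>t. (of_real (Q t) * (E t * w t) - h t) - (of_real (Q t) * (E t * v t) - h t)) integrable_on {0..s}"
          by (intro integrable_diff g)
        show "(\<lambda>t. \<bar>Q t\<bar> * (exp (k * s) * d)) integrable_on {0..s}"
          using integrable_on_subinterval[OF absQ sub] by (rule integrable_on_mult_left)
        fix t assume t: "t \<in> {0..s}"
        have "(of_real (Q t) * (E t * w t) - h t) - (of_real (Q t) * (E t * v t) - h t)
            = of_real (Q t) * (E t * (w t - v t))" by (simp add: algebra_simps)
        also have "norm \<dots> = \<bar>Q t\<bar> * (exp (k * t) * norm (w t - v t))" by (simp add: norm_mult E_def)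
        also have "\<dots> \<le> \<bar>Q t\<bar> * (exp (k * s) * d)"
          using t k wv d0 by (intro mult_left_mono mult_mono) auto
        finally show "norm ((of_real (Q t) * (E t * w t) - h t) - (of_real (Q t) * (E t * v t) - h t))
            \<le> \<bar>Q t\<bar> * (exp (k * s) * d)" .
      qed
      also have "\<dots> = integral {0..s} (\<lambda>t. \<bar>Q t\<bar>) * (exp (k * s) * d)" by simp
      also have "\<dots> \<le> N * (exp (k * s) * d)"
        unfolding N_def using sub absQ integrable_on_subinterval[OF absQ sub] d0
        by (intro mult_right_mono integral_subset_le) auto
      finally show ?thesis by (simp add: mult_ac)
    qed
    have sub: "{0..x} \<subseteq> {0..l}" using x by auto
    have bi: "(\<lambda>s. b + J w s) integrable_on {0..x}" for w :: "real \<Rightarrow>\<^sub>C complex"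
      using cbJ[OF cb] sub continuous_on_subset by (intro integrable_continuous_interval) blast
    have expI: "((\<lambda>s. N * d * exp (k * s)) has_integral (N * d * exp (k * x) / k - N * d * exp (k * 0) / k)) {0..x}"
      using x k by (intro fundamental_theorem_of_calculus)
        (auto intro!: derivative_eq_intros simp flip: has_real_derivative_iff_has_vector_derivative)
    have "I w x - I v x = integral {0..x} (\<lambda>s. (b + J w s) - (b + J v s))"
      unfolding I_def using integral_diff[OF bi bi] by simp
    also have "norm \<dots> \<le> integral {0..x} (\<lambda>s. N * d * exp (k * s))"
    proof (rule integral_norm_bound_integral)
      show "(\<lambda>s. (b + J w s) - (b + J v s)) integrable_on {0..x}" by (intro integrable_diff bi)
      show "(\<lambda>s. N * d * exp (k * s)) integrable_on {0..x}" using expI by auto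
      show "norm ((b + J w s) - (b + J v s)) \<le> N * d * exp (k * s)" if "s \<in> {0..x}" for s
        using Jd[of s] that sub by auto
    qed
    also have "\<dots> \<le> N * d * exp (k * x) / k"
      unfolding integral_unique[OF expI] using N0 d0 k by simp
    finally have "norm (I w x - I v x) \<le> N * d * exp (k * x) / k" .
    then have "norm (I w x - I v x) / exp (k * x) \<le> N * d / k" by (simp add: field_simps)
    also have "\<dots> \<le> 1 / 2 * d" using N0 d0 by (simp add: k_def field_simps)
    also have "norm (I w x - I v x) / exp (k * x) = dist (S w x) (S v x)"
      unfolding dist_norm S_def diff_divide_distrib[symmetric] norm_divide by (simp add: E_def)
    finally show ?thesis by (simp only: d_def)
  qed
  have "\<exists>!w. T w = w"
  proof (rule banach_fix_type)
    show "\<forall>w v. dist (T w) (T v) \<le> 1 / 2 * dist w v"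
      using contr \<open>0 < l\<close> clamp_in_interval[of 0 l] by (intro allI dist_bound) (simp add: T)
  qed auto
  then obtain w where w: "T w = w" by blast
  have wS: "w x = S (apply_bcontfun w) x" if "x \<in> {0..l}" for x
    using T[of w x] that by (simp add: w)
  define u where "u x = E x * w x" for x
  have uI: "u x = I (apply_bcontfun w) x" if "x \<in> {0..l}" for x
    using wS[OF that] E0 by (simp add: u_def S_def)
  have der: "(u has_vector_derivative (b + J w x)) (at x within {0..l})" if x: "x \<in> {0..l}" for x
  proof -
    have "((\<lambda>x. integral {0..x} (\<lambda>s. b + J w s)) has_vector_derivative (b + J w x)) (at x within {0..l})"
      using cbJ[OF cb] x by (rule integral_has_vector_derivative)
    then have "(I w has_vector_derivative (0 + (b + J w x))) (at x within {0..l})"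
      unfolding I_def by (intro has_vector_derivative_add has_vector_derivative_const)
    then have "(I w has_vector_derivative (b + J w x)) (at x within {0..l})" by simp
    with x uI show ?thesis by (rule has_vector_derivative_transform)
  qed
  note C1 = C1_edgeI[OF \<open>0 < l\<close> der cbJ[OF cb]]
  show thesis
  proof
    show "edge_sol l Q u h"
      unfolding edge_sol_def
    proof (intro conjI ballI C1(1))
      fix x assume x: "x \<in> {0..l}"
      then have sub: "{0..x} \<subseteq> {0..l}" by auto
      have "((\<lambda>t. of_real (Q t) * (E t * w t) - h t) has_integral J w x) {0..x}"
        unfolding J_def by (intro integrable_integral integrable_on_subinterval[OF gi[OF cb] sub])
      then show "((\<lambda>t. of_real (Q t) * u t - h t) has_integral (deriv_on l u x - deriv_on l u 0)) {0..x}"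
        using C1(2) x \<open>0 < l\<close> by (simp add: u_def J_def)
    qed
    show "u 0 = a" using uI[of 0] \<open>0 < l\<close> by (simp add: I_def)
    show "deriv_on l u 0 = b" using C1(2)[of 0] \<open>0 < l\<close> by (simp add: J_def)
  qed
qed

section \<open>Functions on the graph\<close>

lemma C1_edge_cong:
  assumes "0 < l" "C1_edge l u" "\<And>x. x \<in> {0..l} \<Longrightarrow> v x = u x"
  shows "C1_edge l v" and "\<And>x. x \<in> {0..l} \<Longrightarrow> deriv_on l v x = deriv_on l u x"
proof -
  have 1: "(v has_vector_derivative deriv_on l u x) (at x within {0..l})" if "x \<in> {0..l}" for x
    using that assms(3) C1_edge_has_vector_derivative[OF assms(2) that]
    by (rule has_vector_derivative_transform)
  show "C1_edge l v" and "\<And>x. x \<in> {0..l} \<Longrightarrow> deriv_on l v x = deriv_on l u x"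
    using C1_edgeI[OF assms(1) 1 C1_edge_continuous_deriv[OF assms(2)]] by auto
qed

lemma edge_sol_cong_left:
  assumes "0 < l" "edge_sol l Q u h" "\<And>x. x \<in> {0..l} \<Longrightarrow> v x = u x"
  shows "edge_sol l Q v h"
  unfolding edge_sol_def
proof (intro conjI ballI)
  note c = C1_edge_cong[OF assms(1) edge_sol_C1[OF assms(2)] assms(3)]
  show "C1_edge l v" by (rule c(1))
  fix x assume x: "x \<in> {0..l}"
  have "((\<lambda>x. of_real (Q x) * u x - h x) has_integral (deriv_on l u x - deriv_on l u 0)) {0..x}"
    using assms(2) x unfolding edge_sol_def by blast
  then have "((\<lambda>x. of_real (Q x) * u x - h x) has_integral (deriv_on l v x - deriv_on l v 0)) {0..x}"
    using c(2) x \<open>0 < l\<close> by simp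
  then show "((\<lambda>x. of_real (Q x) * v x - h x) has_integral (deriv_on l v x - deriv_on l v 0)) {0..x}"
    using x assms(3) by (subst has_integral_cong[where g = "\<lambda>x. of_real (Q x) * u x - h x"]) auto
qed

lemma edge_sol_cnj:
  assumes "0 < l" "edge_sol l Q u (\<lambda>_. 0)"
  shows "edge_sol l Q (\<lambda>x. cnj (u x)) (\<lambda>_. 0)"
    and "\<And>x. x \<in> {0..l} \<Longrightarrow> deriv_on l (\<lambda>x. cnj (u x)) x = cnj (deriv_on l u x)"
proof -
  have u: "C1_edge l u" using assms(2) by (rule edge_sol_C1)
  have 1: "((\<lambda>x. cnj (u x)) has_vector_derivative cnj (deriv_on l u x)) (at x within {0..l})"
    if "x \<in> {0..l}" for x
    using C1_edge_has_vector_derivative[OF u that] by (rule has_vector_derivative_cnj)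
  have 2: "continuous_on {0..l} (\<lambda>x. cnj (deriv_on l u x))"
    by (intro continuous_intros C1_edge_continuous_deriv[OF u])
  note c = C1_edgeI[OF assms(1) 1 2]
  show d: "\<And>x. x \<in> {0..l} \<Longrightarrow> deriv_on l (\<lambda>x. cnj (u x)) x = cnj (deriv_on l u x)" by (rule c(2))
  show "edge_sol l Q (\<lambda>x. cnj (u x)) (\<lambda>_. 0)"
    unfolding edge_sol_def
  proof (intro conjI ballI c(1))
    fix x assume x: "x \<in> {0..l}"
    have "((\<lambda>x. of_real (Q x) * u x) has_integral (deriv_on l u x - deriv_on l u 0)) {0..x}"
      using assms(2) x unfolding edge_sol_def by simp
    then have "(cnj \<circ> (\<lambda>x. of_real (Q x) * u x) has_integral cnj (deriv_on l u x - deriv_on l u 0)) {0..x}"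
      by (simp only: has_integral_cnj)
    then show "((\<lambda>x. of_real (Q x) * cnj (u x) - 0) has_integral
        (deriv_on l (\<lambda>x. cnj (u x)) x - deriv_on l (\<lambda>x. cnj (u x)) 0)) {0..x}"
      using d x \<open>0 < l\<close> by (simp add: o_def)
  qed
qed

text \<open>Green's formula with zero right-hand side, applied in both orders: the two mixed forms
  are conjugate to each other and cancel.\<close>

lemma edge_wronskian:
  assumes "0 < l" "Q absolutely_integrable_on {0..l}"
    and u: "edge_sol l Q u (\<lambda>_. 0)" and v: "edge_sol l Q v (\<lambda>_. 0)"
  shows "deriv_on l u 0 * cnj (v 0) - deriv_on l u l * cnj (v l)
    = u 0 * cnj (deriv_on l v 0) - u l * cnj (deriv_on l v l)"
proof -
  have "0 = deriv_on l u 0 * cnj (v 0) - deriv_on l u l * cnj (v l) + edge_form l Q u v"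
    using edge_green[OF assms(1,2) _ u edge_sol_C1[OF v]] by (simp add: edge_ip_def)
  moreover have "0 = deriv_on l v 0 * cnj (u 0) - deriv_on l v l * cnj (u l) + edge_form l Q v u"
    using edge_green[OF assms(1,2) _ v edge_sol_C1[OF u]] by (simp add: edge_ip_def)
  then have "cnj 0 = cnj (deriv_on l v 0 * cnj (u 0) - deriv_on l v l * cnj (u l) + cnj (edge_form l Q u v))"
    by (simp only: edge_form_commute[of l Q v u])
  ultimately show ?thesis by (simp add: algebra_simps)
qed

text \<open>The data at x = l of a fundamental system form a matrix of determinant 1, so a pair
  annihilated by all of them vanishes.\<close>

lemma edge_data_nondegenerate:
  assumes "0 < l" and Q: "Q absolutely_integrable_on {0..l}"
    and orth: "\<And>v. edge_sol l Q v (\<lambda>_. 0) \<Longrightarrow> d' * cnj (v l) = - (d * cnj (deriv_on l v l))"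
  shows "d = 0 \<and> d' = 0"
proof -
  obtain p where p: "edge_sol l Q p (\<lambda>_. 0)" "p 0 = 1" "deriv_on l p 0 = 0"
    using edge_ivp[OF assms(1,2), of "\<lambda>_. 0" 1 0] by auto
  obtain q where q: "edge_sol l Q q (\<lambda>_. 0)" "q 0 = 0" "deriv_on l q 0 = 1"
    using edge_ivp[OF assms(1,2), of "\<lambda>_. 0" 0 1] by auto
  \<comment> \<open>The solution \<open>q\<close> is conjugated because
    \<open>edge_wronskian\<close> is sesquilinear; this produces the classical bilinear Wronskian,
    equal to 1 at x = 0.\<close>
  have W1: "p l * deriv_on l q l - deriv_on l p l * q l = 1"
    using edge_wronskian[OF assms(1,2) p(1) edge_sol_cnj(1)[OF assms(1) q(1)]]
      edge_sol_cnj(2)[OF assms(1) q(1)] p q \<open>0 < l\<close> by (simp add: algebra_simps)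
  have W: "cnj (p l) * cnj (deriv_on l q l) - cnj (deriv_on l p l) * cnj (q l) = 1"
    using arg_cong[OF W1, of cnj] by simp
  have op: "d' * cnj (p l) = - (d * cnj (deriv_on l p l))"
    and oq: "d' * cnj (q l) = - (d * cnj (deriv_on l q l))" using orth p q by auto
  have "d = d * (cnj (p l) * cnj (deriv_on l q l) - cnj (deriv_on l p l) * cnj (q l))" by (simp add: W)
  also have "\<dots> = - (cnj (p l) * - (d * cnj (deriv_on l q l))) + - (d * cnj (deriv_on l p l)) * cnj (q l)"
    by (simp add: algebra_simps)
  also have "\<dots> = 0" unfolding op[symmetric] oq[symmetric] by simp
  finally have "d = 0" .
  have "d' = d' * (cnj (p l) * cnj (deriv_on l q l) - cnj (deriv_on l p l) * cnj (q l))" by (simp add: W)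
  also have "\<dots> = (d' * cnj (p l)) * cnj (deriv_on l q l) - cnj (deriv_on l p l) * (d' * cnj (q l))"
    by (simp add: algebra_simps)
  also have "\<dots> = 0" unfolding op oq \<open>d = 0\<close> by simp
  finally show ?thesis using \<open>d = 0\<close> by simp
qed

text \<open>Continuity makes the L2 product definite without a quotient, and uniform limits stay in
  the space. Vanishing off the graph makes such a function determined by its values on the
  edges.\<close>

definition continuous_functions :: "'e qgraph \<Rightarrow> ('e \<Rightarrow> real \<Rightarrow> complex) set" where
  "continuous_functions \<Gamma> = {f.
    (\<forall>e x. \<not> (e \<in> edges \<Gamma> \<and> x \<in> {0..len \<Gamma> e}) \<longrightarrow> f e x = 0) \<and>
    (\<forall>e\<in>edges \<Gamma>. continuous_on {0..len \<Gamma> e} (f e))}"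

definition graph_ip :: "'e qgraph \<Rightarrow> ('e \<Rightarrow> real \<Rightarrow> complex) \<Rightarrow> ('e \<Rightarrow> real \<Rightarrow> complex) \<Rightarrow> complex" where
  "graph_ip \<Gamma> f g = (\<Sum>e\<in>edges \<Gamma>. edge_ip (len \<Gamma> e) (f e) (g e))"

abbreviation edge_ends :: "'e qgraph \<Rightarrow> 'e edge_end set" where
  "edge_ends \<Gamma> \<equiv> edges \<Gamma> \<times> UNIV"

section \<open>The inner product space of continuous functions\<close>

lemma edge_ip_add_left:
  assumes "continuous_on {0..l} u" "continuous_on {0..l} v" "continuous_on {0..l} w"
  shows "edge_ip l (\<lambda>x. u x + v x) w = edge_ip l u w + edge_ip l v w"
  unfolding edge_ip_def distrib_right
  by (intro integral_add integrable_continuous_interval continuous_intros assms)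

lemma edge_ip_scale_left: "edge_ip l (\<lambda>x. c * u x) w = c * edge_ip l u w"
  unfolding edge_ip_def by (simp add: mult.assoc)

lemma edge_ip_commute: "edge_ip l v u = cnj (edge_ip l u v)"
  unfolding edge_ip_def integral_cnj by (simp add: mult.commute)

lemma edge_ip_self:
  assumes "continuous_on {0..l} u"
  shows "edge_ip l u u = of_real (edge_mass l u)"
proof -
  have "edge_ip l u u = integral {0..l} (complex_of_real \<circ> (\<lambda>x. (cmod (u x))\<^sup>2))"
    unfolding edge_ip_def o_def by (simp only: complex_norm_square)
  also have "\<dots> = of_real (edge_mass l u)"
    unfolding edge_mass_def
    by (rule integral_linear[OF square_integrable_continuous[OF assms] bounded_linear_of_real])
  finally show ?thesis .
qed

lemma edge_mass_eq_0:
  assumes "0 < l" "continuous_on {0..l} u" "edge_mass l u = 0" "x \<in> {0..l}"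
  shows "u x = 0"
proof -
  have "continuous_on {0..l} (\<lambda>x. (cmod (u x))\<^sup>2)" by (intro continuous_intros assms)
  then show ?thesis
    using assms integral_eq_0_iff[of 0 l "\<lambda>x. (cmod (u x))\<^sup>2"] by (simp add: edge_mass_def)
qed

lemma edge_mass_le:
  assumes "0 \<le> l" "continuous_on {0..l} u" "\<And>x. x \<in> {0..l} \<Longrightarrow> (cmod (u x))\<^sup>2 \<le> c"
  shows "edge_mass l u \<le> l * c"
proof -
  have "edge_mass l u \<le> integral {0..l} (\<lambda>_. c)"
    unfolding edge_mass_def using assms square_integrable_continuous by (intro integral_le) auto
  then show ?thesis using \<open>0 \<le> l\<close> by simp
qed

text \<open>Everything that involves edges and the shifted potential but no vertex condition; gluing
  changes none of this, so both operators live over the same space.\<close>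

locale graph_edges =
  fixes \<Gamma> :: "'e qgraph" and Q :: "'e \<Rightarrow> real \<Rightarrow> real"
  assumes finite_edges: "finite (edges \<Gamma>)" and edges_nonempty: "edges \<Gamma> \<noteq> {}"
    and len_pos: "\<And>e. e \<in> edges \<Gamma> \<Longrightarrow> 0 < len \<Gamma> e"
    and Q_L2: "\<And>e. e \<in> edges \<Gamma> \<Longrightarrow> L2_on {0..len \<Gamma> e} (Q e)"
begin

lemma Q_integrable: "e \<in> edges \<Gamma> \<Longrightarrow> Q e absolutely_integrable_on {0..len \<Gamma> e}"
  using Q_L2 by (rule L2_on_imp_absolutely_integrable)

lemma finite_ends: "finite (edge_ends \<Gamma>)"
  using finite_edges by simp

lemma sum_ends: "(\<Sum>i\<in>edge_ends \<Gamma>. F i) = (\<Sum>e\<in>edges \<Gamma>. F (e, False) + F (e, True))"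
  for F :: "'e edge_end \<Rightarrow> 'b::comm_monoid_add"
proof -
  have "(\<Sum>i\<in>edge_ends \<Gamma>. F i) = (\<Sum>e\<in>edges \<Gamma>. \<Sum>b\<in>UNIV. F (e, b))"
    by (simp add: sum.cartesian_product case_prod_unfold)
  then show ?thesis by (simp add: UNIV_bool)
qed

lemma continuous_functions_continuous:
  "f \<in> continuous_functions \<Gamma> \<Longrightarrow> e \<in> edges \<Gamma> \<Longrightarrow> continuous_on {0..len \<Gamma> e} (f e)"
  by (simp add: continuous_functions_def)

lemma continuous_functions_lincomb:
  assumes "f \<in> continuous_functions \<Gamma>" "g \<in> continuous_functions \<Gamma>"
  shows "(\<lambda>e x. a * f e x + b * g e x) \<in> continuous_functions \<Gamma>"
  using assms unfolding continuous_functions_def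
  by (auto intro!: continuous_intros)

lemma continuous_functions_eqI:
  assumes "f \<in> continuous_functions \<Gamma>" "g \<in> continuous_functions \<Gamma>"
    "\<And>e x. e \<in> edges \<Gamma> \<Longrightarrow> x \<in> {0..len \<Gamma> e} \<Longrightarrow> f e x = g e x"
  shows "f = g"
proof (intro ext)
  fix e x show "f e x = g e x"
    using assms unfolding continuous_functions_def by (cases "e \<in> edges \<Gamma> \<and> x \<in> {0..len \<Gamma> e}") auto
qed

lemma graph_ip_self:
  assumes "f \<in> continuous_functions \<Gamma>"
  shows "graph_ip \<Gamma> f f = of_real (\<Sum>e\<in>edges \<Gamma>. edge_mass (len \<Gamma> e) (f e))"
  using assms by (simp add: graph_ip_def edge_ip_self continuous_functions_continuous)

sublocale complex_inner_space scale_fun "continuous_functions \<Gamma>" "graph_ip \<Gamma>"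
proof -
  interpret vector_space "scale_fun :: complex \<Rightarrow> ('e \<Rightarrow> real \<Rightarrow> complex) \<Rightarrow> _"
    by (rule vector_space_scale_fun)
  have zero: "0 \<in> continuous_functions \<Gamma>" by (simp add: continuous_functions_def)
  show "complex_inner_space scale_fun (continuous_functions \<Gamma>) (graph_ip \<Gamma>)"
  proof
    show "subspace (continuous_functions \<Gamma>)"
    proof (rule subspaceI)
      show "0 \<in> continuous_functions \<Gamma>" by (rule zero)
      show "f + g \<in> continuous_functions \<Gamma>"
        if "f \<in> continuous_functions \<Gamma>" "g \<in> continuous_functions \<Gamma>" for f g
        using continuous_functions_lincomb[OF that, of 1 1] by (simp add: plus_fun_def)
      show "scale_fun c f \<in> continuous_functions \<Gamma>" if "f \<in> continuous_functions \<Gamma>" for c f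
        using continuous_functions_lincomb[OF that that, of c 0] by (simp add: scale_fun_def)
    qed
    fix f g h assume f: "f \<in> continuous_functions \<Gamma>" and g: "g \<in> continuous_functions \<Gamma>"
    show "graph_ip \<Gamma> (f + g) h = graph_ip \<Gamma> f h + graph_ip \<Gamma> g h" if h: "h \<in> continuous_functions \<Gamma>"
      unfolding graph_ip_def plus_fun_def sum.distrib[symmetric]
      using f g h by (intro sum.cong edge_ip_add_left continuous_functions_continuous refl)
    show "graph_ip \<Gamma> (scale_fun c f) g = c * graph_ip \<Gamma> f g" for c
      by (simp add: graph_ip_def scale_fun_def edge_ip_scale_left sum_distrib_left)
    show "graph_ip \<Gamma> g f = cnj (graph_ip \<Gamma> f g)"
      unfolding graph_ip_def cnj_sum by (rule sum.cong[OF refl]) (rule edge_ip_commute)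
  next
    fix f assume f: "f \<in> continuous_functions \<Gamma>"
    show "0 \<le> Re (graph_ip \<Gamma> f f)"
      unfolding graph_ip_self[OF f] by (simp add: sum_nonneg edge_mass_nonneg)
    assume "Re (graph_ip \<Gamma> f f) = 0"
    then have "(\<Sum>e\<in>edges \<Gamma>. edge_mass (len \<Gamma> e) (f e)) = 0" by (simp add: graph_ip_self[OF f])
    then have "edge_mass (len \<Gamma> e) (f e) = 0" if "e \<in> edges \<Gamma>" for e
      using finite_edges that by (simp add: sum_nonneg_eq_0_iff edge_mass_nonneg)
    then have "f e x = 0" if "e \<in> edges \<Gamma>" "x \<in> {0..len \<Gamma> e}" for e x
      using that f by (intro edge_mass_eq_0[of "len \<Gamma> e" "f e"] len_pos continuous_functions_continuous)
    then show "f = 0" by (intro continuous_functions_eqI[OF f zero]) simp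
  qed
qed

lemma nrm_square: "f \<in> continuous_functions \<Gamma> \<Longrightarrow> (nrm f)\<^sup>2 = (\<Sum>e\<in>edges \<Gamma>. edge_mass (len \<Gamma> e) (f e))"
  using ip_ge_0[of f] graph_ip_self[of f] by (simp add: nrm_def)

text \<open>Among the monomials of degree at most n on one edge, a nontrivial combination meets the
  n conditions. It is not the zero function, because a nonzero polynomial has finitely many
  roots.\<close>

lemma orthogonal_nonzero_exists:
  fixes n :: nat
  assumes f: "\<And>k. k < n \<Longrightarrow> f k \<in> continuous_functions \<Gamma>"
  shows "\<exists>h\<in>continuous_functions \<Gamma>. h \<noteq> 0 \<and> (\<forall>k<n. graph_ip \<Gamma> h (f k) = 0)"
proof -
  obtain d where d: "d \<in> edges \<Gamma>" using edges_nonempty by blast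
  define m where "m j = (\<lambda>e x. if e = d \<and> x \<in> {0..len \<Gamma> d} then complex_of_real x ^ j else 0)" for j :: nat
  have m: "m j \<in> continuous_functions \<Gamma>" for j
  proof -
    have "continuous_on {0..len \<Gamma> e} (m j e)" if "e \<in> edges \<Gamma>" for e
    proof (cases "e = d")
      case True
      have "continuous_on {0..len \<Gamma> d} (\<lambda>x. complex_of_real x ^ j)" by (intro continuous_intros)
      then show ?thesis unfolding True by (rule continuous_on_eq) (simp add: m_def)
    qed (simp add: m_def)
    then show ?thesis using d by (auto simp: continuous_functions_def m_def)
  qed
  obtain c where c: "\<exists>j\<in>{..n}. c j \<noteq> 0" "\<forall>i\<in>{..<n}. (\<Sum>j\<le>n. c j * graph_ip \<Gamma> (m j) (f i)) = 0"
    using homogeneous_system_nontrivial[of "{..<n}" "{..n}" "\<lambda>i j. graph_ip \<Gamma> (m j) (f i)"] by auto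
  define h where "h = (\<Sum>j\<le>n. scale_fun (c j) (m j))"
  have hE: "h \<in> continuous_functions \<Gamma>" unfolding h_def using m by auto
  have "graph_ip \<Gamma> h (f k) = 0" if "k < n" for k
    using c(2) that m f by (simp add: h_def ip_sum_left ip_scale_left)
  moreover have "h \<noteq> 0"
  proof
    assume "h = 0"
    have "(\<Sum>j\<le>n. c j * complex_of_real x ^ j) = 0" if "x \<in> {0..len \<Gamma> d}" for x
    proof -
      have "h d x = (\<Sum>j\<le>n. c j * complex_of_real x ^ j)"
        using that by (simp add: h_def sum_fun_apply scale_fun_def m_def)
      then show ?thesis using \<open>h = 0\<close> by simp
    qed
    then have "complex_of_real ` {0..len \<Gamma> d} \<subseteq> {z. (\<Sum>j\<le>n. c j * z ^ j) = 0}" by auto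
    moreover have "infinite (complex_of_real ` {0..len \<Gamma> d})"
      using infinite_Icc[OF len_pos[OF d]] by (simp add: finite_image_iff inj_on_def)
    ultimately have "infinite {z. (\<Sum>j\<le>n. c j * z ^ j) = 0}" by (rule infinite_super)
    moreover have "\<exists>j\<le>n. c j \<noteq> 0" using c(1) by blast
    then have "finite {z. (\<Sum>j\<le>n. c j * z ^ j) = 0}" by (simp only: polyfun_finite_roots)
    ultimately show False by contradiction
  qed
  ultimately show ?thesis using hE by blast
qed

section \<open>Boundary data of solutions on the graph\<close>

definition sol :: "('e \<Rightarrow> real \<Rightarrow> complex) \<Rightarrow> ('e \<Rightarrow> real \<Rightarrow> complex) \<Rightarrow> bool" where
  "sol f h \<longleftrightarrow> f \<in> continuous_functions \<Gamma> \<and>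
    (\<forall>e\<in>edges \<Gamma>. edge_sol (len \<Gamma> e) (Q e) (f e) (h e))"

lemma sol_edge: "sol f h \<Longrightarrow> e \<in> edges \<Gamma> \<Longrightarrow> edge_sol (len \<Gamma> e) (Q e) (f e) (h e)"
  by (simp add: sol_def)

lemma sol_C1: "sol f h \<Longrightarrow> e \<in> edges \<Gamma> \<Longrightarrow> C1_edge (len \<Gamma> e) (f e)"
  using sol_edge edge_sol_C1 by blast

lemma sol_E: "sol f h \<Longrightarrow> f \<in> continuous_functions \<Gamma>"
  by (simp add: sol_def)

lemma sol_lincomb:
  assumes "sol f h" "sol g k"
  shows "sol (\<lambda>e x. a * f e x + b * g e x) (\<lambda>e x. a * h e x + b * k e x)"
    and "end_value \<Gamma> (\<lambda>e x. a * f e x + b * g e x) = (\<lambda>i. a * end_value \<Gamma> f i + b * end_value \<Gamma> g i)"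
    and "\<And>i. i \<in> edge_ends \<Gamma> \<Longrightarrow> end_deriv \<Gamma> (\<lambda>e x. a * f e x + b * g e x) i
      = a * end_deriv \<Gamma> f i + b * end_deriv \<Gamma> g i"
proof -
  show "sol (\<lambda>e x. a * f e x + b * g e x) (\<lambda>e x. a * h e x + b * k e x)"
    using assms unfolding sol_def
    by (auto intro: edge_sol_lincomb continuous_functions_lincomb len_pos)
  show "end_value \<Gamma> (\<lambda>e x. a * f e x + b * g e x) = (\<lambda>i. a * end_value \<Gamma> f i + b * end_value \<Gamma> g i)"
    by (auto simp: end_value_def fun_eq_iff)
  fix i assume "i \<in> edge_ends \<Gamma>"
  then obtain e b' where i: "i = (e, b')" "e \<in> edges \<Gamma>" by auto
  note C1_edge_lincomb(2)[OF len_pos[OF i(2)] sol_C1[OF assms(1) i(2)] sol_C1[OF assms(2) i(2)]]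
  then show "end_deriv \<Gamma> (\<lambda>e x. a * f e x + b * g e x) i
      = a * end_deriv \<Gamma> f i + b * end_deriv \<Gamma> g i"
    using len_pos[OF i(2)] by (auto simp: end_deriv_def i(1) algebra_simps)
qed

lemma sol_ivp:
  assumes "h \<in> continuous_functions \<Gamma>"
  obtains f where "sol f h" "\<And>e. e \<in> edges \<Gamma> \<Longrightarrow> f e 0 = a e"
    "\<And>e. e \<in> edges \<Gamma> \<Longrightarrow> deriv_on (len \<Gamma> e) (f e) 0 = b e"
proof -
  have "\<exists>u. edge_sol (len \<Gamma> e) (Q e) u (h e) \<and> u 0 = a e \<and> deriv_on (len \<Gamma> e) u 0 = b e"
    if e: "e \<in> edges \<Gamma>" for e
    using edge_ivp[OF len_pos[OF e] Q_integrable[OF e] continuous_functions_continuous[OF assms e]] by metis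
  then obtain u where u: "\<And>e. e \<in> edges \<Gamma> \<Longrightarrow> edge_sol (len \<Gamma> e) (Q e) (u e) (h e)"
    "\<And>e. e \<in> edges \<Gamma> \<Longrightarrow> u e 0 = a e" "\<And>e. e \<in> edges \<Gamma> \<Longrightarrow> deriv_on (len \<Gamma> e) (u e) 0 = b e"
    by metis
  define f where "f e x = (if e \<in> edges \<Gamma> \<and> x \<in> {0..len \<Gamma> e} then u e x else 0)" for e x
  have fu: "f e x = u e x" if "e \<in> edges \<Gamma>" "x \<in> {0..len \<Gamma> e}" for e x using that by (simp add: f_def)
  have s: "edge_sol (len \<Gamma> e) (Q e) (f e) (h e)" if e: "e \<in> edges \<Gamma>" for e
    using len_pos[OF e] u(1)[OF e] fu[OF e] by (rule edge_sol_cong_left)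
  have "continuous_on {0..len \<Gamma> e} (f e)" if "e \<in> edges \<Gamma>" for e
    using s[OF that] edge_sol_C1 C1_edge_continuous by blast
  then have "f \<in> continuous_functions \<Gamma>" by (auto simp: continuous_functions_def f_def)
  with s have "sol f h" by (simp add: sol_def)
  moreover have "f e 0 = a e" "deriv_on (len \<Gamma> e) (f e) 0 = b e" if e: "e \<in> edges \<Gamma>" for e
    using C1_edge_cong(2)[OF len_pos[OF e] edge_sol_C1[OF u(1)[OF e]] fu[OF e], of 0]
      fu[OF e, of 0] u(2,3)[OF e] len_pos[OF e] by auto
  ultimately show thesis by (rule that)
qed

definition graph_form :: "('e \<Rightarrow> real \<Rightarrow> complex) \<Rightarrow> ('e \<Rightarrow> real \<Rightarrow> complex) \<Rightarrow> complex" where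
  "graph_form f g = (\<Sum>e\<in>edges \<Gamma>. edge_form (len \<Gamma> e) (Q e) (f e) (g e))"

lemma graph_form_commute: "graph_form g f = cnj (graph_form f g)"
  unfolding graph_form_def cnj_sum by (rule sum.cong[OF refl]) (rule edge_form_commute)

lemma graph_green:
  assumes "sol f h" "sol g k" "h \<in> continuous_functions \<Gamma>"
  shows "graph_ip \<Gamma> h g = (\<Sum>i\<in>edge_ends \<Gamma>. end_deriv \<Gamma> f i * cnj (end_value \<Gamma> g i)) + graph_form f g"
  unfolding sum_ends graph_ip_def graph_form_def sum.distrib[symmetric]
proof (rule sum.cong[OF refl])
  fix e assume e: "e \<in> edges \<Gamma>"
  show "edge_ip (len \<Gamma> e) (h e) (g e) = end_deriv \<Gamma> f (e, False) * cnj (end_value \<Gamma> g (e, False)) +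
      end_deriv \<Gamma> f (e, True) * cnj (end_value \<Gamma> g (e, True)) + edge_form (len \<Gamma> e) (Q e) (f e) (g e)"
    using edge_green[OF len_pos[OF e] Q_integrable[OF e] continuous_functions_continuous[OF assms(3) e]
        sol_edge[OF assms(1) e] sol_C1[OF assms(2) e]]
    by (simp add: end_deriv_def end_value_def)
qed

lemma sol_isotropic:
  assumes "sol u 0" "sol v 0"
  shows "(\<Sum>i\<in>edge_ends \<Gamma>. end_deriv \<Gamma> u i * cnj (end_value \<Gamma> v i))
    = (\<Sum>i\<in>edge_ends \<Gamma>. end_value \<Gamma> u i * cnj (end_deriv \<Gamma> v i))"
proof -
  have "(\<Sum>i\<in>edge_ends \<Gamma>. end_deriv \<Gamma> u i * cnj (end_value \<Gamma> v i)) = - graph_form u v"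
    using graph_green[OF assms] sol_E[OF assms(2)] by (simp add: eq_neg_iff_add_eq_0)
  moreover have "(\<Sum>i\<in>edge_ends \<Gamma>. end_deriv \<Gamma> v i * cnj (end_value \<Gamma> u i)) = - cnj (graph_form u v)"
    using graph_green[OF assms(2,1)] sol_E[OF assms(1)]
    by (simp add: eq_neg_iff_add_eq_0 graph_form_commute[of v u])
  from arg_cong[OF this, of cnj]
  have "(\<Sum>i\<in>edge_ends \<Gamma>. end_value \<Gamma> u i * cnj (end_deriv \<Gamma> v i)) = - graph_form u v"
    by (simp add: mult.commute)
  ultimately show ?thesis by simp
qed

definition cauchy_data :: "('e edge_end \<Rightarrow> complex) \<Rightarrow> ('e edge_end \<Rightarrow> complex) \<Rightarrow> bool" where
  "cauchy_data F F' \<longleftrightarrow> (\<exists>u. sol u 0 \<and>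
    (\<forall>i\<in>edge_ends \<Gamma>. F i = end_value \<Gamma> u i \<and> F' i = end_deriv \<Gamma> u i))"

text \<open>Isotropy is Green's formula. For maximality, an annihilated pair is compared with the
  homogeneous solution that has the same data at the left ends: the defect vanishes there and is
  still annihilated, so \<open>edge_data_nondegenerate\<close>, edge by edge, kills it at the right
  ends.\<close>

lemma lagrangian_cauchy_data: "lagrangian (edge_ends \<Gamma>) cauchy_data"
  unfolding lagrangian_def
proof (intro allI iffI impI)
  fix F F' G G' assume "cauchy_data F F'" "cauchy_data G G'"
  then obtain u v where u: "sol u 0" "\<forall>i\<in>edge_ends \<Gamma>. F i = end_value \<Gamma> u i \<and> F' i = end_deriv \<Gamma> u i"
    and v: "sol v 0" "\<forall>i\<in>edge_ends \<Gamma>. G i = end_value \<Gamma> v i \<and> G' i = end_deriv \<Gamma> v i"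
    unfolding cauchy_data_def by blast
  have "(\<Sum>i\<in>edge_ends \<Gamma>. F' i * cnj (G i)) = (\<Sum>i\<in>edge_ends \<Gamma>. end_deriv \<Gamma> u i * cnj (end_value \<Gamma> v i))"
    using u(2) v(2) by (intro sum.cong) auto
  moreover have "(\<Sum>i\<in>edge_ends \<Gamma>. F i * cnj (G' i)) = (\<Sum>i\<in>edge_ends \<Gamma>. end_value \<Gamma> u i * cnj (end_deriv \<Gamma> v i))"
    using u(2) v(2) by (intro sum.cong) auto
  ultimately show "(\<Sum>i\<in>edge_ends \<Gamma>. F' i * cnj (G i)) = (\<Sum>i\<in>edge_ends \<Gamma>. F i * cnj (G' i))"
    using sol_isotropic[OF u(1) v(1)] by simp
next
  fix F F' assume orth: "\<forall>G G'. cauchy_data G G' \<longrightarrow>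
    (\<Sum>i\<in>edge_ends \<Gamma>. F' i * cnj (G i)) = (\<Sum>i\<in>edge_ends \<Gamma>. F i * cnj (G' i))"
  obtain u where u: "sol u 0" "\<And>e. e \<in> edges \<Gamma> \<Longrightarrow> u e 0 = F (e, False)"
    "\<And>e. e \<in> edges \<Gamma> \<Longrightarrow> deriv_on (len \<Gamma> e) (u e) 0 = F' (e, False)"
    using sol_ivp[of 0 "\<lambda>e. F (e, False)" "\<lambda>e. F' (e, False)"] by auto
  define D where "D i = F i - end_value \<Gamma> u i" for i
  define D' where "D' i = F' i - end_deriv \<Gamma> u i" for i
  have D0: "D (e, False) = 0" "D' (e, False) = 0" if "e \<in> edges \<Gamma>" for e
    using u that by (auto simp: D_def D'_def end_value_def end_deriv_def)
  have orthD: "(\<Sum>i\<in>edge_ends \<Gamma>. D' i * cnj (end_value \<Gamma> v i)) = (\<Sum>i\<in>edge_ends \<Gamma>. D i * cnj (end_deriv \<Gamma> v i))"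
    if v: "sol v 0" for v
  proof -
    have K: "cauchy_data (end_value \<Gamma> v) (end_deriv \<Gamma> v)" using v by (auto simp: cauchy_data_def)
    show ?thesis
      using orth[rule_format, OF K] sol_isotropic[OF u(1) v] by (simp add: D_def D'_def left_diff_distrib sum_subtractf)
  qed
  have DT: "D (e, True) = 0 \<and> D' (e, True) = 0" if e: "e \<in> edges \<Gamma>" for e
  proof (rule edge_data_nondegenerate[OF len_pos[OF e] Q_integrable[OF e]])
    fix v assume v: "edge_sol (len \<Gamma> e) (Q e) v (\<lambda>_. 0)"
    \<comment> \<open>Solutions supported on a single edge isolate the contribution of that
      edge.\<close>
    define w where "w d x = (if d = e \<and> x \<in> {0..len \<Gamma> e} then v x else 0)" for d x
    have we: "w e x = v x" if "x \<in> {0..len \<Gamma> e}" for x using that by (simp add: w_def)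
    have w0: "w d = (\<lambda>_. 0)" if "d \<noteq> e" for d using that by (simp add: w_def fun_eq_iff)
    have "edge_sol (len \<Gamma> d) (Q d) (w d) (\<lambda>_. 0)" if d: "d \<in> edges \<Gamma>" for d
    proof (cases "d = e")
      case True
      show ?thesis unfolding True using len_pos[OF e] v we by (rule edge_sol_cong_left)
    next
      case False
      show ?thesis
        using edge_sol_lincomb[OF len_pos[OF d] sol_edge[OF u(1) d] sol_edge[OF u(1) d], of 0 0]
        by (simp add: w0[OF False])
    qed
    moreover from this have "continuous_on {0..len \<Gamma> d} (w d)" if "d \<in> edges \<Gamma>" for d
      using that edge_sol_C1 C1_edge_continuous by blast
    then have "w \<in> continuous_functions \<Gamma>" using e by (auto simp: continuous_functions_def w_def)
    ultimately have w: "sol w 0" by (simp add: sol_def zero_fun_def)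
    have d0: "deriv_on (len \<Gamma> d) (w d) x = 0" if d: "d \<in> edges \<Gamma>" "d \<noteq> e" "x \<in> {0..len \<Gamma> d}" for d x
      using d by (intro deriv_on_eqI len_pos) (simp_all add: w0)
    have "(\<Sum>i\<in>edge_ends \<Gamma>. D' i * cnj (end_value \<Gamma> w i)) = (\<Sum>d\<in>edges \<Gamma>. if d = e then D' (e, True) * cnj (v (len \<Gamma> e)) else 0)"
      unfolding sum_ends using D0 w0 we len_pos[OF e]
      by (intro sum.cong) (auto simp: end_value_def)
    also have "\<dots> = D' (e, True) * cnj (v (len \<Gamma> e))" using e finite_edges by simp
    finally have 1: "(\<Sum>i\<in>edge_ends \<Gamma>. D' i * cnj (end_value \<Gamma> w i)) = D' (e, True) * cnj (v (len \<Gamma> e))" .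
    have "deriv_on (len \<Gamma> e) (w e) (len \<Gamma> e) = deriv_on (len \<Gamma> e) v (len \<Gamma> e)"
      using C1_edge_cong(2)[OF len_pos[OF e] edge_sol_C1[OF v] we] len_pos[OF e] by simp
    then have "(\<Sum>i\<in>edge_ends \<Gamma>. D i * cnj (end_deriv \<Gamma> w i)) = (\<Sum>d\<in>edges \<Gamma>. if d = e then - (D (e, True) * cnj (deriv_on (len \<Gamma> e) v (len \<Gamma> e))) else 0)"
      unfolding sum_ends using D0 d0 len_pos
      by (intro sum.cong) (auto simp: end_deriv_def less_imp_le)
    also have "\<dots> = - (D (e, True) * cnj (deriv_on (len \<Gamma> e) v (len \<Gamma> e)))" using e finite_edges by simp
    finally show "D' (e, True) * cnj (v (len \<Gamma> e)) = - (D (e, True) * cnj (deriv_on (len \<Gamma> e) v (len \<Gamma> e)))"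
      using orthD[OF w] 1 by simp
  qed
  have "D i = 0 \<and> D' i = 0" if "i \<in> edge_ends \<Gamma>" for i
  proof -
    obtain e b where "i = (e, b)" by fastforce
    moreover from this have "e \<in> edges \<Gamma>" using \<open>i \<in> edge_ends \<Gamma>\<close> by simp
    ultimately show ?thesis using D0[of e] DT[of e] by (cases b) simp_all
  qed
  then show "cauchy_data F F'"
    unfolding cauchy_data_def using u(1) by (intro exI[of _ u]) (auto simp: D_def D'_def)
qed

end

section \<open>The resolvent\<close>

text \<open>The same constant \<open>C\<close> bounds the boundary form of \<open>L\<close> and is
  paid for by the edges, which expresses that \<mu> lies low enough: the total energy dominates half
  of the Dirichlet integral plus the squared norm.\<close>

locale graph_operator = graph_edges \<Gamma> Q for \<Gamma> :: "'e qgraph" and Q +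
  fixes L :: "('e edge_end \<Rightarrow> complex) \<Rightarrow> ('e edge_end \<Rightarrow> complex) \<Rightarrow> bool" and C :: real
  assumes lagrangian_L: "lagrangian (edge_ends \<Gamma>) L"
    and L_bound: "\<And>F F'. L F F' \<Longrightarrow> cmod (\<Sum>i\<in>edge_ends \<Gamma>. F' i * cnj (F i)) \<le> C * (\<Sum>i\<in>edge_ends \<Gamma>. (cmod (F i))\<^sup>2)"
    and edge_coercive: "\<And>e u. e \<in> edges \<Gamma> \<Longrightarrow> C1_edge (len \<Gamma> e) u \<Longrightarrow>
      C * ((cmod (u 0))\<^sup>2 + (cmod (u (len \<Gamma> e)))\<^sup>2) + edge_dirichlet (len \<Gamma> e) u / 2 + edge_mass (len \<Gamma> e) u
        \<le> Re (edge_form (len \<Gamma> e) (Q e) u u)"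
begin

section \<open>Energy estimate and unique solvability\<close>

lemma graph_coercive:
  assumes "sol f h"
  shows "C * (\<Sum>i\<in>edge_ends \<Gamma>. (cmod (end_value \<Gamma> f i))\<^sup>2)
      + (\<Sum>e\<in>edges \<Gamma>. edge_dirichlet (len \<Gamma> e) (f e)) / 2 + (nrm f)\<^sup>2 \<le> Re (graph_form f f)"
proof -
  have "C * (\<Sum>i\<in>edge_ends \<Gamma>. (cmod (end_value \<Gamma> f i))\<^sup>2)
      + (\<Sum>e\<in>edges \<Gamma>. edge_dirichlet (len \<Gamma> e) (f e)) / 2 + (nrm f)\<^sup>2
    = (\<Sum>e\<in>edges \<Gamma>. C * ((cmod (f e 0))\<^sup>2 + (cmod (f e (len \<Gamma> e)))\<^sup>2)
      + edge_dirichlet (len \<Gamma> e) (f e) / 2 + edge_mass (len \<Gamma> e) (f e))"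
    unfolding nrm_square[OF sol_E[OF assms]] sum_ends
    by (simp add: sum.distrib end_value_def flip: sum_distrib_left sum_divide_distrib)
  also have "\<dots> \<le> (\<Sum>e\<in>edges \<Gamma>. Re (edge_form (len \<Gamma> e) (Q e) (f e) (f e)))"
    using assms by (intro sum_mono edge_coercive sol_C1)
  finally show ?thesis by (simp add: graph_form_def)
qed

lemma boundary_form_ge:
  assumes "L F F'"
  shows "- (C * (\<Sum>i\<in>edge_ends \<Gamma>. (cmod (F i))\<^sup>2)) \<le> Re (\<Sum>i\<in>edge_ends \<Gamma>. F' i * cnj (F i))"
  using L_bound[OF assms] abs_Re_le_cmod[of "\<Sum>i\<in>edge_ends \<Gamma>. F' i * cnj (F i)"] by linarith

definition op_sol :: "('e \<Rightarrow> real \<Rightarrow> complex) \<Rightarrow> ('e \<Rightarrow> real \<Rightarrow> complex) \<Rightarrow> bool" where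
  "op_sol f h \<longleftrightarrow> sol f h \<and> L (end_value \<Gamma> f) (end_deriv \<Gamma> f)"

text \<open>In Green's formula for \<open>f\<close> against itself, the boundary sum is at least the
  negative of the boundary term contained in \<open>graph_coercive\<close>, so the two boundary
  contributions cancel.\<close>

lemma op_sol_energy:
  assumes "op_sol f h" "h \<in> continuous_functions \<Gamma>"
  shows "(\<Sum>e\<in>edges \<Gamma>. edge_dirichlet (len \<Gamma> e) (f e)) / 2 + (nrm f)\<^sup>2 \<le> Re (graph_ip \<Gamma> h f)"
proof -
  have f: "sol f h" "L (end_value \<Gamma> f) (end_deriv \<Gamma> f)" using assms by (auto simp: op_sol_def)
  show ?thesis
    unfolding graph_green[OF f(1) f(1) assms(2)] plus_complex.sel
    using graph_coercive[OF f(1)] boundary_form_ge[OF f(2)] by linarith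
qed

lemma op_sol_lincomb:
  assumes "op_sol f h" "op_sol g k"
  shows "op_sol (\<lambda>e x. a * f e x + b * g e x) (\<lambda>e x. a * h e x + b * k e x)"
proof -
  have f: "sol f h" "L (end_value \<Gamma> f) (end_deriv \<Gamma> f)" and g: "sol g k" "L (end_value \<Gamma> g) (end_deriv \<Gamma> g)"
    using assms by (auto simp: op_sol_def)
  note c = sol_lincomb[OF f(1) g(1), where a = a and b = b]
  have "L (\<lambda>i. a * end_value \<Gamma> f i + b * end_value \<Gamma> g i) (\<lambda>i. a * end_deriv \<Gamma> f i + b * end_deriv \<Gamma> g i)"
    by (rule lagrangian_add[OF lagrangian_L, OF lagrangian_scale[OF lagrangian_L, OF f(2)]
          lagrangian_scale[OF lagrangian_L, OF g(2)]])
  then have "L (end_value \<Gamma> (\<lambda>e x. a * f e x + b * g e x)) (end_deriv \<Gamma> (\<lambda>e x. a * f e x + b * g e x))"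
    by (rule lagrangian_cong[OF lagrangian_L]) (simp_all add: c)
  with c(1) show ?thesis by (simp add: op_sol_def)
qed

lemma op_sol_0_imp_0:
  assumes "op_sol f 0"
  shows "f = 0"
proof -
  have f: "f \<in> continuous_functions \<Gamma>" using assms sol_E by (auto simp: op_sol_def)
  have "0 \<le> (\<Sum>e\<in>edges \<Gamma>. edge_dirichlet (len \<Gamma> e) (f e)) / 2"
    by (simp add: sum_nonneg edge_dirichlet_nonneg)
  moreover have "(\<Sum>e\<in>edges \<Gamma>. edge_dirichlet (len \<Gamma> e) (f e)) / 2 + (nrm f)\<^sup>2 \<le> Re (graph_ip \<Gamma> 0 f)"
    by (rule op_sol_energy[OF assms]) simp
  ultimately have "(nrm f)\<^sup>2 \<le> Re (graph_ip \<Gamma> 0 f)" by linarith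
  then have "nrm f = 0" using f by simp
  then show ?thesis using nrm_eq_0[OF f] by simp
qed

lemma op_sol_unique:
  assumes "op_sol f h" "op_sol g h"
  shows "f = g"
proof -
  have "(\<lambda>e x. 1 * f e x + (-1) * g e x) = 0"
    using op_sol_lincomb[OF assms, of 1 "-1"] by (intro op_sol_0_imp_0) (simp add: zero_fun_def)
  then show ?thesis by (simp add: fun_eq_iff)
qed

text \<open>Existence from uniqueness: a particular solution \<open>p\<close> with arbitrary initial
  data is corrected by a homogeneous one. The correction exists because \<open>L\<close> meets the
  Cauchy data only in zero, which is \<open>op_sol_0_imp_0\<close>, and both relations are
  Lagrangian.\<close>

lemma op_sol_exists:
  assumes h: "h \<in> continuous_functions \<Gamma>"
  shows "\<exists>f. op_sol f h"
proof -
  obtain p where p: "sol p h" by (rule sol_ivp[OF h, of "\<lambda>_. 0" "\<lambda>_. 0"])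
  obtain G G' where G: "cauchy_data G G'"
    "L (\<lambda>i. end_value \<Gamma> p i + G i) (\<lambda>i. end_deriv \<Gamma> p i + G' i)"
  proof (rule lagrangian_transversal[OF finite_ends lagrangian_L lagrangian_cauchy_data,
        of "end_value \<Gamma> p" "end_deriv \<Gamma> p"])
    fix F F' assume F: "L F F'" "cauchy_data F F'"
    then obtain u where u: "sol u 0" "\<forall>i\<in>edge_ends \<Gamma>. F i = end_value \<Gamma> u i \<and> F' i = end_deriv \<Gamma> u i"
      unfolding cauchy_data_def by blast
    have "L (end_value \<Gamma> u) (end_deriv \<Gamma> u)"
      by (rule lagrangian_cong[OF lagrangian_L, OF F(1)]) (use u(2) in auto)
    then have "u = 0" using u(1) by (intro op_sol_0_imp_0) (simp add: op_sol_def)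
    \<comment> \<open>The boundary data of the zero function, read off from the trivial linear
      combination.\<close>
    moreover have "end_value \<Gamma> (\<lambda>e x. 0 * u e x + 0 * u e x) = (\<lambda>i. 0)"
      "\<And>i. i \<in> edge_ends \<Gamma> \<Longrightarrow> end_deriv \<Gamma> (\<lambda>e x. 0 * u e x + 0 * u e x) i = 0"
      using sol_lincomb(2,3)[OF u(1) u(1), where a = 0 and b = 0] by simp_all
    ultimately show "\<forall>i\<in>edge_ends \<Gamma>. F i = 0 \<and> F' i = 0" using u(2) by (simp add: zero_fun_def)
  qed (rule that)
  then obtain u where u: "sol u 0" "\<forall>i\<in>edge_ends \<Gamma>. G i = end_value \<Gamma> u i \<and> G' i = end_deriv \<Gamma> u i"
    unfolding cauchy_data_def by blast
  note c = sol_lincomb[OF p u(1), where a = 1 and b = 1]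
  have "L (end_value \<Gamma> (\<lambda>e x. 1 * p e x + 1 * u e x)) (end_deriv \<Gamma> (\<lambda>e x. 1 * p e x + 1 * u e x))"
    by (rule lagrangian_cong[OF lagrangian_L, OF G(2)]) (use u(2) c(2,3) in auto)
  moreover have "sol (\<lambda>e x. 1 * p e x + 1 * u e x) h" using c(1) by simp
  ultimately show ?thesis unfolding op_sol_def by blast
qed

section \<open>The resolvent as a symmetric operator\<close>

definition resolvent :: "('e \<Rightarrow> real \<Rightarrow> complex) \<Rightarrow> 'e \<Rightarrow> real \<Rightarrow> complex" where
  "resolvent h = (SOME f. op_sol f h)"

lemma op_sol_resolvent: "h \<in> continuous_functions \<Gamma> \<Longrightarrow> op_sol (resolvent h) h"
  unfolding resolvent_def using op_sol_exists by (rule someI_ex)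

lemma resolvent_eqI: "h \<in> continuous_functions \<Gamma> \<Longrightarrow> op_sol f h \<Longrightarrow> resolvent h = f"
  using op_sol_unique op_sol_resolvent by blast

lemma resolvent_E: "h \<in> continuous_functions \<Gamma> \<Longrightarrow> resolvent h \<in> continuous_functions \<Gamma>"
  using op_sol_resolvent sol_E unfolding op_sol_def by blast

lemma sol_resolvent: "h \<in> continuous_functions \<Gamma> \<Longrightarrow> sol (resolvent h) h"
  and L_resolvent: "h \<in> continuous_functions \<Gamma> \<Longrightarrow> L (end_value \<Gamma> (resolvent h)) (end_deriv \<Gamma> (resolvent h))"
  using op_sol_resolvent unfolding op_sol_def by blast+

lemma resolvent_lincomb:
  assumes "h \<in> continuous_functions \<Gamma>" "k \<in> continuous_functions \<Gamma>"
  shows "resolvent (\<lambda>e x. a * h e x + b * k e x) = (\<lambda>e x. a * resolvent h e x + b * resolvent k e x)"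
  using assms by (intro resolvent_eqI continuous_functions_lincomb op_sol_lincomb op_sol_resolvent)

text \<open>Green's formula in both orders gives the same mixed form, and the boundary sums agree
  because \<open>L\<close> is isotropic.\<close>

lemma resolvent_sym:
  assumes x: "x \<in> continuous_functions \<Gamma>" and y: "y \<in> continuous_functions \<Gamma>"
  shows "graph_ip \<Gamma> (resolvent x) y = graph_ip \<Gamma> x (resolvent y)"
proof -
  let ?f = "resolvent x" and ?g = "resolvent y"
  have "graph_ip \<Gamma> ?f y = cnj (graph_ip \<Gamma> y ?f)" using ip_commute x y resolvent_E by blast
  also have "\<dots> = (\<Sum>i\<in>edge_ends \<Gamma>. end_value \<Gamma> ?f i * cnj (end_deriv \<Gamma> ?g i)) + graph_form ?f ?g"
    unfolding graph_green[OF sol_resolvent[OF y] sol_resolvent[OF x] y] graph_form_commute[of ?g ?f]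
    by (simp add: mult.commute)
  also have "(\<Sum>i\<in>edge_ends \<Gamma>. end_value \<Gamma> ?f i * cnj (end_deriv \<Gamma> ?g i))
      = (\<Sum>i\<in>edge_ends \<Gamma>. end_deriv \<Gamma> ?f i * cnj (end_value \<Gamma> ?g i))"
    by (rule lagrangian_isotropic[OF lagrangian_L, OF L_resolvent[OF x] L_resolvent[OF y], symmetric])
  also have "\<dots> + graph_form ?f ?g = graph_ip \<Gamma> x ?g"
    by (rule graph_green[OF sol_resolvent[OF x] sol_resolvent[OF y] x, symmetric])
  finally show ?thesis .
qed

lemma resolvent_energy:
  assumes h: "h \<in> continuous_functions \<Gamma>"
  shows "(\<Sum>e\<in>edges \<Gamma>. edge_dirichlet (len \<Gamma> e) (resolvent h e)) / 2 + (nrm (resolvent h))\<^sup>2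
    \<le> Re (graph_ip \<Gamma> (resolvent h) h)"
  using op_sol_energy[OF op_sol_resolvent[OF h] h] resolvent_sym[OF h h] by simp

section \<open>Compactness of the resolvent\<close>

lemma edge_subsequence:
  assumes e: "e \<in> edges \<Gamma>" and u: "\<And>n. C1_edge (len \<Gamma> e) (u n)"
    and dir: "\<And>n. edge_dirichlet (len \<Gamma> e) (u n) \<le> 2" and mass: "\<And>n. edge_mass (len \<Gamma> e) (u n) \<le> 1"
  obtains g r where "continuous_on {0..len \<Gamma> e} g" "strict_mono (r :: nat \<Rightarrow> nat)"
    "\<And>\<epsilon>. 0 < \<epsilon> \<Longrightarrow> \<exists>N. \<forall>n x. n \<ge> N \<and> x \<in> {0..len \<Gamma> e} \<longrightarrow> cmod (u (r n) x - g x) < \<epsilon>"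
proof -
  let ?l = "len \<Gamma> e"
  have "compact {0..?l}" by simp
  then show thesis
  \<comment> \<open>The uniform bound is \<open>edge_sup_le\<close> with \<epsilon> = 1, Dirichlet
    integral at most 2 and mass at most 1.\<close>
  proof (rule Arzela_Ascoli[of "{0..?l}" u "sqrt (2 + (1 + 1 / ?l))"])
    fix n x assume x: "x \<in> {0..?l}"
    have "(cmod (u n x))\<^sup>2 \<le> 1 * edge_dirichlet ?l (u n) + (1 / 1 + 1 / ?l) * edge_mass ?l (u n)"
      using len_pos[OF e] u x by (rule edge_sup_le) simp
    also have "\<dots> \<le> 1 * 2 + (1 / 1 + 1 / ?l) * 1"
      using dir mass len_pos[OF e] by (intro add_mono mult_left_mono) auto
    finally show "norm (u n x) \<le> sqrt (2 + (1 + 1 / ?l))" by (intro real_le_rsqrt) simp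
  next
    fix x \<epsilon> :: real assume x: "x \<in> {0..?l}" and "0 < \<epsilon>"
    show "\<exists>d>0. \<forall>n y. y \<in> {0..?l} \<and> norm (x - y) < d \<longrightarrow> norm (u n x - u n y) < \<epsilon>"
    \<comment> \<open>This modulus comes from \<open>edge_hoelder\<close> with \<theta> = \<epsilon>
      / 4, which leaves at most 3/4 of \<epsilon>.\<close>
    proof (intro exI[of _ "\<epsilon>\<^sup>2 / 4"] conjI allI impI)
      show "0 < \<epsilon>\<^sup>2 / 4" using \<open>0 < \<epsilon>\<close> by simp
      fix n y assume y: "y \<in> {0..?l} \<and> norm (x - y) < \<epsilon>\<^sup>2 / 4"
      have "cmod (u n x - u n y) \<le> (\<epsilon> / 4 * edge_dirichlet ?l (u n) + \<bar>x - y\<bar> / (\<epsilon> / 4)) / 2"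
        using \<open>0 < \<epsilon>\<close> x y by (intro edge_hoelder u) auto
      moreover have "\<epsilon> / 4 * edge_dirichlet ?l (u n) \<le> \<epsilon> / 4 * 2"
        using dir \<open>0 < \<epsilon>\<close> by (intro mult_left_mono) auto
      moreover have "\<bar>x - y\<bar> / (\<epsilon> / 4) < \<epsilon>"
        using y \<open>0 < \<epsilon>\<close> by (simp add: field_simps power2_eq_square)
      moreover have "(X + Y) / 2 < \<epsilon>" if "X \<le> \<epsilon> / 4 * 2" "Y < \<epsilon>" for X Y
        using that \<open>0 < \<epsilon>\<close> by simp
      ultimately show "norm (u n x - u n y) < \<epsilon>" using order_le_less_trans by blast
    qed
  qed (use that in blast)
qed

text \<open>Each new edge refines the subsequence found so far; uniform convergence on the earlier
  edges survives because a strictly increasing \<open>s\<close> satisfies n \<le> s n.\<close>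

lemma graph_subsequence:
  assumes u: "\<And>n e. e \<in> edges \<Gamma> \<Longrightarrow> C1_edge (len \<Gamma> e) (u n e)"
    and dir: "\<And>n e. e \<in> edges \<Gamma> \<Longrightarrow> edge_dirichlet (len \<Gamma> e) (u n e) \<le> 2"
    and mass: "\<And>n e. e \<in> edges \<Gamma> \<Longrightarrow> edge_mass (len \<Gamma> e) (u n e) \<le> 1"
    and "finite A" "A \<subseteq> edges \<Gamma>"
  shows "\<exists>g. \<exists>r :: nat \<Rightarrow> nat. strict_mono r \<and> (\<forall>e\<in>A. continuous_on {0..len \<Gamma> e} (g e) \<and>
    (\<forall>\<epsilon>>0. \<exists>N. \<forall>n x. n \<ge> N \<and> x \<in> {0..len \<Gamma> e} \<longrightarrow> cmod (u (r n) e x - g e x) < \<epsilon>))"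
  using \<open>finite A\<close> \<open>A \<subseteq> edges \<Gamma>\<close>
proof (induction A rule: finite_induct)
  case empty
  show ?case by (intro exI[of _ id] exI) (simp add: strict_mono_def)
next
  case (insert d A)
  have "A \<subseteq> edges \<Gamma>" using insert by simp
  from insert.IH[OF this] obtain g and r :: "nat \<Rightarrow> nat" where r: "strict_mono r"
    and g: "\<forall>e\<in>A. continuous_on {0..len \<Gamma> e} (g e) \<and>
    (\<forall>\<epsilon>>0. \<exists>N. \<forall>n x. n \<ge> N \<and> x \<in> {0..len \<Gamma> e} \<longrightarrow> cmod (u (r n) e x - g e x) < \<epsilon>)"
    by (elim exE conjE) (rule that)
  have d: "d \<in> edges \<Gamma>" using insert by simp
  obtain k s where k: "continuous_on {0..len \<Gamma> d} k" and s: "strict_mono (s :: nat \<Rightarrow> nat)"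
    and ks: "\<And>\<epsilon>. 0 < \<epsilon> \<Longrightarrow> \<exists>N. \<forall>n x. n \<ge> N \<and> x \<in> {0..len \<Gamma> d} \<longrightarrow> cmod (u (r (s n)) d x - k x) < \<epsilon>"
    by (rule edge_subsequence[OF d, of "\<lambda>n. u (r n) d", OF u[OF d] dir[OF d] mass[OF d]]) (rule that)
  define g' where "g' = g(d := k)"
  have g': "continuous_on {0..len \<Gamma> e} (g' e) \<and>
    (\<forall>\<epsilon>>0. \<exists>N. \<forall>n x. n \<ge> N \<and> x \<in> {0..len \<Gamma> e} \<longrightarrow> cmod (u ((r \<circ> s) n) e x - g' e x) < \<epsilon>)"
    if e: "e \<in> insert d A" for e
  proof (cases "e = d")
    case True
    then show ?thesis using k ks by (simp add: g'_def)
  next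
    case False
    then have eA: "e \<in> A" using e by simp
    have "\<exists>N. \<forall>n x. n \<ge> N \<and> x \<in> {0..len \<Gamma> e} \<longrightarrow> cmod (u ((r \<circ> s) n) e x - g' e x) < \<epsilon>"
      if pos: "0 < \<epsilon>" for \<epsilon>
    proof -
      obtain N where N: "\<forall>n x. n \<ge> N \<and> x \<in> {0..len \<Gamma> e} \<longrightarrow> cmod (u (r n) e x - g e x) < \<epsilon>"
        using bspec[OF g eA, THEN conjunct2, rule_format, OF pos] by (elim exE) (rule that)
      have "n \<le> s n" for n using s by (rule seq_suble)
      then have "cmod (u ((r \<circ> s) n) e x - g' e x) < \<epsilon>" if "n \<ge> N" "x \<in> {0..len \<Gamma> e}" for n x
        using N[rule_format, of "s n" x] that False le_trans[of N n "s n"] by (simp add: g'_def)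
      then show ?thesis by blast
    qed
    then show ?thesis using bspec[OF g eA] False by (simp add: g'_def)
  qed
  show ?case
    by (rule exI[of _ g'], rule exI[of _ "r \<circ> s"]) (intro conjI[OF strict_mono_o[OF r s]] ballI g')
qed

lemma resolvent_compact:
  assumes f: "\<And>n. f n \<in> continuous_functions \<Gamma>" "\<And>n. nrm (f n) = 1"
  shows "\<exists>g\<in>continuous_functions \<Gamma>. \<exists>r::nat \<Rightarrow> nat. strict_mono r \<and> (\<lambda>n. nrm (resolvent (f (r n)) - g)) \<longlonglongrightarrow> 0"
proof -
  define u where "u n = resolvent (f n)" for n
  have uE: "u n \<in> continuous_functions \<Gamma>" for n unfolding u_def using f(1) by (rule resolvent_E)
  \<comment> \<open>The energy estimate against unit vectors \<open>f n\<close>: it yields first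
    norm at most 1 and then Dirichlet integral at most 2, the constants assumed in
    \<open>graph_subsequence\<close>.\<close>
  have energy: "(\<Sum>e\<in>edges \<Gamma>. edge_dirichlet (len \<Gamma> e) (u n e)) / 2 + (nrm (u n))\<^sup>2 \<le> nrm (u n)" for n
    using resolvent_energy[OF f(1)[of n]] Cauchy_Schwarz[OF uE f(1), of n n]
      complex_Re_le_cmod[of "graph_ip \<Gamma> (u n) (f n)"] by (simp add: u_def f(2))
  have D0: "0 \<le> (\<Sum>e\<in>edges \<Gamma>. edge_dirichlet (len \<Gamma> e) (u n e))" for n
    by (intro sum_nonneg edge_dirichlet_nonneg)
  have n1: "nrm (u n) \<le> 1" for n
  proof -
    have "nrm (u n) * nrm (u n) \<le> nrm (u n) * 1"
      using energy[of n] D0[of n] by (simp add: power2_eq_square)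
    then show ?thesis using nrm_ge_0[OF uE[of n]] by (cases "nrm (u n) = 0") (auto simp: mult_le_cancel_left)
  qed
  have C1: "C1_edge (len \<Gamma> e) (u n e)" if "e \<in> edges \<Gamma>" for n e
    unfolding u_def using sol_resolvent[OF f(1)] that by (rule sol_C1)
  have dir: "edge_dirichlet (len \<Gamma> e) (u n e) \<le> 2" if "e \<in> edges \<Gamma>" for n e
  proof -
    have "edge_dirichlet (len \<Gamma> e) (u n e) \<le> (\<Sum>e\<in>edges \<Gamma>. edge_dirichlet (len \<Gamma> e) (u n e))"
      using that finite_edges edge_dirichlet_nonneg by (intro member_le_sum)
    also have "\<dots> \<le> 2" using energy[of n] n1[of n] zero_le_power2[of "nrm (u n)"] by linarith
    finally show ?thesis .
  qed
  have mass: "edge_mass (len \<Gamma> e) (u n e) \<le> 1" if "e \<in> edges \<Gamma>" for n e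
  proof -
    have "edge_mass (len \<Gamma> e) (u n e) \<le> (\<Sum>e\<in>edges \<Gamma>. edge_mass (len \<Gamma> e) (u n e))"
      using that finite_edges edge_mass_nonneg by (intro member_le_sum)
    also have "\<dots> = (nrm (u n))\<^sup>2" by (rule nrm_square[OF uE, symmetric])
    also have "\<dots> \<le> 1" using n1 nrm_ge_0[OF uE] by (simp add: power_le_one)
    finally show ?thesis .
  qed
  have "\<exists>g. \<exists>r :: nat \<Rightarrow> nat. strict_mono r \<and> (\<forall>e\<in>edges \<Gamma>. continuous_on {0..len \<Gamma> e} (g e) \<and>
    (\<forall>\<epsilon>>0. \<exists>N. \<forall>n x. n \<ge> N \<and> x \<in> {0..len \<Gamma> e} \<longrightarrow> cmod (u (r n) e x - g e x) < \<epsilon>))"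
    using C1 dir mass finite_edges subset_refl by (rule graph_subsequence)
  then obtain g and r :: "nat \<Rightarrow> nat" where r: "strict_mono r"
    and g: "\<forall>e\<in>edges \<Gamma>. continuous_on {0..len \<Gamma> e} (g e) \<and>
    (\<forall>\<epsilon>>0. \<exists>N. \<forall>n x. n \<ge> N \<and> x \<in> {0..len \<Gamma> e} \<longrightarrow> cmod (u (r n) e x - g e x) < \<epsilon>)"
    by (elim exE conjE) (rule that)
  define k where "k e x = (if e \<in> edges \<Gamma> \<and> x \<in> {0..len \<Gamma> e} then g e x else 0)" for e x
  have kE: "k \<in> continuous_functions \<Gamma>"
  proof -
    have "continuous_on {0..len \<Gamma> e} (k e)" if "e \<in> edges \<Gamma>" for e
      using bspec[OF g that, THEN conjunct1] by (rule continuous_on_eq) (simp add: k_def that)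
    then show ?thesis by (auto simp: continuous_functions_def k_def)
  qed
  have massto0: "(\<lambda>n. edge_mass (len \<Gamma> e) ((u (r n) - k) e)) \<longlonglongrightarrow> 0" if e: "e \<in> edges \<Gamma>" for e
  proof (rule LIMSEQ_I)
    fix \<epsilon> :: real assume "0 < \<epsilon>"
    \<comment> \<open>Uniform distance below \<delta> contributes at most \<epsilon> / 2 to the
      squared L2 norm on this edge.\<close>
    define \<delta> where "\<delta> = sqrt (\<epsilon> / (2 * len \<Gamma> e))"
    have \<delta>: "0 < \<delta>" "\<delta>\<^sup>2 = \<epsilon> / (2 * len \<Gamma> e)" using \<open>0 < \<epsilon>\<close> len_pos[OF e] by (auto simp: \<delta>_def)
    obtain N where N: "\<forall>n x. n \<ge> N \<and> x \<in> {0..len \<Gamma> e} \<longrightarrow> cmod (u (r n) e x - g e x) < \<delta>"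
      using bspec[OF g e, THEN conjunct2, rule_format, OF \<delta>(1)] by (elim exE) (rule that)
    have "edge_mass (len \<Gamma> e) ((u (r n) - k) e) < \<epsilon>" if "n \<ge> N" for n
    proof -
      have uk: "u (r n) - k \<in> continuous_functions \<Gamma>" using uE kE by (rule E_simps)
      have le: "(cmod ((u (r n) - k) e x))\<^sup>2 \<le> \<delta>\<^sup>2" if x: "x \<in> {0..len \<Gamma> e}" for x
      proof (rule power_mono)
        show "cmod ((u (r n) - k) e x) \<le> \<delta>"
          using N[rule_format, of n x] \<open>n \<ge> N\<close> x e by (simp add: k_def less_imp_le)
      qed simp
      have "edge_mass (len \<Gamma> e) ((u (r n) - k) e) \<le> len \<Gamma> e * \<delta>\<^sup>2"
        by (rule edge_mass_le[OF less_imp_le[OF len_pos[OF e]] continuous_functions_continuous[OF uk e] le])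
      also have "len \<Gamma> e * \<delta>\<^sup>2 < \<epsilon>" using \<delta>(2) len_pos[OF e] \<open>0 < \<epsilon>\<close> by simp
      finally show ?thesis .
    qed
    then show "\<exists>N. \<forall>n\<ge>N. norm (edge_mass (len \<Gamma> e) ((u (r n) - k) e) - 0) < \<epsilon>"
      using edge_mass_nonneg by (intro exI[of _ N]) simp
  qed
  have "(\<lambda>n. \<Sum>e\<in>edges \<Gamma>. edge_mass (len \<Gamma> e) ((u (r n) - k) e)) \<longlonglongrightarrow> (\<Sum>e\<in>edges \<Gamma>. 0)"
    using massto0 by (intro tendsto_sum)
  moreover have "(\<Sum>e\<in>edges \<Gamma>. edge_mass (len \<Gamma> e) ((u (r n) - k) e)) = (nrm (u (r n) - k))\<^sup>2" for n
    using uE kE by (intro nrm_square[symmetric] E_simps)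
  ultimately have "(\<lambda>n. sqrt ((nrm (u (r n) - k))\<^sup>2)) \<longlonglongrightarrow> sqrt 0"
    by (intro tendsto_real_sqrt) simp
  moreover have "sqrt ((nrm (u (r n) - k))\<^sup>2) = nrm (u (r n) - k)" for n
    using nrm_ge_0[of "u (r n) - k"] uE kE by simp
  ultimately have "(\<lambda>n. nrm (u (r n) - k)) \<longlonglongrightarrow> 0" by simp
  then show ?thesis using kE r unfolding u_def by (intro bexI[of _ k] exI[of _ r] conjI)
qed

lemma compact_positive_resolvent:
  "compact_positive scale_fun (continuous_functions \<Gamma>) (graph_ip \<Gamma>) resolvent"
proof
  fix x y assume x: "x \<in> continuous_functions \<Gamma>"
  show "resolvent x \<in> continuous_functions \<Gamma>" by (rule resolvent_E[OF x])
  show "resolvent (scale_fun c x) = scale_fun c (resolvent x)" for c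
    using resolvent_lincomb[OF x x, of c 0] by (simp add: scale_fun_def)
  show "(nrm (resolvent x))\<^sup>2 \<le> Re (graph_ip \<Gamma> (resolvent x) x)"
  proof -
    have "0 \<le> (\<Sum>e\<in>edges \<Gamma>. edge_dirichlet (len \<Gamma> e) (resolvent x e)) / 2"
      by (simp add: sum_nonneg edge_dirichlet_nonneg)
    then show ?thesis using resolvent_energy[OF x] by linarith
  qed
  \<comment> \<open>A right-hand side \<open>x\<close> with solution zero has vanishing integral
    over every initial interval of each edge; differentiating the integral of the continuous
    function gives \<open>x = 0\<close>.\<close>
  show "x = 0" if "resolvent x = 0"
  proof (rule continuous_functions_eqI[OF x])
    show "0 \<in> continuous_functions \<Gamma>" by simp
    fix e t assume e: "e \<in> edges \<Gamma>" and t: "t \<in> {0..len \<Gamma> e}"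
    let ?l = "len \<Gamma> e"
    have s: "edge_sol ?l (Q e) (\<lambda>_. 0) (x e)"
      using sol_edge[OF sol_resolvent[OF x] e] that by (simp add: zero_fun_def)
    have d: "deriv_on ?l (\<lambda>_. 0) 0 = 0" "deriv_on ?l (\<lambda>_. 0) ?l = 0"
      using len_pos[OF e] by (auto intro!: deriv_on_eqI)
    obtain v where v: "edge_sol ?l (Q e) v (x e)"
      using edge_ivp[OF len_pos[OF e] Q_integrable[OF e] continuous_functions_continuous[OF x e]] by blast
    have h0: "((\<lambda>t. x e t) has_integral 0) {0..b}" if b: "b \<in> {0..?l}" for b
    proof -
      have "((\<lambda>t. of_real (Q e t) * 0 - x e t) has_integral (deriv_on ?l (\<lambda>_. 0) b - deriv_on ?l (\<lambda>_. 0) 0)) {0..b}"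
        using s b unfolding edge_sol_def by blast
      moreover have "deriv_on ?l (\<lambda>_. 0) b = 0" using len_pos[OF e] b by (auto intro!: deriv_on_eqI)
      ultimately have "((\<lambda>t. - x e t) has_integral 0) {0..b}" using d by simp
      from has_integral_neg[OF this] show ?thesis by simp
    qed
    have cx: "continuous_on {0..?l} (x e)" using x e by (rule continuous_functions_continuous)
    have "((\<lambda>b. integral {0..b} (x e)) has_vector_derivative x e t) (at t within {0..?l})"
      using cx t by (rule integral_has_vector_derivative)
    then have "((\<lambda>b. 0) has_vector_derivative x e t) (at t within {0..?l})"
      by (rule has_vector_derivative_transform[OF t, rotated]) (simp add: integral_unique[OF h0])
    then have "deriv_on ?l (\<lambda>_. 0) t = x e t" using len_pos[OF e] t by (intro deriv_on_eqI)
    moreover have "deriv_on ?l (\<lambda>_. 0) t = 0" using len_pos[OF e] t by (auto intro!: deriv_on_eqI)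
    ultimately show "x e t = 0 e t" by simp
  qed
  assume y: "y \<in> continuous_functions \<Gamma>"
  show "resolvent (x + y) = resolvent x + resolvent y"
    using resolvent_lincomb[OF x y, of 1 1] by (simp add: plus_fun_def)
  show "graph_ip \<Gamma> (resolvent x) y = graph_ip \<Gamma> x (resolvent y)" by (rule resolvent_sym[OF x y])
next
  fix f :: "nat \<Rightarrow> 'e \<Rightarrow> real \<Rightarrow> complex" assume "\<And>n. f n \<in> continuous_functions \<Gamma>" "\<And>n. nrm (f n) = 1"
  then show "\<exists>g\<in>continuous_functions \<Gamma>. \<exists>r::nat \<Rightarrow> nat. strict_mono r \<and> (\<lambda>n. nrm (resolvent (f (r n)) - g)) \<longlonglongrightarrow> 0"
    by (rule resolvent_compact)
next
  fix f :: "nat \<Rightarrow> 'e \<Rightarrow> real \<Rightarrow> complex" and n assume "\<And>k. k < n \<Longrightarrow> f k \<in> continuous_functions \<Gamma>"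
  then show "\<exists>h\<in>continuous_functions \<Gamma>. h \<noteq> 0 \<and> (\<forall>k<n. graph_ip \<Gamma> h (f k) = 0)"
    by (rule orthogonal_nonzero_exists)
qed

end

section \<open>Comparison of the two resolvents\<close>

context graph_edges
begin

text \<open>
  The difference \<open>\<psi>\<close> of the two resolvents solves the homogeneous equation, and gluing changes its boundary
  data by a jump \<open>t\<close> of the derivative; the difference of the forms is \<open>cnj t\<close> times the jump of
  \<open>\<psi>\<close>, and also the energy of \<open>\<psi>\<close>.
\<close>

lemma resolvent_glue:
  assumes "graph_operator \<Gamma> Q L C" "graph_operator \<Gamma> Q L' C'"
    and i: "i \<in> edge_ends \<Gamma>" "j \<in> edge_ends \<Gamma>" "i \<noteq> j"
    and glue: "\<And>F F'. L' F F' \<Longrightarrow> F i = F j \<and>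
      (\<exists>t. L F (\<lambda>k. F' k - (if k = i then t else if k = j then - t else 0)))"
    and h: "h \<in> continuous_functions \<Gamma>"
  shows "Re (graph_ip \<Gamma> (graph_operator.resolvent \<Gamma> Q L' h) h) \<le> Re (graph_ip \<Gamma> (graph_operator.resolvent \<Gamma> Q L h) h)"
    and "end_value \<Gamma> (graph_operator.resolvent \<Gamma> Q L h) i = end_value \<Gamma> (graph_operator.resolvent \<Gamma> Q L h) j \<Longrightarrow>
      Re (graph_ip \<Gamma> (graph_operator.resolvent \<Gamma> Q L h) h) \<le> Re (graph_ip \<Gamma> (graph_operator.resolvent \<Gamma> Q L' h) h)"
proof -
  interpret G: graph_operator \<Gamma> Q L C by (rule assms)
  interpret G': graph_operator \<Gamma> Q L' C' by (rule assms)
  define f where "f = G.resolvent h"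
  define g where "g = G'.resolvent h"
  have f: "sol f h" "L (end_value \<Gamma> f) (end_deriv \<Gamma> f)" "f \<in> continuous_functions \<Gamma>"
    unfolding f_def using h by (auto intro: G.sol_resolvent G.L_resolvent G.resolvent_E)
  have g: "sol g h" "L' (end_value \<Gamma> g) (end_deriv \<Gamma> g)" "g \<in> continuous_functions \<Gamma>"
    unfolding g_def using h by (auto intro: G'.sol_resolvent G'.L_resolvent G'.resolvent_E)
  define A where "A = end_value \<Gamma> f"
  define A' where "A' = end_deriv \<Gamma> f"
  define B where "B = end_value \<Gamma> g"
  define B' where "B' = end_deriv \<Gamma> g"
  obtain t where Bij: "B i = B j" and
    LB: "L B (\<lambda>k. B' k - (if k = i then t else if k = j then - t else 0))"
    using glue[OF g(2)] unfolding B_def B'_def by blast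
  let ?\<tau> = "\<lambda>k. if k = i then t else if k = j then - t else 0"
  have sum_tau: "(\<Sum>k\<in>edge_ends \<Gamma>. ?\<tau> k * X k) = t * (X i - X j)" for X
  proof -
    have "(\<Sum>k\<in>edge_ends \<Gamma>. ?\<tau> k * X k)
        = (\<Sum>k\<in>edge_ends \<Gamma>. (if k = i then t * X i else 0) + (if k = j then - t * X j else 0))"
      using i(3) by (intro sum.cong) auto
    also have "\<dots> = t * X i - t * X j" using i finite_ends by (simp add: sum.distrib)
    finally show ?thesis by (simp add: algebra_simps)
  qed
  \<comment> \<open>Both pairings are written with the same mixed form: here the equation for
    \<open>g\<close> is tested with \<open>f\<close>, in \<open>hg\<close> the equation for
    \<open>f\<close> with \<open>g\<close>. Only boundary terms survive in the difference.\<close>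
  have hf: "graph_ip \<Gamma> h f = (\<Sum>k\<in>edge_ends \<Gamma>. A k * cnj (B' k)) + graph_form f g"
  proof -
    have "graph_ip \<Gamma> h f = graph_ip \<Gamma> f h" using G.resolvent_sym[OF h h] by (simp add: f_def)
    also have "\<dots> = cnj (graph_ip \<Gamma> h f)" by (rule ip_commute[OF h f(3)])
    also have "\<dots> = (\<Sum>k\<in>edge_ends \<Gamma>. A k * cnj (B' k)) + graph_form f g"
      unfolding graph_green[OF g(1) f(1) h] graph_form_commute[of g f]
      by (simp add: A_def B'_def mult.commute)
    finally show ?thesis .
  qed
  have hg: "graph_ip \<Gamma> h g = (\<Sum>k\<in>edge_ends \<Gamma>. A' k * cnj (B k)) + graph_form f g"
    unfolding graph_green[OF f(1) g(1) h] by (simp add: A'_def B_def)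
  have "(\<Sum>k\<in>edge_ends \<Gamma>. A' k * cnj (B k)) = (\<Sum>k\<in>edge_ends \<Gamma>. A k * cnj (B' k - ?\<tau> k))"
    by (rule lagrangian_isotropic[OF G.lagrangian_L, OF f(2)[folded A_def A'_def] LB])
  also have "\<dots> = (\<Sum>k\<in>edge_ends \<Gamma>. A k * cnj (B' k)) - cnj (\<Sum>k\<in>edge_ends \<Gamma>. ?\<tau> k * cnj (A k))"
    unfolding cnj_sum sum_subtractf[symmetric] by (intro sum.cong) (auto simp: algebra_simps)
  finally have diff: "graph_ip \<Gamma> h f - graph_ip \<Gamma> h g = cnj (t * cnj (A i - A j))"
    unfolding hf hg sum_tau by simp
  have re: "Re (graph_ip \<Gamma> f h) - Re (graph_ip \<Gamma> g h) = Re (t * cnj (A i - A j))"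
  proof -
    have "Re (graph_ip \<Gamma> f h) = Re (graph_ip \<Gamma> h f)" "Re (graph_ip \<Gamma> g h) = Re (graph_ip \<Gamma> h g)"
      by (simp_all only: ip_commute[OF h f(3)] ip_commute[OF h g(3)] cnj.sel)
    then have "Re (graph_ip \<Gamma> f h) - Re (graph_ip \<Gamma> g h) = Re (graph_ip \<Gamma> h f - graph_ip \<Gamma> h g)" by simp
    then show ?thesis unfolding diff cnj.sel .
  qed
  have "0 \<le> Re (t * cnj (A i - A j))"
  proof -
    define \<psi> where "\<psi> = (\<lambda>e x. 1 * f e x + (-1) * g e x)"
    have \<psi>: "sol \<psi> 0" using sol_lincomb(1)[OF f(1) g(1), of 1 "-1"] by (simp add: \<psi>_def zero_fun_def)
    define D where "D k = A k - B k" for k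
    \<comment> \<open>The jump is taken out of \<open>B'\<close> so that \<open>(D, D')\<close> is a
      difference of two pairs in \<open>L\<close>, to which \<open>G.boundary_form_ge\<close>
      applies. The correction reappears as \<open>t\<close> times the conjugate jump of
      \<open>A\<close>, because \<open>B\<close> has no jump.\<close>
    define D' where "D' k = A' k - (B' k - ?\<tau> k)" for k
    have val: "end_value \<Gamma> \<psi> = D" using sol_lincomb(2)[OF f(1) g(1), of 1 "-1"]
      by (simp add: \<psi>_def D_def A_def B_def fun_eq_iff)
    have der: "end_deriv \<Gamma> \<psi> k = D' k - ?\<tau> k" if "k \<in> edge_ends \<Gamma>" for k
      using sol_lincomb(3)[OF f(1) g(1) that, where a = 1 and b = "-1"] by (simp add: \<psi>_def D'_def A'_def B'_def)
    have "L D D'" unfolding D_def D'_def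
      by (rule lagrangian_diff[OF G.lagrangian_L, OF f(2)[folded A_def A'_def] LB])
    then have bound: "- (C * (\<Sum>k\<in>edge_ends \<Gamma>. (cmod (D k))\<^sup>2)) \<le> Re (\<Sum>k\<in>edge_ends \<Gamma>. D' k * cnj (D k))"
      by (rule G.boundary_form_ge)
    have "0 = (\<Sum>k\<in>edge_ends \<Gamma>. end_deriv \<Gamma> \<psi> k * cnj (end_value \<Gamma> \<psi> k)) + graph_form \<psi> \<psi>"
      using graph_green[OF \<psi> \<psi>] sol_E[OF \<psi>] by simp
    also have "(\<Sum>k\<in>edge_ends \<Gamma>. end_deriv \<Gamma> \<psi> k * cnj (end_value \<Gamma> \<psi> k))
        = (\<Sum>k\<in>edge_ends \<Gamma>. D' k * cnj (D k)) - (\<Sum>k\<in>edge_ends \<Gamma>. ?\<tau> k * cnj (D k))"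
      unfolding sum_subtractf[symmetric] by (intro sum.cong) (simp_all add: der val left_diff_distrib)
    also have "(\<Sum>k\<in>edge_ends \<Gamma>. ?\<tau> k * cnj (D k)) = t * cnj (A i - A j)"
      unfolding sum_tau using Bij by (simp add: D_def)
    finally have "t * cnj (A i - A j) = (\<Sum>k\<in>edge_ends \<Gamma>. D' k * cnj (D k)) + graph_form \<psi> \<psi>"
      by (simp add: algebra_simps)
    then have "Re (t * cnj (A i - A j)) = Re (\<Sum>k\<in>edge_ends \<Gamma>. D' k * cnj (D k)) + Re (graph_form \<psi> \<psi>)"
      by (simp only: plus_complex.sel)
    moreover have "0 \<le> (\<Sum>e\<in>edges \<Gamma>. edge_dirichlet (len \<Gamma> e) (\<psi> e)) / 2"
      by (simp add: sum_nonneg edge_dirichlet_nonneg)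
    ultimately show ?thesis
      using bound G.graph_coercive[OF \<psi>] zero_le_power2[of "nrm \<psi>"] unfolding val by linarith
  qed
  with re show "Re (graph_ip \<Gamma> (G'.resolvent h) h) \<le> Re (graph_ip \<Gamma> (G.resolvent h) h)"
    by (simp add: f_def g_def)
  show "Re (graph_ip \<Gamma> (G.resolvent h) h) \<le> Re (graph_ip \<Gamma> (G'.resolvent h) h)"
    if "end_value \<Gamma> (G.resolvent h) i = end_value \<Gamma> (G.resolvent h) j"
    using re that by (simp add: f_def g_def A_def)
qed

end

section \<open>Eigenvalues\<close>

definition boundary_condition :: "'e qgraph \<Rightarrow> 'e vertex_condition" where
  "boundary_condition \<Gamma> F F' \<longleftrightarrow> (\<forall>w\<in>vertices \<Gamma>. cond \<Gamma> w F F')"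

context graph_operator
begin

text \<open>The graph \<Gamma>' shares edges and lengths with \<Gamma>, so the original and the
  glued graph are both treated in the function space of \<Gamma>. The almost-everywhere identity
  enters only through integrals; conversely the second derivative prescribed by the equation
  satisfies it everywhere.\<close>

lemma qg_eigenspace_iff_op_sol:
  fixes \<Gamma>' :: "'e qgraph"
  assumes \<Gamma>': "edges \<Gamma>' = edges \<Gamma>" "len \<Gamma>' = len \<Gamma>" "boundary_condition \<Gamma>' = L"
    and pot: "\<And>e. e \<in> edges \<Gamma> \<Longrightarrow> L2_on {0..len \<Gamma> e} (pot \<Gamma>' e)"
    and Q: "Q = (\<lambda>e x. pot \<Gamma>' e x - \<mu>)"
  shows "f \<in> qg_eigenspace \<Gamma>' z \<longleftrightarrow> op_sol f (scale_fun (z - of_real \<mu>) f)"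
proof -
  have ends: "end_value \<Gamma>' = end_value \<Gamma>" "end_deriv \<Gamma>' = end_deriv \<Gamma>"
    using \<Gamma>' by (auto simp: end_value_def end_deriv_def fun_eq_iff)
  let ?g = "\<lambda>e x. of_real (Q e x) * f e x - scale_fun (z - of_real \<mu>) f e x"
  have g: "?g e x = of_real (pot \<Gamma>' e x) * f e x - z * f e x" for e x
    by (simp add: Q scale_fun_def algebra_simps)
  show ?thesis
  proof
    assume "f \<in> qg_eigenspace \<Gamma>' z"
    then have dom: "f \<in> op_domain \<Gamma>'" and eq: "\<And>e. e \<in> edges \<Gamma> \<Longrightarrow>
      \<exists>g. has_second_weak_deriv (len \<Gamma> e) (f e) g \<and>
        (AE x in lebesgue_on {0..len \<Gamma> e}. scale_fun z f e x = - g x + of_real (pot \<Gamma>' e x) * f e x)"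
      unfolding qg_eigenspace_def op_maps_to_def \<Gamma>'(1,2) by auto
    have s: "edge_sol (len \<Gamma> e) (Q e) (f e) (scale_fun (z - of_real \<mu>) f e)" if e: "e \<in> edges \<Gamma>" for e
      unfolding edge_sol_def
    proof (intro conjI ballI)
      from eq[OF e] obtain g where g1: "has_second_weak_deriv (len \<Gamma> e) (f e) g"
        and g2: "AE x in lebesgue_on {0..len \<Gamma> e}. scale_fun z f e x = - g x + of_real (pot \<Gamma>' e x) * f e x"
        by blast
      show "C1_edge (len \<Gamma> e) (f e)" using len_pos[OF e] g1 by (rule has_second_weak_deriv_C1)
      fix x assume x: "x \<in> {0..len \<Gamma> e}"
      have ae: "AE t in lborel. t \<in> {0..x} \<longrightarrow> ?g e t = g t"
      proof -
        have "AE t in lebesgue. t \<in> {0..len \<Gamma> e} \<longrightarrow> scale_fun z f e t = - g t + of_real (pot \<Gamma>' e t) * f e t"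
          using g2 by (subst (asm) AE_restrict_space_iff) auto
        then have "AE t in lborel. t \<in> {0..len \<Gamma> e} \<longrightarrow> scale_fun z f e t = - g t + of_real (pot \<Gamma>' e t) * f e t"
          by (simp only: AE_completion_iff)
        then show ?thesis
        proof (rule AE_mp, intro AE_I2 impI)
          fix t assume "t \<in> {0..len \<Gamma> e} \<longrightarrow> scale_fun z f e t = - g t + of_real (pot \<Gamma>' e t) * f e t"
            and "t \<in> {0..x}"
          then have "z * f e t = - g t + of_real (pot \<Gamma>' e t) * f e t" using x by (simp add: scale_fun_def)
          then show "?g e t = g t" unfolding g by (simp add: algebra_simps)
        qed
      qed
      have "(g has_integral (deriv_on (len \<Gamma> e) (f e) x - deriv_on (len \<Gamma> e) (f e) 0)) {0..x}"
        using g1 x unfolding has_second_weak_deriv_def by blast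
      then show "(?g e has_integral (deriv_on (len \<Gamma> e) (f e) x - deriv_on (len \<Gamma> e) (f e) 0)) {0..x}"
        by (simp only: has_integral_AE[OF ae])
    qed
    have "continuous_on {0..len \<Gamma> e} (f e)" if "e \<in> edges \<Gamma>" for e
      using s[OF that] by (intro C1_edge_continuous edge_sol_C1)
    then have "f \<in> continuous_functions \<Gamma>"
      using dom by (simp add: op_domain_def continuous_functions_def \<Gamma>')
    moreover have "L (end_value \<Gamma> f) (end_deriv \<Gamma> f)"
      using dom unfolding op_domain_def \<Gamma>'(3)[symmetric] boundary_condition_def ends by blast
    ultimately show "op_sol f (scale_fun (z - of_real \<mu>) f)"
      using s by (simp add: op_sol_def sol_def)
  next
    assume f: "op_sol f (scale_fun (z - of_real \<mu>) f)"
    then have fE: "f \<in> continuous_functions \<Gamma>" by (simp add: op_sol_def sol_def)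
    have w: "has_second_weak_deriv (len \<Gamma> e) (f e) (?g e)" if e: "e \<in> edges \<Gamma>" for e
    proof -
      have "edge_sol (len \<Gamma> e) (Q e) (f e) (scale_fun (z - of_real \<mu>) f e)"
        using f e by (simp add: op_sol_def sol_def)
      moreover have "continuous_on {0..len \<Gamma> e} (scale_fun (z - of_real \<mu>) f e)"
        using fE e by (intro continuous_functions_continuous E_simps)
      ultimately show ?thesis using edge_sol_iff_has_second_weak_deriv[OF len_pos[OF e] Q_L2[OF e]] by blast
    qed
    have "L (end_value \<Gamma> f) (end_deriv \<Gamma> f)" using f by (simp add: op_sol_def)
    then have "\<forall>w\<in>vertices \<Gamma>'. cond \<Gamma>' w (end_value \<Gamma>' f) (end_deriv \<Gamma>' f)"
      unfolding \<Gamma>'(3)[symmetric] boundary_condition_def ends .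
    moreover have "\<forall>e\<in>edges \<Gamma>. H2_edge (len \<Gamma> e) (f e)" using w unfolding H2_edge_def by blast
    ultimately have "f \<in> op_domain \<Gamma>'"
      using fE by (simp add: op_domain_def continuous_functions_def \<Gamma>')
    moreover have "\<exists>g. has_second_weak_deriv (len \<Gamma> e) (f e) g \<and>
        (AE x in lebesgue_on {0..len \<Gamma> e}. scale_fun z f e x = - g x + of_real (pot \<Gamma>' e x) * f e x)"
      if "e \<in> edges \<Gamma>" for e
    proof (intro exI[of _ "?g e"] conjI w[OF that] AE_I2)
      show "scale_fun z f e x = - ?g e x + of_real (pot \<Gamma>' e x) * f e x" for x
        unfolding g by (simp add: scale_fun_def)
    qed
    ultimately show "f \<in> qg_eigenspace \<Gamma>' z"
      unfolding qg_eigenspace_def op_maps_to_def \<Gamma>'(1,2) by blast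
  qed
qed

text \<open>For z different from \<mu>, the eigenspace at z is the eigenspace of the resolvent at 1
  / (z - \<mu>), also for non-real z. The value \<mu> itself has multiplicity 0, since the
  homogeneous problem has only the zero solution, and no \<mu> + 1 / s m equals it. The shift
  \<open>n - 1\<close> translates between counting from 1 and from 0.\<close>

lemma lists_eigenvalues_eigen_system:
  fixes \<Gamma>' :: "'e qgraph"
  assumes \<Gamma>': "edges \<Gamma>' = edges \<Gamma>" "len \<Gamma>' = len \<Gamma>" "boundary_condition \<Gamma>' = L"
    and pot: "\<And>e. e \<in> edges \<Gamma> \<Longrightarrow> L2_on {0..len \<Gamma> e} (pot \<Gamma>' e)"
    and Q: "Q = (\<lambda>e x. pot \<Gamma>' e x - \<mu>)"
    and es: "eigen_system resolvent f s"
  shows "lists_eigenvalues \<Gamma>' (\<lambda>n. \<mu> + 1 / s (n - 1))"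
proof -
  interpret R: compact_positive scale_fun "continuous_functions \<Gamma>" "graph_ip \<Gamma>" resolvent
    by (rule compact_positive_resolvent)
  note iff = qg_eigenspace_iff_op_sol[OF \<Gamma>' pot Q]
  let ?lam = "\<lambda>n. \<mu> + 1 / s (n - 1)"
  have s0: "0 < s n" for n using es by (rule eigen_systemD)
  have "mono_on {1..} ?lam"
  proof (rule mono_onI)
    fix m n :: nat assume "m \<le> n"
    then have "s (n - 1) \<le> s (m - 1)" by (intro eigen_system_antimono[OF es]) simp
    then show "?lam m \<le> ?lam n" using s0 by (simp add: frac_le)
  qed
  moreover have "finite {n\<in>{1..}. complex_of_real (?lam n) = z} \<and>
      card {n\<in>{1..}. complex_of_real (?lam n) = z} = multiplicity_of \<Gamma>' z" for z
  proof (cases "z = of_real \<mu>")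
    case True
    have empty: "{n\<in>{1..}. complex_of_real (?lam n) = z} = {}"
    proof -
      have "complex_of_real (\<mu> + 1 / s m) \<noteq> of_real \<mu>" for m
        unfolding of_real_eq_iff using s0[of m] by simp
      then show ?thesis unfolding True by blast
    qed
    have "qg_eigenspace \<Gamma>' z = {0}"
    proof -
      have "op_sol 0 0" using op_sol_resolvent[of 0] by simp
      then show ?thesis using op_sol_0_imp_0 by (auto simp: iff True scale_fun_def zero_fun_def)
    qed
    then have "multiplicity_of \<Gamma>' z = 0"
      unfolding multiplicity_of_def using dim_unique[of "{}" "{0}" 0] independent_empty by simp
    then show ?thesis unfolding empty by simp
  next
    case False
    define \<kappa> where "\<kappa> = 1 / (z - of_real \<mu>)"
    have \<kappa>: "\<kappa> \<noteq> 0" "\<kappa> * (z - of_real \<mu>) = 1" using False by (auto simp: \<kappa>_def)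
    have "qg_eigenspace \<Gamma>' z = {x\<in>continuous_functions \<Gamma>. resolvent x = scale_fun \<kappa> x}"
    proof (intro equalityI subsetI)
      fix x assume "x \<in> qg_eigenspace \<Gamma>' z"
      then have x: "op_sol x (scale_fun (z - of_real \<mu>) x)" by (simp add: iff)
      then have xE: "x \<in> continuous_functions \<Gamma>" by (simp add: op_sol_def sol_def)
      have "x = resolvent (scale_fun (z - of_real \<mu>) x)"
        using resolvent_eqI[OF _ x] xE by simp
      also have "\<dots> = scale_fun (z - of_real \<mu>) (resolvent x)" using xE by (rule R.G_scale)
      finally have "scale_fun \<kappa> x = scale_fun \<kappa> (scale_fun (z - of_real \<mu>) (resolvent x))" by (rule arg_cong)
      then show "x \<in> {x\<in>continuous_functions \<Gamma>. resolvent x = scale_fun \<kappa> x}" using xE \<kappa> by simp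
    next
      fix x assume "x \<in> {x\<in>continuous_functions \<Gamma>. resolvent x = scale_fun \<kappa> x}"
      then have xE: "x \<in> continuous_functions \<Gamma>" and x: "resolvent x = scale_fun \<kappa> x" by auto
      have "resolvent (scale_fun (z - of_real \<mu>) x) = scale_fun (z - of_real \<mu>) (resolvent x)"
        using xE by (rule R.G_scale)
      also have "\<dots> = x" unfolding x using \<kappa> by (simp add: mult.commute)
      finally show "x \<in> qg_eigenspace \<Gamma>' z"
        using op_sol_resolvent[of "scale_fun (z - of_real \<mu>) x"] xE by (simp add: iff)
    qed
    then have mult: "multiplicity_of \<Gamma>' z = card {n. of_real (s n) = \<kappa>}"
      unfolding multiplicity_of_def using R.eigen_system_multiplicity(2)[OF es \<kappa>(1)] by simp
    have "complex_of_real (\<mu> + 1 / s n) = z \<longleftrightarrow> of_real (s n) = \<kappa>" for n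
      using s0[of n] False by (auto simp: \<kappa>_def field_simps)
    then have iff_s: "{n. of_real (s n) = \<kappa>} = {n. complex_of_real (\<mu> + 1 / s n) = z}" by blast
    have "{n\<in>{1..}. complex_of_real (?lam n) = z} = Suc ` {n. of_real (s n) = \<kappa>}"
      unfolding iff_s
    proof (intro equalityI subsetI)
      fix n assume "n \<in> {n\<in>{1..}. complex_of_real (?lam n) = z}"
      then show "n \<in> Suc ` {n. complex_of_real (\<mu> + 1 / s n) = z}"
        by (intro image_eqI[of _ _ "n - 1"]) simp_all
    qed auto
    then show ?thesis
      using mult R.eigen_system_multiplicity(1)[OF es \<kappa>(1)] by (simp add: card_image)
  qed
  ultimately show ?thesis unfolding lists_eigenvalues_def by blast
qed

text \<open>Needed for uniqueness of the listing: it makes the number of eigenvalues below any bound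
  finite.\<close>

lemma eigen_system_unbounded:
  assumes "eigen_system resolvent f s"
  shows "\<exists>n. x < \<mu> + 1 / s n"
proof -
  interpret R: compact_positive scale_fun "continuous_functions \<Gamma>" "graph_ip \<Gamma>" resolvent
    by (rule compact_positive_resolvent)
  have "0 < \<bar>x - \<mu>\<bar> + 1" by linarith
  then obtain n where n: "s n < 1 / (\<bar>x - \<mu>\<bar> + 1)"
    using R.eigen_system_tendsto_0[OF assms, of "1 / (\<bar>x - \<mu>\<bar> + 1)"] by auto
  have "0 < s n" using assms by (rule eigen_systemD)
  with n have "\<bar>x - \<mu>\<bar> + 1 < 1 / s n" by (simp add: field_simps)
  then show ?thesis by (intro exI[of _ n]) linarith
qed

end

section \<open>Uniqueness of the listing of eigenvalues\<close>

lemma initial_segment_eq: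
  fixes D :: "nat set"
  assumes "finite D" "D \<subseteq> {1..}" "\<And>m n. n \<in> D \<Longrightarrow> 1 \<le> m \<Longrightarrow> m \<le> n \<Longrightarrow> m \<in> D"
  shows "D = {1..card D}"
proof (cases "D = {}")
  case False
  have "D = {1..Max D}"
  proof
    show "D \<subseteq> {1..Max D}" using assms(1,2) by auto
    show "{1..Max D} \<subseteq> D" using assms(3)[OF Max_in[OF assms(1) False]] by auto
  qed
  then have "card D = Max D" by (metis card_atLeastAtMost diff_Suc_1)
  with \<open>D = {1..Max D}\<close> show ?thesis by simp
qed simp

text \<open>For each x, the indices with value at most x form an initial segment by monotonicity,
  and its length is the sum of the multiplicities up to x, a number that depends on the graph only.
  Unboundedness of \<open>b\<close> makes this number finite.\<close>

lemma lists_eigenvalues_unique: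
  assumes a: "lists_eigenvalues \<Gamma> a" and b: "lists_eigenvalues \<Gamma> b"
    and unbounded: "\<And>x. \<exists>n\<ge>1. x < b n" and "1 \<le> n"
  shows "a n = b n"
proof -
  define fib where "fib c z = {n\<in>{1..}. complex_of_real (c n) = z}" for c :: "nat \<Rightarrow> real" and z
  have mono: "c m \<le> c n" if "lists_eigenvalues \<Gamma> c" "1 \<le> m" "m \<le> n" for c m n
    using that unfolding lists_eigenvalues_def by (auto intro: mono_onD)
  have fib: "finite (fib c z)" "card (fib c z) = multiplicity_of \<Gamma> z" if "lists_eigenvalues \<Gamma> c" for c z
    using that unfolding lists_eigenvalues_def fib_def by auto
  define low where "low c x = {n\<in>{1..}. c n \<le> x}" for c :: "nat \<Rightarrow> real" and x
  have fin_b: "finite (low b x)" for x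
  proof -
    obtain N where N: "1 \<le> N" "x < b N" using unbounded by blast
    have "low b x \<subseteq> {..N}"
    proof
      fix n assume "n \<in> low b x"
      then show "n \<in> {..N}" using mono[OF b N(1), of n] N(2) by (cases "n \<le> N") (auto simp: low_def)
    qed
    then show ?thesis by (rule finite_subset) simp
  qed
  have card_eq: "finite (low a x) \<and> card (low a x) = card (low b x)" for x
  proof -
    \<comment> \<open>The values of \<open>b\<close> up to x describe the low indices of
      \<open>a\<close> as well: a value taken by \<open>a\<close> has positive multiplicity and is
      therefore taken by \<open>b\<close>.\<close>
    define Z where "Z = (\<lambda>n. complex_of_real (b n)) ` low b x"
    have finZ: "finite Z" unfolding Z_def using fin_b by simp
    have union: "low c x = (\<Union>z\<in>Z. fib c z)" if c: "lists_eigenvalues \<Gamma> c" for c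
    proof (intro equalityI subsetI)
      fix n assume n: "n \<in> low c x"
      have "n \<in> fib c (of_real (c n))" using n by (simp add: fib_def low_def)
      then have "0 < card (fib c (of_real (c n)))" using fib(1)[OF c] card_gt_0_iff by blast
      then have "0 < card (fib b (of_real (c n)))" using fib(2)[OF c] fib(2)[OF b] by simp
      then have "fib b (of_real (c n)) \<noteq> {}" by (simp add: card_gt_0_iff)
      then obtain m where "m \<in> fib b (of_real (c n))" by (meson ex_in_conv)
      then have m: "1 \<le> m" "b m = c n" by (simp_all add: fib_def)
      then have "of_real (c n) \<in> Z" unfolding Z_def using n by (intro image_eqI[of _ _ m]) (auto simp: low_def)
      then show "n \<in> (\<Union>z\<in>Z. fib c z)" using \<open>n \<in> fib c (of_real (c n))\<close> by (rule UN_I)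
    next
      fix n assume "n \<in> (\<Union>z\<in>Z. fib c z)"
      then obtain m where "m \<in> low b x" "n \<in> fib c (of_real (b m))" unfolding Z_def by auto
      then show "n \<in> low c x" by (simp add: fib_def low_def)
    qed
    have card: "card (low c x) = (\<Sum>z\<in>Z. multiplicity_of \<Gamma> z)" if c: "lists_eigenvalues \<Gamma> c" for c
    proof -
      have "card (\<Union>z\<in>Z. fib c z) = (\<Sum>z\<in>Z. card (fib c z))"
        using finZ fib(1)[OF c] by (intro card_UN_disjoint) (auto simp: fib_def)
      then show ?thesis unfolding union[OF c] by (simp add: fib(2)[OF c])
    qed
    have "finite (low a x)" unfolding union[OF a] using finZ fib(1)[OF a] by simp
    then show ?thesis using card[OF a] card[OF b] by simp
  qed
  have seg: "low c x = {1..card (low c x)}" if c: "lists_eigenvalues \<Gamma> c" and "finite (low c x)" for c x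
  proof (rule initial_segment_eq[OF that(2)])
    show "low c x \<subseteq> {1..}" by (auto simp: low_def)
    show "m \<in> low c x" if "n \<in> low c x" "1 \<le> m" "m \<le> n" for m n
      using that mono[OF c that(2,3)] by (simp add: low_def)
  qed
  have "low a x = low b x" for x
    using seg[OF a, of x] seg[OF b, of x] card_eq[of x] fin_b[of x] by simp
  then have "n \<in> low a x \<longleftrightarrow> n \<in> low b x" for x by simp
  then have "a n \<le> x \<longleftrightarrow> b n \<le> x" for x using \<open>1 \<le> n\<close> by (simp add: low_def)
  from this[of "a n"] this[of "b n"] show ?thesis by simp
qed

lemma graph_operator_exists:
  fixes \<Gamma> :: "'e qgraph"
  assumes fin: "finite (edges \<Gamma>)" "edges \<Gamma> \<noteq> {}"
    and len: "\<And>e. e \<in> edges \<Gamma> \<Longrightarrow> 0 < len \<Gamma> e"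
    and V: "\<And>e. e \<in> edges \<Gamma> \<Longrightarrow> L2_on {0..len \<Gamma> e} (V e)"
    and L: "lagrangian (edge_ends \<Gamma>) L"
  obtains C \<mu>\<^sub>0 where "\<And>\<mu>. \<mu> \<le> \<mu>\<^sub>0 \<Longrightarrow> graph_operator \<Gamma> (\<lambda>e x. V e x - \<mu>) L C"
proof -
  have finE: "finite (edge_ends \<Gamma>)" using fin by simp
  obtain C where C: "0 \<le> C"
    "\<And>F F'. L F F' \<Longrightarrow> cmod (\<Sum>i\<in>edge_ends \<Gamma>. F' i * cnj (F i)) \<le> C * (\<Sum>i\<in>edge_ends \<Gamma>. (cmod (F i))\<^sup>2)"
    by (rule lagrangian_form_bounded[OF finE L]) (rule that)
  have "\<exists>M. \<forall>m u. M \<le> m \<longrightarrow> C1_edge (len \<Gamma> e) u \<longrightarrow>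
      C * ((cmod (u 0))\<^sup>2 + (cmod (u (len \<Gamma> e)))\<^sup>2) + edge_dirichlet (len \<Gamma> e) u / 2 + edge_mass (len \<Gamma> e) u
      \<le> Re (edge_form (len \<Gamma> e) (\<lambda>x. V e x + m) u u)" if e: "e \<in> edges \<Gamma>" for e
    using len[OF e] L2_on_imp_absolutely_integrable[OF V[OF e]] C(1)
    by (rule edge_form_coercive) (rule exI, intro allI impI)
  then obtain M where M: "\<And>e m u. e \<in> edges \<Gamma> \<Longrightarrow> M e \<le> m \<Longrightarrow> C1_edge (len \<Gamma> e) u \<Longrightarrow>
      C * ((cmod (u 0))\<^sup>2 + (cmod (u (len \<Gamma> e)))\<^sup>2) + edge_dirichlet (len \<Gamma> e) u / 2 + edge_mass (len \<Gamma> e) u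
      \<le> Re (edge_form (len \<Gamma> e) (\<lambda>x. V e x + m) u u)" by metis
  show thesis
  proof (rule that[of "- Max (M ` edges \<Gamma>)"])
    fix \<mu> assume \<mu>: "\<mu> \<le> - Max (M ` edges \<Gamma>)"
    show "graph_operator \<Gamma> (\<lambda>e x. V e x - \<mu>) L C"
    proof unfold_locales
      fix e assume e: "e \<in> edges \<Gamma>"
      show "L2_on {0..len \<Gamma> e} (\<lambda>x. V e x - \<mu>)"
      proof -
        have "L2_on {0..len \<Gamma> e} (\<lambda>x. complex_of_real (V e x) * 1 - of_real \<mu>)"
          using V[OF e] by (rule L2_on_affine) auto
        then have "L2_on {0..len \<Gamma> e} (\<lambda>x. complex_of_real (V e x - \<mu>))" by (simp only: mult_1_right of_real_diff)
        then have "integrable (lebesgue_on {0..len \<Gamma> e}) (\<lambda>x. (norm (V e x - \<mu>))\<^sup>2)"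
          unfolding L2_on_def norm_of_real by simp
        moreover have "(\<lambda>x. V e x - \<mu>) \<in> borel_measurable (lebesgue_on {0..len \<Gamma> e})"
          using V[OF e] unfolding L2_on_def by (intro borel_measurable_diff) auto
        ultimately show ?thesis unfolding L2_on_def by simp
      qed
      have "M e \<le> Max (M ` edges \<Gamma>)" using e fin by simp
      then have "M e \<le> - \<mu>" using \<mu> by linarith
      then show "C * ((cmod (u 0))\<^sup>2 + (cmod (u (len \<Gamma> e)))\<^sup>2) + edge_dirichlet (len \<Gamma> e) u / 2 + edge_mass (len \<Gamma> e) u
          \<le> Re (edge_form (len \<Gamma> e) (\<lambda>x. V e x - \<mu>) u u)" if "C1_edge (len \<Gamma> e) u" for u
        using M[OF e _ that, of "- \<mu>"] by simp
    qed (use fin len L C(2) in auto)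
  qed
qed

section \<open>Gluing two vertices\<close>

lemma partition_on_glue:
  assumes P: "partition_on A P" and v: "v\<^sub>0 \<in> P" "v\<^sub>1 \<in> P"
  shows "partition_on A (insert (v\<^sub>0 \<union> v\<^sub>1) (P - {v\<^sub>0, v\<^sub>1}))"
proof (rule partition_onI)
  show "\<Union> (insert (v\<^sub>0 \<union> v\<^sub>1) (P - {v\<^sub>0, v\<^sub>1})) = A" using partition_onD1[OF P] v by blast
  show "{} \<notin> insert (v\<^sub>0 \<union> v\<^sub>1) (P - {v\<^sub>0, v\<^sub>1})"
    using partition_onD3[OF P] v by auto
  have d: "p \<inter> q = {}" if "p \<in> P" "q \<in> P" "p \<noteq> q" for p q
    using partition_onD2[OF P] that by (auto simp: disjoint_def)
  show "disjnt p q" if "p \<in> insert (v\<^sub>0 \<union> v\<^sub>1) (P - {v\<^sub>0, v\<^sub>1})" "q \<in> insert (v\<^sub>0 \<union> v\<^sub>1) (P - {v\<^sub>0, v\<^sub>1})" "p \<noteq> q" for p q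
  proof -
    have u: "(v\<^sub>0 \<union> v\<^sub>1) \<inter> w = {}" if "w \<in> P - {v\<^sub>0, v\<^sub>1}" for w
      using d[of v\<^sub>0 w] d[of v\<^sub>1 w] v that by blast
    from that consider "p = v\<^sub>0 \<union> v\<^sub>1" "q \<in> P - {v\<^sub>0, v\<^sub>1}" | "q = v\<^sub>0 \<union> v\<^sub>1" "p \<in> P - {v\<^sub>0, v\<^sub>1}"
      | "p \<in> P" "q \<in> P" by blast
    then show ?thesis
    proof cases
      case 1
      then show ?thesis using u[of q] by (simp add: disjnt_def)
    next
      case 2
      then show ?thesis using u[of p] by (simp add: disjnt_def Int_commute)
    next
      case 3
      then show ?thesis using d \<open>p \<noteq> q\<close> by (simp add: disjnt_def)
    qed
  qed
qed

theorem theorem5p3: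
  fixes \<Gamma> :: "'e qgraph" and v\<^sub>0 v\<^sub>1 :: "'e vertex" and \<alpha>\<^sub>0 \<alpha>\<^sub>1 :: real and n :: nat
  assumes "compact_quantum_graph \<Gamma>"
    and "v\<^sub>0 \<in> vertices \<Gamma>" and "v\<^sub>1 \<in> vertices \<Gamma>" and "v\<^sub>0 \<noteq> v\<^sub>1"
    and "cond \<Gamma> v\<^sub>0 = delta_condition \<alpha>\<^sub>0 v\<^sub>0"
    and "cond \<Gamma> v\<^sub>1 = delta_condition \<alpha>\<^sub>1 v\<^sub>1"
    and "n \<ge> 1"
  shows "qg_eigenvalue \<Gamma> n \<le> qg_eigenvalue (glue \<Gamma> v\<^sub>0 v\<^sub>1 (\<alpha>\<^sub>0 + \<alpha>\<^sub>1)) n \<and>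
    qg_eigenvalue (glue \<Gamma> v\<^sub>0 v\<^sub>1 (\<alpha>\<^sub>0 + \<alpha>\<^sub>1)) n \<le> qg_eigenvalue \<Gamma> (n + 1)"
proof -
  define \<Gamma>' where "\<Gamma>' = glue \<Gamma> v\<^sub>0 v\<^sub>1 (\<alpha>\<^sub>0 + \<alpha>\<^sub>1)"
  have \<Gamma>': "edges \<Gamma>' = edges \<Gamma>" "len \<Gamma>' = len \<Gamma>" "pot \<Gamma>' = pot \<Gamma>"
    "vertices \<Gamma>' = insert (v\<^sub>0 \<union> v\<^sub>1) (vertices \<Gamma> - {v\<^sub>0, v\<^sub>1})"
    "cond \<Gamma>' = (cond \<Gamma>)(v\<^sub>0 \<union> v\<^sub>1 := delta_condition (\<alpha>\<^sub>0 + \<alpha>\<^sub>1) (v\<^sub>0 \<union> v\<^sub>1))"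
    by (simp_all add: \<Gamma>'_def glue_def)
  have fin: "finite (edges \<Gamma>)" and len: "\<And>e. e \<in> edges \<Gamma> \<Longrightarrow> 0 < len \<Gamma> e"
    and pot: "\<And>e. e \<in> edges \<Gamma> \<Longrightarrow> L2_on {0..len \<Gamma> e} (pot \<Gamma> e)"
    and P: "partition_on (edge_ends \<Gamma>) (vertices \<Gamma>)"
    and sa: "\<And>w. w \<in> vertices \<Gamma> \<Longrightarrow> self_adjoint_condition w (cond \<Gamma> w)"
    using assms(1) unfolding compact_quantum_graph_def by blast+
  have finE: "finite (edge_ends \<Gamma>)" using fin by simp
  have P': "partition_on (edge_ends \<Gamma>) (vertices \<Gamma>')"
    unfolding \<Gamma>' using P assms(2,3) by (rule partition_on_glue)
  have sub: "w \<subseteq> edge_ends \<Gamma>" if "w \<in> vertices \<Gamma>" for w using partition_onD1[OF P] that by blast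
  have disj: "v \<inter> w = {}" if "v \<in> vertices \<Gamma>" "w \<in> vertices \<Gamma>" "v \<noteq> w" for v w
    using partition_onD2[OF P] that by (auto simp: disjoint_def)
  have nonempty: "w \<noteq> {}" if "w \<in> vertices \<Gamma>" for w using partition_onD3[OF P] that by blast
  have lag: "lagrangian w (cond \<Gamma> w)" if "w \<in> vertices \<Gamma>" for w
    using sa[OF that] by (rule lagrangian_self_adjoint_condition)
  \<comment> \<open>One edge-end at each vertex represents it: under the delta conditions the values
    there do not depend on the edge-end.\<close>
  obtain i where i: "i \<in> v\<^sub>0" using nonempty[OF assms(2)] by blast
  obtain j where j: "j \<in> v\<^sub>1" using nonempty[OF assms(3)] by blast
  have v01: "v\<^sub>0 \<inter> v\<^sub>1 = {}" using disj assms(2-4) by blast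
  have ij: "i \<in> edge_ends \<Gamma>" "j \<in> edge_ends \<Gamma>" "i \<noteq> j"
    using i j sub[OF assms(2)] sub[OF assms(3)] v01 by blast+
  have ne: "edges \<Gamma> \<noteq> {}" using ij by auto
  have fv: "finite v\<^sub>0" "finite v\<^sub>1" using sub[OF assms(2)] sub[OF assms(3)] finE finite_subset by blast+
  \<comment> \<open>The union \<open>v\<^sub>0 \<union> v\<^sub>1\<close> contains \<open>i\<close>
    and thus is none of the remaining vertices, so the update of \<open>cond\<close> in
    \<open>glue\<close> leaves their conditions alone; a change of data at \<open>i\<close> and
    \<open>j\<close> does not reach them either.\<close>
  have other: "w \<noteq> v\<^sub>0 \<union> v\<^sub>1" "i \<notin> w" "j \<notin> w" if "w \<in> vertices \<Gamma> - {v\<^sub>0, v\<^sub>1}" for w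
    using that i j disj[of w v\<^sub>0] disj[of w v\<^sub>1] assms(2,3) by auto
  define L where "L = boundary_condition \<Gamma>"
  define L' where "L' = boundary_condition \<Gamma>'"
  have L: "lagrangian (edge_ends \<Gamma>) L"
    using lagrangian_partition[OF finE P, of "cond \<Gamma>"] lag
    by (simp add: L_def boundary_condition_def[abs_def])
  have "lagrangian w (cond \<Gamma>' w)" if w: "w \<in> vertices \<Gamma>'" for w
  proof (cases "w = v\<^sub>0 \<union> v\<^sub>1")
    case True
    have "lagrangian (v\<^sub>0 \<union> v\<^sub>1) (delta_condition (\<alpha>\<^sub>0 + \<alpha>\<^sub>1) (v\<^sub>0 \<union> v\<^sub>1))"
      using fv i by (intro lagrangian_delta_condition) auto
    then show ?thesis by (simp add: \<Gamma>'(5) True)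
  next
    case False
    then show ?thesis using w lag by (simp add: \<Gamma>'(4,5))
  qed
  then have L': "lagrangian (edge_ends \<Gamma>) L'"
    using lagrangian_partition[OF finE P', of "cond \<Gamma>'"]
    by (simp add: L'_def boundary_condition_def[abs_def])
  have glue: "F i = F j \<and> (\<exists>t. L F (\<lambda>k. F' k - (if k = i then t else if k = j then - t else 0)))"
    if "L' F F'" for F F'
  proof -
    have c: "cond \<Gamma>' w F F'" if "w \<in> vertices \<Gamma>'" for w
      using \<open>L' F F'\<close> that by (simp add: L'_def boundary_condition_def)
    have d: "delta_condition (\<alpha>\<^sub>0 + \<alpha>\<^sub>1) (v\<^sub>0 \<union> v\<^sub>1) F F'"
      using c[of "v\<^sub>0 \<union> v\<^sub>1"] by (simp add: \<Gamma>'(4,5))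
    have F: "F k = F i" if "k \<in> v\<^sub>0 \<union> v\<^sub>1" for k
      using d i that unfolding delta_condition_def by blast
    have sum: "(\<Sum>k\<in>v\<^sub>0. F' k) + (\<Sum>k\<in>v\<^sub>1. F' k) = of_real (\<alpha>\<^sub>0 + \<alpha>\<^sub>1) * F i"
      using d i unfolding delta_condition_def sum.union_disjoint[OF fv v01] by blast
    \<comment> \<open>The excess of the derivative sum at \<open>v\<^sub>0\<close> over its delta
      condition. Moving it from \<open>i\<close> to \<open>j\<close> restores both conditions,
      because the total over the two vertices is already correct.\<close>
    define t where "t = (\<Sum>k\<in>v\<^sub>0. F' k) - of_real \<alpha>\<^sub>0 * F i"
    define G where "G k = F' k - (if k = i then t else if k = j then - t else 0)" for k
    have G0: "(\<Sum>k\<in>v\<^sub>0. G k) = of_real \<alpha>\<^sub>0 * F i"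
    proof -
      have "(\<Sum>k\<in>v\<^sub>0. G k) = (\<Sum>k\<in>v\<^sub>0. F' k - (if k = i then t else 0))"
        using j v01 by (intro sum.cong) (auto simp: G_def)
      then show ?thesis using i fv by (simp add: sum_subtractf t_def)
    qed
    have G1: "(\<Sum>k\<in>v\<^sub>1. G k) = of_real \<alpha>\<^sub>1 * F i"
    proof -
      have "(\<Sum>k\<in>v\<^sub>1. G k) = (\<Sum>k\<in>v\<^sub>1. F' k + (if k = j then t else 0))"
        using i v01 ij(3) by (intro sum.cong) (auto simp: G_def)
      also have "\<dots> = (\<Sum>k\<in>v\<^sub>1. F' k) + t" using j fv by (simp add: sum.distrib)
      also have "\<dots> = ((\<Sum>k\<in>v\<^sub>0. F' k) + (\<Sum>k\<in>v\<^sub>1. F' k)) - of_real \<alpha>\<^sub>0 * F i" by (simp add: t_def)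
      finally show ?thesis unfolding sum by (simp add: algebra_simps)
    qed
    have "cond \<Gamma> w F G" if w: "w \<in> vertices \<Gamma>" for w
    proof -
      consider "w = v\<^sub>0" | "w = v\<^sub>1" | "w \<in> vertices \<Gamma> - {v\<^sub>0, v\<^sub>1}" using w by blast
      then show ?thesis
      proof cases
        case 1
        show ?thesis unfolding 1 assms(5) delta_condition_def using F G0 by auto
      next
        case 2
        show ?thesis unfolding 2 assms(6) delta_condition_def using F G1 by auto
      next
        case 3
        have "cond \<Gamma> w F F'" using c[of w] 3 other(1)[OF 3] by (simp add: \<Gamma>'(4,5))
        then show ?thesis
          by (rule lagrangian_cong[OF lag[OF w]]) (use other[OF 3] in \<open>auto simp: G_def\<close>)
      qed
    qed
    then have "L F G" by (simp add: L_def boundary_condition_def)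
    then show ?thesis using F[of j] j by (auto simp: G_def[abs_def])
  qed
  obtain C \<mu>\<^sub>0 where C: "\<And>\<mu>. \<mu> \<le> \<mu>\<^sub>0 \<Longrightarrow> graph_operator \<Gamma> (\<lambda>e x. pot \<Gamma> e x - \<mu>) L C"
    using graph_operator_exists[OF fin ne len pot L] by blast
  obtain C' \<mu>\<^sub>1 where C': "\<And>\<mu>. \<mu> \<le> \<mu>\<^sub>1 \<Longrightarrow> graph_operator \<Gamma> (\<lambda>e x. pot \<Gamma> e x - \<mu>) L' C'"
    using graph_operator_exists[OF fin ne len pot L'] by blast
  \<comment> \<open>A common shift, so that both resolvents belong to the same \<open>Q\<close> and
    can be compared.\<close>
  define \<mu> where "\<mu> = min \<mu>\<^sub>0 \<mu>\<^sub>1"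
  define Q where "Q = (\<lambda>e x. pot \<Gamma> e x - \<mu>)"
  interpret G: graph_operator \<Gamma> Q L C unfolding Q_def by (rule C) (simp add: \<mu>_def)
  interpret G': graph_operator \<Gamma> Q L' C' unfolding Q_def by (rule C') (simp add: \<mu>_def)
  obtain f s where es: "G.eigen_system G.resolvent f s"
    using compact_positive.eigen_system_exists[OF G.compact_positive_resolvent] by blast
  obtain f' s' where es': "G.eigen_system G'.resolvent f' s'"
    using compact_positive.eigen_system_exists[OF G'.compact_positive_resolvent] by blast
  have s0: "0 < s m" "0 < s' m" for m
    using G.eigen_systemD(3)[OF es] G.eigen_systemD(3)[OF es'] by auto
  have list: "lists_eigenvalues \<Gamma> (\<lambda>n. \<mu> + 1 / s (n - 1))"
    by (rule G.lists_eigenvalues_eigen_system[OF refl refl L_def[symmetric] pot Q_def es])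
  have list': "lists_eigenvalues \<Gamma>' (\<lambda>n. \<mu> + 1 / s' (n - 1))"
    by (rule G'.lists_eigenvalues_eigen_system[OF \<Gamma>'(1,2) L'_def[symmetric] _ _ es'])
      (simp_all add: \<Gamma>'(3) pot Q_def)
  have ev: "qg_eigenvalue \<Gamma> m = \<mu> + 1 / s (m - 1)" if "1 \<le> m" for m
  proof (rule lists_eigenvalues_unique[OF _ list _ that])
    show "lists_eigenvalues \<Gamma> (qg_eigenvalue \<Gamma>)"
      unfolding qg_eigenvalue_def using list by (rule someI[of "lists_eigenvalues \<Gamma>"])
    show "\<exists>n\<ge>1. x < \<mu> + 1 / s (n - 1)" for x
      using G.eigen_system_unbounded[OF es, of x \<mu>] by (metis diff_Suc_1 le_add1 plus_1_eq_Suc)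
  qed
  have ev': "qg_eigenvalue \<Gamma>' m = \<mu> + 1 / s' (m - 1)" if "1 \<le> m" for m
  proof (rule lists_eigenvalues_unique[OF _ list' _ that])
    show "lists_eigenvalues \<Gamma>' (qg_eigenvalue \<Gamma>')"
      unfolding qg_eigenvalue_def using list' by (rule someI[of "lists_eigenvalues \<Gamma>'"])
    show "\<exists>n\<ge>1. x < \<mu> + 1 / s' (n - 1)" for x
      using G'.eigen_system_unbounded[OF es', of x \<mu>] by (metis diff_Suc_1 le_add1 plus_1_eq_Suc)
  qed
  note cmp = G.resolvent_glue[OF G.graph_operator_axioms G'.graph_operator_axioms ij glue]
  \<comment> \<open>The roles are exchanged: the form of the glued resolvent lies below the other
    one for every \<open>h\<close>, so the zero functional serves and no index is lost.\<close>
  have le1: "s' m \<le> s m" for m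
    by (rule G.eigen_system_compare(2)[OF G'.compact_positive_resolvent es' es, of "\<lambda>_. 0"])
      (simp_all add: cmp(1))
  \<comment> \<open>The single linear condition under which the inequality between the forms is
    reversed: no jump of the original resolvent between the two vertices.\<close>
  define \<phi> where "\<phi> h = end_value \<Gamma> (G.resolvent h) i - end_value \<Gamma> (G.resolvent h) j" for h
  have le2: "s (Suc m) \<le> s' m" for m
  proof (rule G.eigen_system_compare(1)[OF G.compact_positive_resolvent es es', of \<phi>])
    fix x y assume x: "x \<in> continuous_functions \<Gamma>" and y: "y \<in> continuous_functions \<Gamma>"
    show "\<phi> (x + y) = \<phi> x + \<phi> y"
      using G.resolvent_lincomb[OF x y, of 1 1]
      by (simp add: \<phi>_def plus_fun_def end_value_def split: prod.splits)
  next
    fix c x assume x: "x \<in> continuous_functions \<Gamma>"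
    show "\<phi> (scale_fun c x) = c * \<phi> x"
      using G.resolvent_lincomb[OF x x, of c 0]
      by (simp add: \<phi>_def scale_fun_def end_value_def algebra_simps split: prod.splits)
  next
    fix h assume "h \<in> continuous_functions \<Gamma>" "\<phi> h = 0"
    then show "Re (graph_ip \<Gamma> (G.resolvent h) h) \<le> Re (graph_ip \<Gamma> (G'.resolvent h) h)"
      by (intro cmp(2)) (simp_all add: \<phi>_def)
  qed
  \<comment> \<open>Eigenvalue n belongs to \<open>s (n - 1)\<close> and eigenvalue n + 1 of the
    original graph to \<open>s n\<close>; taking reciprocals reverses \<open>le1\<close> and
    \<open>le2\<close>.\<close>
  have "1 / s (n - 1) \<le> 1 / s' (n - 1)" using le1 s0 by (intro divide_left_mono) auto
  moreover have "1 / s' (n - 1) \<le> 1 / s n"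
    using le2[of "n - 1"] s0 \<open>n \<ge> 1\<close> by (intro divide_left_mono) auto
  ultimately show ?thesis
    using ev[OF \<open>n \<ge> 1\<close>] ev'[OF \<open>n \<ge> 1\<close>] ev[of "n + 1"] unfolding \<Gamma>'_def by simp
qed

end
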